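(* Assume: (1) $Z$ is independent of $\eta$, the $Z_t$ are i.i.d., and for each $\vartheta\in\Theta$, $t\in\mathbb Z$, $\varphi(Z_t,\vartheta)$ has a density $f(x,\vartheta)$; (2) $\eta$ is a Markov chain and there are $\kappa\ge 1$, $\phi_*>0$ such that $\Pr\{\eta_t=b\mid\eta_s=a\}\ge\phi_*$ for all $a,b\in\mathcal H$ and $s,t\in\mathbb Z$ with $|s-t|\ge\kappa$; (3) for each $z\in\mathcal Z$, $a,b\in\mathcal H$, $0<f(\varphi(z,\theta_a(\varepsilon)),\theta_b(\varepsilon))<\infty$ and this is continuous in $\varepsilon$; (4) there is $q\in\mathbb N$ such that for each $z\in\mathcal Z$, $a,b\in\mathcal H$, $f(\varphi(z,\theta_a(\varepsilon)),\theta_b(\varepsilon))$ as a function of $\varepsilon$ belongs to $C^{(q)}$ and all its partial derivatives of order $\le q$ are continuous in $(z,\varepsilon)$; furthermore, for every $r>0$ there is $c=c(r)>2$ such that $\Pr\{M_q(Z_0,r)\ge u\}=O((\log u)^{-c})$ as $u\to\infty$. Then almost surely, as $n\to\infty$, for each nonzero multi-index $\nu$ with $|\nu|\le q$ and each $a\in\mathcal H$, $\Lambda_{\pm n,a}^{(\nu)}$ converge uniformly on every compact set of $\varepsilon$. Let $$\mathsf L_{\nu,a}(\varepsilon)=\lim_{n\to\infty}\Lambda_{n,a}^{(\nu)}(\varepsilon),\qquad \bar{\mathsf L}_{\nu,a}(\varepsilon)=\lim_{n\to\infty}\Lambda_{-n,a}^{(\nu)}(\varepsilon).$$ There is an increasing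 deterministic function $r_\nu(\varepsilon_0)\in(0,1)$ of $\varepsilon_0>0$, such that almost surely, as $n\to\infty$, $$\max_a\sup_{|\varepsilon|\le\varepsilon_0}\bigl|\Lambda_{n,a}^{(\nu)}(\varepsilon)-\mathsf L_{\nu,a}(\varepsilon)\bigr|=o(r_\nu(\varepsilon_0)^n)\qquad\forall\,\varepsilon_0>0,$$ and likewise for $\Lambda_{-n,a}^{(\nu)}$ and $\bar{\mathsf L}_{\nu,a}(\varepsilon)$.
   Context: Multi-index notation: for $h:\mathbb R^s\to\mathbb R$ and $\nu=(\nu_1,\ldots,\nu_s)$ with nonnegative integer entries, $|\nu|=\nu_1+\cdots+\nu_s$, $h^{(\nu)}=\partial^{|\nu|}h/\partial x_1^{\nu_1}\cdots\partial x_s^{\nu_s}$, $h^{(0)}=h$; $h\in C^{(q)}$ means $h^{(\nu)}$ exists and is continuous for every $|\nu|\le q$. Derivatives of random functions of $\varepsilon$ are taken in $\varepsilon$ with the realization of $(\eta,Z)$ fixed. Model: $\mathcal H$ is a finite set partitioned into nonempty subsets $\mathcal H_0$ and $\mathcal H_1$; $\eta=(\eta_t)_{t\in\mathbb Z}$ is an $\mathcal H$-valued process; $Z=(Z_t)_{t\in\mathbb Z}$ takes values in a Euclidean space $\mathcal Z$; $\Theta\subset\mathbb R^d$ is open; $\varphi(\cdot,\vartheta):\mathcal Z\to\mathcal X$, $\vartheta\in\Theta$, is a family of maps into a Euclidean space $\mathcal X$; $\theta_a:\mathbb R^p\to\Theta$, $a\in\mathcal H$, are functions; $\varepsilon\in\mathbb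 R^p$. With $\ell_{z,ab}(\varepsilon)=\ln f(\varphi(z,\theta_a(\varepsilon)),\theta_b(\varepsilon))$: $M_0(z,r)=1$ and, for $k>0$, $M_k(z,r)=\sup\{|\ell_{z,ab}^{(\nu)}(\varepsilon)|: 1\le|\nu|\le k,\ |\varepsilon|\le r,\ a,b\in\mathcal H\}$. Let $\sigma=(\sigma_t)$ be an independent copy of $\eta$, also independent of $Z$; $\mathsf E_\sigma$ is expectation with respect to $\sigma$ ($\eta$, $Z$ held fixed). Let $\psi_t(\varepsilon,c)=f(\varphi(Z_t,\theta_{\eta_t}(\varepsilon)),\theta_c(\varepsilon))$ for $c\in\mathcal H$. Fix an arbitrary $\imath\in\mathcal H$ and define, for $n\ge1$, $$\Lambda_{\pm n,a}(\varepsilon)=\frac{\mathsf E_\sigma[\prod_{s=1}^n\psi_{\pm s}(\varepsilon,\sigma_{\pm s})\mid\sigma_0=a]}{\mathsf E_\sigma[\prod_{s=1}^n\psi_{\pm s}(\varepsilon,\sigma_{\pm s})\mid\sigma_0=\imath]}.$$ *)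

theory Defs
  imports "HOL-Probability.Probability" "HOL-Library.Landau_Symbols"
begin

section \<open>Multi-index derivatives\<close>

text \<open>A multi-index on \<open>real ^ 'p\<close> is a function \<open>\<nu> :: 'p \<Rightarrow> nat\<close>. The linear order on the index
  type is only used to fix the order of differentiation
  in \<open>\<partial>\<^sup>|\<^sup>\<nu>\<^sup>| h / \<partial>x\<^sub>1\<^sup>\<nu>\<^sup>1 \<dots> \<partial>x\<^sub>s\<^sup>\<nu>\<^sup>s\<close>.\<close>

definition mi_size :: "('p::finite \<Rightarrow> nat) \<Rightarrow> nat" where
  "mi_size \<nu> = (\<Sum>i\<in>UNIV. \<nu> i)"

definition mi_list :: "('p::{finite,linorder} \<Rightarrow> nat) \<Rightarrow> 'p list" where
  "mi_list \<nu> = concat (map (\<lambda>i. replicate (\<nu> i) i) (sorted_list_of_set UNIV))"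

definition partial_deriv :: "'p::finite \<Rightarrow> (real ^ 'p \<Rightarrow> real) \<Rightarrow> real ^ 'p \<Rightarrow> real" where
  "partial_deriv i h x = deriv (\<lambda>t. h (x + t *\<^sub>R axis i 1)) 0"

definition has_partial :: "'p::finite \<Rightarrow> (real ^ 'p \<Rightarrow> real) \<Rightarrow> bool" where
  "has_partial i h \<longleftrightarrow> (\<forall>x. (\<lambda>t. h (x + t *\<^sub>R axis i 1)) differentiable (at (0::real)))"

text \<open>In a list \<open>i # is\<close> the derivatives along \<open>is\<close> are taken first.\<close>

primrec iter_partial_exists :: "'p::finite list \<Rightarrow> (real ^ 'p \<Rightarrow> real) \<Rightarrow> bool" where
  "iter_partial_exists [] h \<longleftrightarrow> True"
| "iter_partial_exists (i # is) h \<longleftrightarrow>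
     iter_partial_exists is h \<and> has_partial i (foldr partial_deriv is h)"

definition mderiv :: "('p \<Rightarrow> nat) \<Rightarrow> (real ^ 'p::{finite,linorder} \<Rightarrow> real) \<Rightarrow>
    real ^ 'p::{finite,linorder} \<Rightarrow> real" where
  "mderiv \<nu> h = foldr partial_deriv (mi_list \<nu>) h"

definition mderiv_exists :: "('p \<Rightarrow> nat) \<Rightarrow> (real ^ 'p::{finite,linorder} \<Rightarrow> real) \<Rightarrow> bool" where
  "mderiv_exists \<nu> h \<longleftrightarrow> iter_partial_exists (mi_list \<nu>) h"

definition C_class :: "nat \<Rightarrow> (real ^ 'p::{finite,linorder} \<Rightarrow> real) \<Rightarrow> bool" where
  "C_class q h \<longleftrightarrow>
     (\<forall>\<nu>. mi_size \<nu> \<le> q \<longrightarrow> mderiv_exists \<nu> h \<and> continuous_on UNIV (mderiv \<nu> h))"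

section \<open>The model\<close>

text \<open>Independence of two random variables; \<open>prob_space.indep_var\<close> requires both to have values in
  the same type.\<close>

definition indep_rv :: "'w measure \<Rightarrow> 'a measure \<Rightarrow> ('w \<Rightarrow> 'a) \<Rightarrow> 'b measure \<Rightarrow> ('w \<Rightarrow> 'b) \<Rightarrow> bool" where
  "indep_rv P A X B Y \<longleftrightarrow> X \<in> measurable P A \<and> Y \<in> measurable P B \<and>
     prob_space.indep_set P {X -` S \<inter> space P | S. S \<in> sets A} {Y -` T \<inter> space P | T. T \<in> sets B}"

text \<open>Markov property, without any assumption of homogeneity or stationarity; the process is indexed
  by all integers, so the conditioning is on arbitrary finite stretches of the past.\<close>

definition markov_chain :: "'w measure \<Rightarrow> (int \<Rightarrow> 'w \<Rightarrow> 'h) \<Rightarrow> bool" where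
  "markov_chain P \<eta> \<longleftrightarrow>
     (\<forall>t. \<eta> t \<in> measurable P (count_space UNIV)) \<and>
     (\<forall>s t x. s \<le> t \<longrightarrow> \<P>(\<omega> in P. \<forall>i\<in>{s..t}. \<eta> i \<omega> = x i) > 0 \<longrightarrow>
        \<P>(\<omega> in P. \<eta> (t + 1) \<omega> = x (t + 1) \<bar> \<forall>i\<in>{s..t}. \<eta> i \<omega> = x i) =
        \<P>(\<omega> in P. \<eta> (t + 1) \<omega> = x (t + 1) \<bar> \<eta> t \<omega> = x t))"

text \<open>\<open>lik f \<phi> \<theta> z a b \<epsilon>\<close> is \<open>f(\<phi>(z,\<theta>\<^sub>a(\<epsilon>)),\<theta>\<^sub>b(\<epsilon>))\<close> as a real number. Densities are
  \<open>ennreal\<close>-valued, so that their finiteness at these points is a genuine hypothesis.\<close>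

definition lik :: "('x \<Rightarrow> 't \<Rightarrow> ennreal) \<Rightarrow> ('z \<Rightarrow> 't \<Rightarrow> 'x) \<Rightarrow> ('h \<Rightarrow> real ^ 'p \<Rightarrow> 't) \<Rightarrow>
    'z \<Rightarrow> 'h \<Rightarrow> 'h \<Rightarrow> real ^ 'p \<Rightarrow> real" where
  "lik f \<phi> \<theta> z a b \<epsilon> = enn2real (f (\<phi> z (\<theta> a \<epsilon>)) (\<theta> b \<epsilon>))"

text \<open>In the following definitions \<open>g\<close> stands for \<open>lik f \<phi> \<theta>\<close>.\<close>

definition log_deriv_bound :: "('z \<Rightarrow> 'h \<Rightarrow> 'h \<Rightarrow> real ^ 'p::{finite,linorder} \<Rightarrow> real) \<Rightarrow>
    nat \<Rightarrow> 'z \<Rightarrow> real \<Rightarrow> real" where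
  "log_deriv_bound g k z r =
     (if k = 0 then 1
      else Sup {\<bar>mderiv \<nu> (\<lambda>\<epsilon>. ln (g z a b \<epsilon>)) \<epsilon>\<bar> | \<nu> \<epsilon> a b.
                  1 \<le> mi_size \<nu> \<and> mi_size \<nu> \<le> k \<and> norm \<epsilon> \<le> r})"

definition cond_expect :: "'v measure \<Rightarrow> ('v \<Rightarrow> real) \<Rightarrow> ('v \<Rightarrow> bool) \<Rightarrow> real" where
  "cond_expect Q X A =
     (\<integral>v. X v * indicator {v \<in> space Q. A v} v \<partial>Q) / \<P>(v in Q. A v)"

text \<open>The independent copy \<open>\<sigma>\<close> lives on its own probability space \<open>Q\<close>, that is, on the second
  factor of a product space whose first factor carries \<open>\<eta>\<close> and \<open>Z\<close>; \<open>E\<^sub>\<sigma>\<close> with \<open>\<eta>\<close> and \<open>Z\<close> held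
  fixed is then integration over \<open>Q\<close>. The arguments \<open>h\<close> and \<open>z\<close> are the realizations of \<open>\<eta>\<close> and
  \<open>Z\<close>, and \<open>d\<close> is the sign: \<open>Lambda Q \<sigma> g \<iota> h z d n a\<close> is \<open>\<Lambda>\<^sub>n\<^sub>,\<^sub>a\<close> for \<open>d = 1\<close> and
  \<open>\<Lambda>\<^sub>-\<^sub>n\<^sub>,\<^sub>a\<close> for \<open>d = -1\<close>.\<close>

definition Lambda :: "'v measure \<Rightarrow> (int \<Rightarrow> 'v \<Rightarrow> 'h) \<Rightarrow> ('z \<Rightarrow> 'h \<Rightarrow> 'h \<Rightarrow> real ^ 'p \<Rightarrow> real) \<Rightarrow> 'h \<Rightarrow>
    (int \<Rightarrow> 'h) \<Rightarrow> (int \<Rightarrow> 'z) \<Rightarrow> int \<Rightarrow> nat \<Rightarrow> 'h \<Rightarrow> real ^ 'p \<Rightarrow> real" where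
  "Lambda Q \<sigma> g \<iota> h z d n a \<epsilon> =
     cond_expect Q (\<lambda>v. \<Prod>s=1..n. g (z (d * int s)) (h (d * int s)) (\<sigma> (d * int s) v) \<epsilon>)
       (\<lambda>v. \<sigma> 0 v = a) /
     cond_expect Q (\<lambda>v. \<Prod>s=1..n. g (z (d * int s)) (h (d * int s)) (\<sigma> (d * int s) v) \<epsilon>)
       (\<lambda>v. \<sigma> 0 v = \<iota>)"

definition Lambda_lim :: "'v measure \<Rightarrow> (int \<Rightarrow> 'v \<Rightarrow> 'h) \<Rightarrow>
    ('z \<Rightarrow> 'h \<Rightarrow> 'h \<Rightarrow> real ^ 'p::{finite,linorder} \<Rightarrow> real) \<Rightarrow> 'h \<Rightarrow>
    (int \<Rightarrow> 'h) \<Rightarrow> (int \<Rightarrow> 'z) \<Rightarrow> int \<Rightarrow> ('p \<Rightarrow> nat) \<Rightarrow> 'h \<Rightarrow>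
    real ^ 'p::{finite,linorder} \<Rightarrow> real" where
  "Lambda_lim Q \<sigma> g \<iota> h z d \<nu> a \<epsilon> = lim (\<lambda>n. mderiv \<nu> (Lambda Q \<sigma> g \<iota> h z d n a) \<epsilon>)"

end

theory Submission
  imports Defs "HOL-Library.Sublist"
begin

text \<open>
Fix a realization of \<open>\<eta>\<close> and \<open>Z\<close> and a direction of time. Let \<open>W\<^sub>n(a, y)\<close> be the sum, over all
paths of length \<open>n\<close> from \<open>a\<close> to \<open>y\<close>, of the transition probabilities times the likelihoods met on the
way. Then \<open>\<Lambda>\<^sub>n\<^sub>,\<^sub>a\<close> is the quotient of \<open>\<Sum>\<^sub>y W\<^sub>n(a, y)\<close> and \<open>\<Sum>\<^sub>y W\<^sub>n(\<iota>, y)\<close>. The ratios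
\<open>R\<^sub>n(a, y) = W\<^sub>n(a, y) / W\<^sub>n(\<iota>, y)\<close> obey a linear recursion \<open>R\<^sub>n(a, y) = \<Sum>\<^sub>x R\<^sub>m(a, x) K(x, y)\<close>
for \<open>m \<le> n\<close>, where \<open>K(\<cdot>, y)\<close> is a probability vector: the law at time \<open>m\<close> of the weighted path that
starts in \<open>\<iota>\<close> and ends in \<open>y\<close> at time \<open>n\<close> (in the formal text, \<open>W\<close> is \<open>trans_weight\<close>, \<open>R\<close> is
\<open>start_ratio\<close> and \<open>K\<close> is \<open>backward_kernel\<close>). Both \<open>\<Lambda>\<^sub>n\<^sub>,\<^sub>a\<close> and the next quotient are averages of
\<open>R\<^sub>n(a, \<cdot>)\<close>, so their difference is governed by the oscillation of \<open>R\<^sub>n(a, y)\<close> in \<open>y\<close>, and the same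
is true of the derivatives. It is enough to show that the oscillations of all derivatives of
\<open>R\<^sub>n(a, \<cdot>)\<close> decay geometrically.

Apply the partial derivative of multi-index \<open>\<nu>\<close> to \<open>R\<^sub>m K\<close>. The term in which all derivatives hit \<open>R\<^sub>m\<close> is
contracted by \<open>K\<close>. Every other term contains a derivative of \<open>R\<^sub>m\<close> of lower order, and since the columns
of \<open>K\<close> have the constant sum \<open>1\<close>, only its oscillation matters; by induction on the order this is
geometrically small in \<open>m\<close>. With \<open>m\<close> close to \<open>n / 2\<close> both contributions are geometrically small in
\<open>n\<close>, up to a factor coming from the derivatives of \<open>K\<close> (\<open>leibniz_top_order\<close>, \<open>oscillation_step\<close>,
\<open>start_ratio_oscillation\<close>).

That factor is subexponential. Say that a positive \<open>F\<close> is dominated with constant \<open>S\<close> if each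
iterated derivative of length \<open>k\<close> is at most \<open>S\<^sup>k F\<close> in absolute value. Sums keep the constant,
products add the constants, and a quotient costs a factor depending only on the order
(\<open>dominated_mult\<close>, \<open>dominated_divide\<close>). A likelihood is dominated with a constant proportional to
\<open>max 1 (M\<^sub>q(z, r))\<close>, so \<open>R\<^sub>n\<close> and \<open>K\<close> are dominated with a multiple of the sum of these numbers over
the first \<open>n\<close> times. By the tail hypothesis and Borel-Cantelli that sum is almost surely
subexponential (\<open>AE_subexponential\<close>).

The contraction comes from Doeblin's argument on blocks of \<open>\<kappa>\<close> steps. If all \<open>Z\<^sub>t\<close> in a block lie in a
fixed ball, compactness bounds the ratios of the likelihoods, and by mixing the weights of the paths across
the block depend on the starting state only up to a bounded factor; so \<open>K\<close> contracts oscillations by a fixed factor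
(\<open>backward_kernel_contraction\<close>). Blocks are independent and identically distributed, hence Markov's
inequality and Borel-Cantelli give a deterministic \<open>t < 1\<close> such that almost surely the \<open>J\<close> blocks starting
with block \<open>J\<close> contract by at least \<open>t\<^sup>J\<close> for all large \<open>J\<close> (\<open>AE_block_contraction\<close>). All rates are
explicit functions of \<open>t\<close>, \<open>\<kappa>\<close> and the order of the derivative, so they are deterministic.
\<close>

section \<open>Iterated partial derivatives along a list of directions\<close>

lemma has_partial_DERIV:
  assumes "has_partial i h"
  shows "((\<lambda>t. h (x + t *\<^sub>R axis i 1)) has_real_derivative partial_deriv i h x) (at 0)"
  using assms unfolding has_partial_def partial_deriv_def
  by (simp add: DERIV_deriv_iff_real_differentiable)

lemma partial_derivI:
  assumes "\<And>x. ((\<lambda>t. h (x + t *\<^sub>R axis i 1)) has_real_derivative d x) (at 0)"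
  shows "has_partial i h" "partial_deriv i h = d"
  using assms unfolding has_partial_def partial_deriv_def
  by (auto simp: real_differentiable_def DERIV_imp_deriv)

lemma partial_const:
  "has_partial i (\<lambda>x. c)" "partial_deriv i (\<lambda>x. c) = (\<lambda>x. 0)"
  using partial_derivI[of "\<lambda>x. c" i "\<lambda>x. 0"] by auto

lemma partial_add:
  assumes "has_partial i f" "has_partial i g"
  shows "has_partial i (\<lambda>x. f x + g x)"
    "partial_deriv i (\<lambda>x. f x + g x) = (\<lambda>x. partial_deriv i f x + partial_deriv i g x)"
  using partial_derivI[of "\<lambda>x. f x + g x" i,
      OF DERIV_add[OF has_partial_DERIV[OF assms(1)] has_partial_DERIV[OF assms(2)]]] by auto

lemma partial_cmult:
  assumes "has_partial i f"
  shows "has_partial i (\<lambda>x. c * f x)"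
    "partial_deriv i (\<lambda>x. c * f x) = (\<lambda>x. c * partial_deriv i f x)"
  using partial_derivI[of "\<lambda>x. c * f x" i, OF DERIV_cmult[OF has_partial_DERIV[OF assms]]] by auto

lemma partial_mult:
  assumes "has_partial i f" "has_partial i g"
  shows "has_partial i (\<lambda>x. f x * g x)"
    "partial_deriv i (\<lambda>x. f x * g x) = (\<lambda>x. partial_deriv i f x * g x + f x * partial_deriv i g x)"
proof -
  have *: "((\<lambda>t. f (x + t *\<^sub>R axis i 1) * g (x + t *\<^sub>R axis i 1)) has_real_derivative
         (partial_deriv i f x * g x + f x * partial_deriv i g x)) (at 0)" for x
    using DERIV_mult[OF has_partial_DERIV[OF assms(1), of x] has_partial_DERIV[OF assms(2), of x]]
    by (simp add: algebra_simps)
  show "has_partial i (\<lambda>x. f x * g x)"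
    "partial_deriv i (\<lambda>x. f x * g x) = (\<lambda>x. partial_deriv i f x * g x + f x * partial_deriv i g x)"
    using partial_derivI[of "\<lambda>x. f x * g x" i, OF *] by auto
qed

lemma partial_inverse:
  fixes f :: "real ^ 'p::finite \<Rightarrow> real"
  assumes "has_partial i f" "\<And>x. f x > 0"
  shows "has_partial i (\<lambda>x. inverse (f x))"
    "partial_deriv i (\<lambda>x. inverse (f x)) =
      (\<lambda>x. - 1 * (partial_deriv i f x * (inverse (f x) * inverse (f x))))"
proof -
  have *: "((\<lambda>t. inverse (f (x + t *\<^sub>R axis i 1))) has_real_derivative
         - 1 * (partial_deriv i f x * (inverse (f x) * inverse (f x)))) (at 0)" for x
    using DERIV_inverse'[OF has_partial_DERIV[OF assms(1), of x]] assms(2)[of x]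
    by (simp add: algebra_simps)
  show "has_partial i (\<lambda>x. inverse (f x))"
    "partial_deriv i (\<lambda>x. inverse (f x)) =
      (\<lambda>x. - 1 * (partial_deriv i f x * (inverse (f x) * inverse (f x))))"
    using partial_derivI[of "\<lambda>x. inverse (f x)" i, OF *] by auto
qed

lemma partial_ln:
  fixes f :: "real ^ 'p::finite \<Rightarrow> real"
  assumes "has_partial i f" "\<And>x. f x > 0"
  shows "has_partial i (\<lambda>x. ln (f x))"
    "partial_deriv i (\<lambda>x. ln (f x)) = (\<lambda>x. partial_deriv i f x * inverse (f x))"
proof -
  have *: "((\<lambda>t. ln (f (x + t *\<^sub>R axis i 1))) has_real_derivative
         (partial_deriv i f x * inverse (f x))) (at 0)" for x
    using DERIV_chain2[where f = ln and g = "\<lambda>t. f (x + t *\<^sub>R axis i 1)" and x = 0,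
        OF _ has_partial_DERIV[OF assms(1), of x]] DERIV_ln[OF assms(2)[of x]]
    by (auto simp: algebra_simps)
  show "has_partial i (\<lambda>x. ln (f x))"
    "partial_deriv i (\<lambda>x. ln (f x)) = (\<lambda>x. partial_deriv i f x * inverse (f x))"
    using partial_derivI[of "\<lambda>x. ln (f x)" i, OF *] by auto
qed

text \<open>
The outermost derivative is the head of the list. Induction is always on the last element, the first
derivative taken: peeling it off replaces \<open>F\<close> by \<open>partial_deriv i F\<close>, to which the ordinary rules of
calculus apply.
\<close>

abbreviation iter_partial :: "'p::finite list \<Rightarrow> (real ^ 'p \<Rightarrow> real) \<Rightarrow> real ^ 'p \<Rightarrow> real" where
  "iter_partial \<equiv> foldr partial_deriv"

lemma iter_partial_exists_snoc:
  "iter_partial_exists (A @ [i]) F \<longleftrightarrow> has_partial i F \<and> iter_partial_exists A (partial_deriv i F)"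
  by (induction A) auto

lemma subseq_snoc_iff:
  "subseq B (A @ [i]) \<longleftrightarrow> subseq B A \<or> (\<exists>B'. B = B' @ [i] \<and> subseq B' A)"
proof
  assume "subseq B (A @ [i])"
  then obtain B1 B2 where "B = B1 @ B2" "subseq B1 A" "subseq B2 [i]"
    unfolding subseq_append_iff by auto
  moreover from this(3) have "B2 = [] \<or> B2 = [i]"
    by (auto elim: list_emb.cases)
  ultimately show "subseq B A \<or> (\<exists>B'. B = B' @ [i] \<and> subseq B' A)" by auto
qed (auto intro: subseq_rev_drop_many)

lemma all_subseq_snoc:
  "(\<forall>B. subseq B (A @ [i]) \<longrightarrow> P B) \<longleftrightarrow>
   (\<forall>B. subseq B A \<longrightarrow> P B) \<and> (\<forall>B. subseq B A \<longrightarrow> P (B @ [i]))"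
  unfolding subseq_snoc_iff by auto

lemma iter_partial_add:
  assumes "iter_partial_exists A F" "iter_partial_exists A G"
  shows "iter_partial_exists A (\<lambda>\<epsilon>. F \<epsilon> + G \<epsilon>)"
    "iter_partial A (\<lambda>\<epsilon>. F \<epsilon> + G \<epsilon>) = (\<lambda>\<epsilon>. iter_partial A F \<epsilon> + iter_partial A G \<epsilon>)"
  using assms by (induction A) (auto simp: partial_add)

lemma iter_partial_cmult:
  assumes "iter_partial_exists A F"
  shows "iter_partial_exists A (\<lambda>\<epsilon>. c * F \<epsilon>)"
    "iter_partial A (\<lambda>\<epsilon>. c * F \<epsilon>) = (\<lambda>\<epsilon>. c * iter_partial A F \<epsilon>)"
  using assms by (induction A) (auto simp: partial_cmult)

lemma iter_partial_diff:
  assumes "iter_partial_exists A F" "iter_partial_exists A G"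
  shows "iter_partial_exists A (\<lambda>\<epsilon>. F \<epsilon> - G \<epsilon>)"
    "iter_partial A (\<lambda>\<epsilon>. F \<epsilon> - G \<epsilon>) = (\<lambda>\<epsilon>. iter_partial A F \<epsilon> - iter_partial A G \<epsilon>)"
  using iter_partial_add[OF assms(1) iter_partial_cmult(1)[OF assms(2), of "- 1"]]
    iter_partial_cmult(2)[OF assms(2), of "- 1"] by auto

lemma iter_partial_zero:
  "iter_partial_exists A (\<lambda>\<epsilon>. 0)" "iter_partial A (\<lambda>\<epsilon>. 0) = (\<lambda>\<epsilon>. 0)"
  by (induction A) (auto simp: partial_const)

lemma iter_partial_sum:
  assumes "finite I" "\<And>x. x \<in> I \<Longrightarrow> iter_partial_exists A (F x)"
  shows "iter_partial_exists A (\<lambda>\<epsilon>. \<Sum>x\<in>I. F x \<epsilon>)"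
    "iter_partial A (\<lambda>\<epsilon>. \<Sum>x\<in>I. F x \<epsilon>) = (\<lambda>\<epsilon>. \<Sum>x\<in>I. iter_partial A (F x) \<epsilon>)"
proof -
  have "iter_partial_exists A (\<lambda>\<epsilon>. \<Sum>x\<in>I. F x \<epsilon>) \<and>
    iter_partial A (\<lambda>\<epsilon>. \<Sum>x\<in>I. F x \<epsilon>) = (\<lambda>\<epsilon>. \<Sum>x\<in>I. iter_partial A (F x) \<epsilon>)"
    using assms
    by (induction I rule: finite_induct) (auto simp: iter_partial_zero iter_partial_add)
  then show "iter_partial_exists A (\<lambda>\<epsilon>. \<Sum>x\<in>I. F x \<epsilon>)"
    "iter_partial A (\<lambda>\<epsilon>. \<Sum>x\<in>I. F x \<epsilon>) = (\<lambda>\<epsilon>. \<Sum>x\<in>I. iter_partial A (F x) \<epsilon>)"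
    by auto
qed

subsection \<open>Domination of all partial derivatives\<close>

text \<open>
The bound is required along every subsequence of the list, because these are the derivatives that
Leibniz's rule produces. For a sorted list the subsequences are sorted again, so no interchange of partial
derivatives is involved. Since \<open>S\<close> is raised to the length, the derivative in direction \<open>i\<close> satisfies
the same kind of bound with \<open>S * H\<close> in place of \<open>H\<close>; this is the recursion \<open>dominated_snoc\<close>.
\<close>

definition dominated :: "(real ^ 'p) set \<Rightarrow> 'p::finite list \<Rightarrow> real \<Rightarrow> (real ^ 'p \<Rightarrow> real) \<Rightarrow>
    (real ^ 'p \<Rightarrow> real) \<Rightarrow> bool" where
  "dominated U A S H F \<longleftrightarrow> (\<forall>B. subseq B A \<longrightarrow>
     iter_partial_exists B F \<and> (\<forall>\<epsilon>\<in>U. \<bar>iter_partial B F \<epsilon>\<bar> \<le> S ^ length B * H \<epsilon>))"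

lemma dominated_Nil: "dominated U [] S H F \<longleftrightarrow> (\<forall>\<epsilon>\<in>U. \<bar>F \<epsilon>\<bar> \<le> H \<epsilon>)"
  unfolding dominated_def by (auto dest: subseq_order.antisym)

lemma dominated_snoc:
  "dominated U (A @ [i]) S H F \<longleftrightarrow>
     dominated U A S H F \<and> has_partial i F \<and> dominated U A S (\<lambda>\<epsilon>. S * H \<epsilon>) (partial_deriv i F)"
  unfolding dominated_def all_subseq_snoc
  by (auto simp: iter_partial_exists_snoc algebra_simps)

lemma dominatedD:
  assumes "dominated U A S H F"
  shows "iter_partial_exists A F" "\<epsilon> \<in> U \<Longrightarrow> \<bar>iter_partial A F \<epsilon>\<bar> \<le> S ^ length A * H \<epsilon>"
  using assms unfolding dominated_def by auto

lemma dominated_subseq: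
  "dominated U A S H F \<Longrightarrow> subseq B A \<Longrightarrow> dominated U B S H F"
  unfolding dominated_def by (meson subseq_order.order_trans)

lemma dominated_mono:
  assumes "dominated U A S H F" "0 \<le> S" "S \<le> S'" "\<And>\<epsilon>. \<epsilon> \<in> U \<Longrightarrow> H \<epsilon> \<le> H' \<epsilon>" "\<And>\<epsilon>. \<epsilon> \<in> U \<Longrightarrow> 0 \<le> H' \<epsilon>"
  shows "dominated U A S' H' F"
  unfolding dominated_def
proof (intro allI impI conjI ballI)
  fix B \<epsilon> assume B: "subseq B A"
  show "iter_partial_exists B F" using assms(1) B unfolding dominated_def by auto
  assume e: "\<epsilon> \<in> U"
  have "\<bar>iter_partial B F \<epsilon>\<bar> \<le> S ^ length B * H \<epsilon>" using assms(1) B e unfolding dominated_def by auto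
  also have "\<dots> \<le> S ^ length B * H' \<epsilon>" using assms e by (intro mult_left_mono) auto
  also have "\<dots> \<le> S' ^ length B * H' \<epsilon>" using assms e by (intro mult_right_mono power_mono) auto
  finally show "\<bar>iter_partial B F \<epsilon>\<bar> \<le> S' ^ length B * H' \<epsilon>" .
qed

lemma dominated_zero: "dominated U A S (\<lambda>\<epsilon>. 0) (\<lambda>\<epsilon>. 0)"
  by (induction A rule: rev_induct) (auto simp: dominated_Nil dominated_snoc partial_const)

lemma dominated_const:
  assumes "0 \<le> S" "0 \<le> c"
  shows "dominated U A S (\<lambda>\<epsilon>. c) (\<lambda>\<epsilon>. c)"
proof (induction A rule: rev_induct)
  case (snoc i A)
  have "dominated U A S (\<lambda>\<epsilon>. S * c) (\<lambda>\<epsilon>. 0)"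
    by (rule dominated_mono[OF dominated_zero]) (use assms in auto)
  then show ?case using snoc by (auto simp: dominated_snoc partial_const)
qed (use assms in \<open>auto simp: dominated_Nil\<close>)

lemma dominated_add:
  assumes "dominated U A S H F" "dominated U A S K G"
  shows "dominated U A S (\<lambda>\<epsilon>. H \<epsilon> + K \<epsilon>) (\<lambda>\<epsilon>. F \<epsilon> + G \<epsilon>)"
  using assms
proof (induction A arbitrary: F G H K rule: rev_induct)
  case Nil
  then show ?case
    unfolding dominated_Nil by (auto intro!: order_trans[OF abs_triangle_ineq] add_mono)
next
  case (snoc i A)
  then show ?case
    using snoc.IH[of "\<lambda>\<epsilon>. S * H \<epsilon>" "partial_deriv i F" "\<lambda>\<epsilon>. S * K \<epsilon>" "partial_deriv i G"]
    by (auto simp: dominated_snoc partial_add algebra_simps)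
qed

lemma dominated_cmult:
  assumes "dominated U A S H F"
  shows "dominated U A S (\<lambda>\<epsilon>. \<bar>c\<bar> * H \<epsilon>) (\<lambda>\<epsilon>. c * F \<epsilon>)"
  using assms
proof (induction A arbitrary: F H rule: rev_induct)
  case Nil
  then show ?case
    unfolding dominated_Nil by (simp add: abs_mult mult_left_mono)
next
  case (snoc i A)
  then show ?case
    using snoc.IH[of H F] snoc.IH[of "\<lambda>\<epsilon>. S * H \<epsilon>" "partial_deriv i F"]
    by (auto simp: dominated_snoc partial_cmult mult.left_commute)
qed

lemma dominated_diff:
  assumes "dominated U A S H F" "dominated U A S K G"
  shows "dominated U A S (\<lambda>\<epsilon>. H \<epsilon> + K \<epsilon>) (\<lambda>\<epsilon>. F \<epsilon> - G \<epsilon>)"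
  using dominated_add[OF assms(1) dominated_cmult[OF assms(2), of "- 1"]] by simp

lemma dominated_sum:
  assumes "finite I" "\<And>x. x \<in> I \<Longrightarrow> dominated U A S (H x) (F x)"
  shows "dominated U A S (\<lambda>\<epsilon>. \<Sum>x\<in>I. H x \<epsilon>) (\<lambda>\<epsilon>. \<Sum>x\<in>I. F x \<epsilon>)"
  using assms by (induction I rule: finite_induct) (auto intro: dominated_zero dominated_add)

text \<open>
The constants add because \<open>\<partial>(F G) = \<partial>F G + F \<partial>G\<close> is bounded by \<open>(S + T) H K\<close>; this is the binomial
theorem hidden in Leibniz's rule.
\<close>

lemma dominated_mult:
  assumes "dominated U A S H F" "dominated U A T K G" "0 \<le> S" "0 \<le> T"
    and "\<And>\<epsilon>. \<epsilon> \<in> U \<Longrightarrow> 0 \<le> H \<epsilon>" "\<And>\<epsilon>. \<epsilon> \<in> U \<Longrightarrow> 0 \<le> K \<epsilon>"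
  shows "dominated U A (S + T) (\<lambda>\<epsilon>. H \<epsilon> * K \<epsilon>) (\<lambda>\<epsilon>. F \<epsilon> * G \<epsilon>)"
  using assms(1,2,5,6)
proof (induction A arbitrary: F G H K rule: rev_induct)
  case Nil
  then show ?case
    unfolding dominated_Nil by (simp add: abs_mult mult_mono)
next
  case (snoc i A)
  have "dominated U A (S + T) (\<lambda>\<epsilon>. (S * H \<epsilon>) * K \<epsilon> + H \<epsilon> * (T * K \<epsilon>))
      (\<lambda>\<epsilon>. partial_deriv i F \<epsilon> * G \<epsilon> + F \<epsilon> * partial_deriv i G \<epsilon>)"
    using snoc.prems assms(3,4)
    by (intro dominated_add snoc.IH) (auto simp: dominated_snoc)
  then show ?case
    using snoc assms(3,4) by (auto simp: dominated_snoc partial_mult algebra_simps)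
qed

text \<open>
The derivative of \<open>1 / G\<close> is \<open>- \<partial>G / G\<^sup>2\<close>, a product of one factor with constant \<open>T\<close> and two copies of
\<open>1 / G\<close>. If \<open>1 / G\<close> has the constant \<open>R \<ge> T\<close> for the shorter list, the product has \<open>T + 2 R \<le> 3 R\<close>.
\<close>

lemma dominated_inverse:
  assumes "dominated U A T G G" "0 \<le> T" "\<And>\<epsilon>. G \<epsilon> > 0"
  shows "dominated U A (3 ^ length A * T) (\<lambda>\<epsilon>. inverse (G \<epsilon>)) (\<lambda>\<epsilon>. inverse (G \<epsilon>))"
  using assms(1)
proof (induction A rule: rev_induct)
  case Nil
  then show ?case
    using assms by (auto simp: dominated_Nil less_imp_le)
next
  case (snoc i A)
  define R where "R = 3 ^ length A * T"
  have R: "0 \<le> R" "T \<le> R" using assms(2) mult_right_mono[of 1 "3 ^ length A" T] by (auto simp: R_def)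
  have G: "0 \<le> inverse (G \<epsilon>)" "0 \<le> G \<epsilon>" "G \<epsilon> \<noteq> 0" for \<epsilon> using assms(3)[of \<epsilon>] by auto
  have 1: "dominated U A R (\<lambda>\<epsilon>. inverse (G \<epsilon>)) (\<lambda>\<epsilon>. inverse (G \<epsilon>))"
    using snoc by (auto simp: dominated_snoc R_def)
  have 2: "dominated U A T (\<lambda>\<epsilon>. T * G \<epsilon>) (partial_deriv i G)" and p: "has_partial i G"
    using snoc.prems by (auto simp: dominated_snoc)
  have 3: "dominated U A (T + (R + R))
     (\<lambda>\<epsilon>. \<bar>- 1\<bar> * (T * G \<epsilon> * (inverse (G \<epsilon>) * inverse (G \<epsilon>))))
     (\<lambda>\<epsilon>. - 1 * (partial_deriv i G \<epsilon> * (inverse (G \<epsilon>) * inverse (G \<epsilon>))))"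
    using R G assms(2) by (intro dominated_cmult dominated_mult 1 2) auto
  have "dominated U A (3 * R) (\<lambda>\<epsilon>. 3 * R * inverse (G \<epsilon>))
     (\<lambda>\<epsilon>. - 1 * (partial_deriv i G \<epsilon> * (inverse (G \<epsilon>) * inverse (G \<epsilon>))))"
  proof (rule dominated_mono[OF 3])
    fix \<epsilon>
    have "\<bar>- 1\<bar> * (T * G \<epsilon> * (inverse (G \<epsilon>) * inverse (G \<epsilon>))) = T * inverse (G \<epsilon>)"
      using G[of \<epsilon>] by simp
    also have "\<dots> \<le> 3 * R * inverse (G \<epsilon>)" using R G[of \<epsilon>] by (intro mult_right_mono) auto
    finally show "\<bar>- 1\<bar> * (T * G \<epsilon> * (inverse (G \<epsilon>) * inverse (G \<epsilon>))) \<le> 3 * R * inverse (G \<epsilon>)" .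
  qed (use R G assms(2) in auto)
  moreover have "dominated U A (3 * R) (\<lambda>\<epsilon>. inverse (G \<epsilon>)) (\<lambda>\<epsilon>. inverse (G \<epsilon>))"
    by (rule dominated_mono[OF 1]) (use R G in auto)
  ultimately show ?case
    using partial_inverse[OF p assms(3)] by (simp add: dominated_snoc R_def mult.assoc)
qed

lemma dominated_divide:
  assumes "dominated U A S H F" "dominated U A T G G" "0 \<le> S" "0 \<le> T" "\<And>\<epsilon>. G \<epsilon> > 0"
    and "\<And>\<epsilon>. \<epsilon> \<in> U \<Longrightarrow> 0 \<le> H \<epsilon>"
  shows "dominated U A (S + 3 ^ length A * T) (\<lambda>\<epsilon>. H \<epsilon> / G \<epsilon>) (\<lambda>\<epsilon>. F \<epsilon> / G \<epsilon>)"
  unfolding divide_inverse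
  using assms by (intro dominated_mult dominated_inverse) (auto intro: less_imp_le)

text \<open>
Bounds on the logarithmic derivatives turn into domination of \<open>G\<close> by itself, since
\<open>\<partial>G = (\<partial>G / G) G\<close>: each further direction adds the constant \<open>1\<close> of the first factor, and \<open>1 \<le> M\<close>.
\<close>

lemma dominated_of_log_derivs:
  assumes "\<And>B i. subseq (B @ [i]) A \<Longrightarrow> has_partial i G \<and>
      (iter_partial_exists B (\<lambda>\<epsilon>. partial_deriv i G \<epsilon> / G \<epsilon>)) \<and>
      (\<forall>\<epsilon>\<in>U. \<bar>iter_partial B (\<lambda>\<epsilon>. partial_deriv i G \<epsilon> / G \<epsilon>) \<epsilon>\<bar> \<le> M)"
    and "1 \<le> M" "\<And>\<epsilon>. G \<epsilon> > 0"
  shows "dominated U A ((real (length A) + 1) * M) G G"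
  using assms(1)
proof (induction A rule: rev_induct)
  case Nil
  then show ?case using assms(3) by (auto simp: dominated_Nil less_imp_le)
next
  case (snoc i A)
  define c where "c = real (length A) + 1"
  have c: "c \<ge> 1" by (auto simp: c_def)
  have pos: "G \<epsilon> > 0" "G \<epsilon> \<ge> 0" "G \<epsilon> \<noteq> 0" for \<epsilon> using assms(3)[of \<epsilon>] by auto
  have 1: "dominated U A (c * M) G G" unfolding c_def
    by (rule snoc.IH) (use snoc.prems in \<open>auto simp: subseq_snoc_iff\<close>)
  have 2: "dominated U A 1 (\<lambda>\<epsilon>. M) (\<lambda>\<epsilon>. partial_deriv i G \<epsilon> / G \<epsilon>)"
    unfolding dominated_def using snoc.prems[of _ i] by (auto simp: subseq_snoc_iff)
  have p: "has_partial i G" using snoc.prems[of "[]" i] by (auto simp: subseq_snoc_iff)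
  have "dominated U A (1 + c * M) (\<lambda>\<epsilon>. M * G \<epsilon>) (\<lambda>\<epsilon>. partial_deriv i G \<epsilon> / G \<epsilon> * G \<epsilon>)"
    by (rule dominated_mult[OF 2 1]) (use assms(2) c pos in auto)
  then have 3: "dominated U A (1 + c * M) (\<lambda>\<epsilon>. M * G \<epsilon>) (partial_deriv i G)"
    using pos by simp
  have M1: "M \<le> (c + 1) * M" using mult_right_mono[of 1 "c + 1" M] c assms(2) by simp
  have "dominated U A ((c + 1) * M) (\<lambda>\<epsilon>. (c + 1) * M * G \<epsilon>) (partial_deriv i G)"
    by (rule dominated_mono[OF 3])
       (use assms(2) c pos M1 in \<open>auto simp: algebra_simps intro!: mult_right_mono add_nonneg_nonneg mult_nonneg_nonneg\<close>)
  moreover have "dominated U A ((c + 1) * M) G G"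
    by (rule dominated_mono[OF 1]) (use assms(2) c pos in \<open>auto simp: algebra_simps\<close>)
  ultimately show ?case using p by (simp add: dominated_snoc c_def add.commute)
qed

text \<open>
What the induction on the order knows about an oscillation: all derivatives along strictly shorter
subsequences are small, and nothing but existence is known about the derivative of full order.
\<close>

definition low_order_bound :: "(real ^ 'p) set \<Rightarrow> 'p::finite list \<Rightarrow> real \<Rightarrow>
    (real ^ 'p \<Rightarrow> real) \<Rightarrow> bool" where
  "low_order_bound U A E F \<longleftrightarrow> (\<forall>B. subseq B A \<longrightarrow> iter_partial_exists B F \<and>
     (length B < length A \<longrightarrow> (\<forall>\<epsilon>\<in>U. \<bar>iter_partial B F \<epsilon>\<bar> \<le> E)))"

lemma low_order_bound_snoc:
  assumes "low_order_bound U (A @ [i]) E F"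
  shows "dominated U A 1 (\<lambda>\<epsilon>. E) F" "has_partial i F" "low_order_bound U A E (partial_deriv i F)"
proof -
  have len: "length B \<le> length A" if "subseq B A" for B
    using that not_subseq_length not_le by blast
  have "\<forall>B. subseq B A \<longrightarrow> (iter_partial_exists B F \<and> (\<forall>\<epsilon>\<in>U. \<bar>iter_partial B F \<epsilon>\<bar> \<le> E))"
    and *: "\<forall>B. subseq B A \<longrightarrow> iter_partial_exists (B @ [i]) F \<and>
       (length (B @ [i]) < length (A @ [i]) \<longrightarrow> (\<forall>\<epsilon>\<in>U. \<bar>iter_partial (B @ [i]) F \<epsilon>\<bar> \<le> E))"
    using assms len unfolding low_order_bound_def all_subseq_snoc by (auto simp: le_imp_less_Suc)
  then show "dominated U A 1 (\<lambda>\<epsilon>. E) F" unfolding dominated_def by auto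
  show "has_partial i F" "low_order_bound U A E (partial_deriv i F)"
    using * unfolding low_order_bound_def by (auto simp: iter_partial_exists_snoc)
qed

text \<open>
In Leibniz's rule for \<open>F K\<close> only one term contains the full derivative of \<open>F\<close>, and it carries \<open>K\<close>
undifferentiated. The other terms see derivatives of \<open>F\<close> of lower order, at most \<open>E\<close> each.
\<close>

lemma leibniz_top_order:
  assumes "low_order_bound U A E F" "dominated U A S H K" "0 \<le> S" "0 \<le> E"
    and "\<And>\<epsilon>. \<epsilon> \<in> U \<Longrightarrow> 0 \<le> H \<epsilon>" "\<epsilon> \<in> U"
  shows "\<bar>iter_partial A (\<lambda>\<epsilon>. F \<epsilon> * K \<epsilon>) \<epsilon> - iter_partial A F \<epsilon> * K \<epsilon>\<bar> \<le> E * H \<epsilon> * (1 + S) ^ length A"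
  using assms(1,2)
proof (induction A arbitrary: F rule: rev_induct)
  case Nil
  then show ?case using assms by auto
next
  case (snoc i A)
  note low = low_order_bound_snoc[OF snoc.prems(1)]
  have K: "dominated U A S H K" "has_partial i K" "dominated U A S (\<lambda>\<epsilon>. S * H \<epsilon>) (partial_deriv i K)"
    using snoc.prems by (auto simp: dominated_snoc)
  have len: "subseq B A \<Longrightarrow> iter_partial_exists B (partial_deriv i F)" for B
    using low(3) by (auto simp: low_order_bound_def)
  let ?F1 = "\<lambda>\<epsilon>. partial_deriv i F \<epsilon> * K \<epsilon>" and ?F2 = "\<lambda>\<epsilon>. F \<epsilon> * partial_deriv i K \<epsilon>"
  have d2: "dominated U A (1 + S) (\<lambda>\<epsilon>. E * (S * H \<epsilon>)) ?F2"
    by (rule dominated_mult[OF low(1) K(3)]) (use assms in auto)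
  have d1: "dominated {} A (1 + S) (\<lambda>\<epsilon>. 0 * H \<epsilon>) ?F1"
    by (rule dominated_mult[where S = 1 and T = S])
       (use K(1) len assms(3) in \<open>auto simp: dominated_def\<close>)
  have split: "iter_partial A (\<lambda>\<epsilon>. ?F1 \<epsilon> + ?F2 \<epsilon>) \<epsilon> = iter_partial A ?F1 \<epsilon> + iter_partial A ?F2 \<epsilon>"
    using iter_partial_add(2)[OF dominatedD(1)[OF d1] dominatedD(1)[OF d2]] by simp
  have "\<bar>iter_partial A ?F1 \<epsilon> - iter_partial A (partial_deriv i F) \<epsilon> * K \<epsilon>\<bar> \<le> E * H \<epsilon> * (1 + S) ^ length A"
    by (rule snoc.IH[OF low(3) K(1)])
  moreover have "\<bar>iter_partial A ?F2 \<epsilon>\<bar> \<le> (1 + S) ^ length A * (E * (S * H \<epsilon>))"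
    by (rule dominatedD(2)[OF d2 assms(6)])
  moreover have "E * H \<epsilon> * (1 + S) ^ length A + (1 + S) ^ length A * (E * (S * H \<epsilon>))
      = E * H \<epsilon> * (1 + S) ^ length (A @ [i])" by (simp add: algebra_simps)
  ultimately show ?case
    using split by (simp add: partial_mult[OF low(2) K(2)])
qed

section \<open>Weighted path sums\<close>

text \<open>
The total weight of the paths of \<open>k\<close> steps that are in \<open>x\<close> at time \<open>m\<close> and in \<open>y\<close> at time \<open>m + k\<close>. Here
\<open>p n\<close> is the transition matrix from time \<open>n\<close> to time \<open>n + 1\<close>, and \<open>w s b\<close> is the weight of being in \<open>b\<close> at
time \<open>s\<close>; the initial time carries no weight. With all weights \<open>1\<close> this is the transition probability.
\<close>

primrec trans_weight :: "(nat \<Rightarrow> 'h \<Rightarrow> 'h \<Rightarrow> real) \<Rightarrow> (nat \<Rightarrow> 'h \<Rightarrow> real) \<Rightarrow> nat \<Rightarrow> nat \<Rightarrow>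
    'h::finite \<Rightarrow> 'h \<Rightarrow> real" where
  "trans_weight p w m 0 x y = of_bool (x = y)"
| "trans_weight p w m (Suc k) x y =
     (\<Sum>v\<in>UNIV. p (m + k) v y * trans_weight p w m k x v) * w (m + k + 1) y"

lemma trans_weight_add:
  "trans_weight p w m (k + l) x y =
     (\<Sum>v\<in>UNIV. trans_weight p w m k x v * trans_weight p w (m + k) l v y)"
proof (induction l arbitrary: y)
  case 0
  have "(\<Sum>v\<in>UNIV. trans_weight p w m k x v * of_bool (v = y)) =
      (\<Sum>v\<in>{y}. trans_weight p w m k x v * of_bool (v = y))"
    by (rule sum.mono_neutral_right) auto
  then show ?case by simp
next
  case (Suc l)
  have "trans_weight p w m (k + Suc l) x y =
     (\<Sum>u\<in>UNIV. p (m + k + l) u y *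
        (\<Sum>v\<in>UNIV. trans_weight p w m k x v * trans_weight p w (m + k) l v u)) * w (m + k + l + 1) y"
    by (simp add: Suc.IH add.assoc)
  also have "\<dots> = (\<Sum>u\<in>UNIV. \<Sum>v\<in>UNIV. trans_weight p w m k x v *
     (p (m + k + l) u y * trans_weight p w (m + k) l v u)) * w (m + k + l + 1) y"
    by (simp add: sum_distrib_left mult_ac)
  also have "\<dots> = (\<Sum>v\<in>UNIV. \<Sum>u\<in>UNIV. trans_weight p w m k x v *
     (p (m + k + l) u y * trans_weight p w (m + k) l v u)) * w (m + k + l + 1) y"
    by (subst sum.swap) simp
  also have "\<dots> = (\<Sum>v\<in>UNIV. trans_weight p w m k x v * trans_weight p w (m + k) (Suc l) v y)"
    by (simp add: sum_distrib_left sum_distrib_right mult_ac)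
  finally show ?case .
qed

locale mixing_chain =
  fixes p :: "nat \<Rightarrow> 'h::finite \<Rightarrow> 'h \<Rightarrow> real" and \<kappa> :: nat and \<delta> :: real
  assumes p_nonneg: "\<And>n x y. 0 \<le> p n x y"
    and p_sum: "\<And>n x. (\<Sum>y\<in>UNIV. p n x y) = 1"
    and kappa_pos: "1 \<le> \<kappa>"
    and delta_pos: "0 < \<delta>"
    and mixing: "\<And>m x y. \<delta> \<le> trans_weight p (\<lambda>_ _. 1) m \<kappa> x y"
begin

lemma trans_weight_nonneg:
  assumes "\<And>s b. 0 < w s b"
  shows "0 \<le> trans_weight p w m k x y"
  using assms by (induction k arbitrary: y)
    (auto intro!: mult_nonneg_nonneg sum_nonneg p_nonneg simp: less_imp_le)

lemma unweighted_sum: "(\<Sum>y\<in>UNIV. trans_weight p (\<lambda>_ _. 1) m k x y) = 1"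
proof (induction k)
  case 0
  have "(\<Sum>y\<in>UNIV. of_bool (x = y)) = (\<Sum>y\<in>{x}. of_bool (x = y) :: real)"
    by (rule sum.mono_neutral_right) auto
  then show ?case by simp
next
  case (Suc k)
  have "(\<Sum>y\<in>UNIV. trans_weight p (\<lambda>_ _. 1) m (Suc k) x y) =
     (\<Sum>v\<in>UNIV. \<Sum>y\<in>UNIV. p (m + k) v y * trans_weight p (\<lambda>_ _. 1) m k x v)"
    by (simp, subst sum.swap) simp
  also have "\<dots> = 1" using Suc by (simp add: sum_distrib_right[symmetric] p_sum)
  finally show ?case .
qed

lemma unweighted_le_1: "trans_weight p (\<lambda>_ _. 1) m k x y \<le> 1"
  using member_le_sum[of y UNIV "trans_weight p (\<lambda>_ _. 1) m k x"] unweighted_sum[of m k x]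
    trans_weight_nonneg[of "\<lambda>_ _. 1"] by auto

lemma delta_le_1: "\<delta> \<le> 1"
  using mixing unweighted_le_1 order_trans by blast

text \<open>
Mixing over exactly \<open>\<kappa>\<close> steps gives the same lower bound for longer times, by averaging over the state
\<open>\<kappa>\<close> steps before the end.
\<close>

lemma unweighted_ge:
  assumes "\<kappa> \<le> k"
  shows "\<delta> \<le> trans_weight p (\<lambda>_ _. 1) m k x y"
proof -
  obtain j where k: "k = j + \<kappa>" using assms by (metis le_add_diff_inverse2)
  have "\<delta> = (\<Sum>v\<in>UNIV. trans_weight p (\<lambda>_ _. 1) m j x v * \<delta>)"
    using unweighted_sum[of m j x] by (simp add: sum_distrib_right[symmetric])
  also have "\<dots> \<le> (\<Sum>v\<in>UNIV. trans_weight p (\<lambda>_ _. 1) m j x v * trans_weight p (\<lambda>_ _. 1) (m + j) \<kappa> v y)"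
    by (intro sum_mono mult_left_mono mixing trans_weight_nonneg) auto
  finally show ?thesis by (simp add: k trans_weight_add)
qed

lemma trans_weight_ge:
  assumes "\<And>s b. 0 < w s b" "\<And>s b. s \<in> {m<..m+k} \<Longrightarrow> lo s \<le> w s b" "\<And>s. 0 \<le> lo s"
  shows "(\<Prod>s\<in>{m<..m+k}. lo s) * trans_weight p (\<lambda>_ _. 1) m k x y \<le> trans_weight p w m k x y"
  using assms(2)
proof (induction k arbitrary: y)
  case (Suc k)
  have "{m<..Suc (m + k)} = insert (Suc (m + k)) {m<..m+k}" by auto
  then have i: "prod f {m<..Suc (m + k)} = f (Suc (m + k)) * prod f {m<..m+k}" for f :: "nat \<Rightarrow> real"
    by simp
  have "(\<Prod>s\<in>{m<..m+Suc k}. lo s) * trans_weight p (\<lambda>_ _. 1) m (Suc k) x y =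
    (\<Sum>v\<in>UNIV. p (m + k) v y * ((\<Prod>s\<in>{m<..m+k}. lo s) * trans_weight p (\<lambda>_ _. 1) m k x v)) * lo (m + k + 1)"
    by (simp add: i sum_distrib_left sum_distrib_right mult_ac)
  also have "\<dots> \<le> (\<Sum>v\<in>UNIV. p (m + k) v y * trans_weight p w m k x v) * w (m + k + 1) y"
    using Suc assms(3)
    by (intro mult_mono sum_mono mult_left_mono p_nonneg sum_nonneg mult_nonneg_nonneg
         trans_weight_nonneg assms(1)) auto
  finally show ?case by simp
qed auto

lemma trans_weight_le:
  assumes "\<And>s b. 0 < w s b" "\<And>s b. s \<in> {m<..m+k} \<Longrightarrow> w s b \<le> hi s" "\<And>s. 0 \<le> hi s"
  shows "trans_weight p w m k x y \<le> (\<Prod>s\<in>{m<..m+k}. hi s) * trans_weight p (\<lambda>_ _. 1) m k x y"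
  using assms(2)
proof (induction k arbitrary: y)
  case (Suc k)
  have "{m<..Suc (m + k)} = insert (Suc (m + k)) {m<..m+k}" by auto
  then have i: "prod f {m<..Suc (m + k)} = f (Suc (m + k)) * prod f {m<..m+k}" for f :: "nat \<Rightarrow> real"
    by simp
  have "trans_weight p w m (Suc k) x y \<le>
    (\<Sum>v\<in>UNIV. p (m + k) v y * ((\<Prod>s\<in>{m<..m+k}. hi s) * trans_weight p (\<lambda>_ _. 1) m k x v)) * hi (m + k + 1)"
    unfolding trans_weight.simps using Suc assms(3)
    by (intro mult_mono sum_mono mult_left_mono p_nonneg sum_nonneg mult_nonneg_nonneg
         trans_weight_nonneg prod_nonneg) (auto simp: assms(1) less_imp_le)
  also have "\<dots> = (\<Prod>s\<in>{m<..m+Suc k}. hi s) * trans_weight p (\<lambda>_ _. 1) m (Suc k) x y"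
    by (simp add: i sum_distrib_left sum_distrib_right mult_ac)
  finally show ?case by simp
qed auto

lemma trans_weight_pos:
  assumes w: "\<And>s b. 0 < w s b" and "\<kappa> \<le> k"
  shows "0 < trans_weight p w m k x y"
proof -
  define lo where "lo s = Min (range (w s))" for s
  have lo: "0 < lo s" "lo s \<le> w s b" for s b using w by (auto simp: lo_def)
  have "0 < (\<Prod>s\<in>{m<..m+k}. lo s) * trans_weight p (\<lambda>_ _. 1) m k x y"
    using lo unweighted_ge[OF assms(2), of m x y] delta_pos by (intro mult_pos_pos prod_pos) auto
  also have "\<dots> \<le> trans_weight p w m k x y"
    by (rule trans_weight_ge[of w, OF w]) (use lo in \<open>auto simp: less_imp_le\<close>)
  finally show ?thesis .
qed

lemma trans_weight_sum_pos:
  assumes w: "\<And>s b. 0 < w s b"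
  shows "0 < (\<Sum>y\<in>UNIV. trans_weight p w m k x y)"
proof -
  define lo where "lo s = Min (range (w s))" for s
  have lo: "0 < lo s" "lo s \<le> w s b" for s b using w by (auto simp: lo_def)
  have "0 < (\<Prod>s\<in>{m<..m+k}. lo s) * (\<Sum>y\<in>UNIV. trans_weight p (\<lambda>_ _. 1) m k x y)"
    using lo by (simp add: unweighted_sum prod_pos)
  also have "\<dots> = (\<Sum>y\<in>UNIV. (\<Prod>s\<in>{m<..m+k}. lo s) * trans_weight p (\<lambda>_ _. 1) m k x y)"
    by (simp add: sum_distrib_left)
  also have "\<dots> \<le> (\<Sum>y\<in>UNIV. trans_weight p w m k x y)"
    by (intro sum_mono trans_weight_ge[of w, OF w]) (use lo in \<open>auto simp: less_imp_le\<close>)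
  finally show ?thesis .
qed

text \<open>
If the weights at each time of a block differ at most by the factor \<open>\<rho>\<close>, then, after division by the product
of their minima, the weighted transition matrix exceeds the unweighted one at most by the factor
\<open>\<rho> ^ \<kappa>\<close> and is not below it. The entries of the unweighted matrix lie between \<open>\<delta>\<close> and \<open>1\<close>.
\<close>

lemma trans_weight_minorization:
  assumes w: "\<And>s b. 0 < w s b" and "1 \<le> \<rho>"
    and good: "\<And>s b b'. s \<in> {m<..m+\<kappa>} \<Longrightarrow> w s b \<le> \<rho> * w s b'"
  shows "\<delta> / \<rho> ^ \<kappa> * trans_weight p w m \<kappa> x' y \<le> trans_weight p w m \<kappa> x y"
proof -
  define lo where "lo s = Min (range (w s))" for s
  have lo: "0 < lo s" "lo s \<le> w s b" for s b using w by (auto simp: lo_def)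
  have "\<exists>b. lo s = w s b" for s
    using Min_in[of "range (w s)"] unfolding lo_def image_iff by simp
  then have hi: "s \<in> {m<..m+\<kappa>} \<Longrightarrow> w s b \<le> \<rho> * lo s" for s b
    using good by metis
  have "trans_weight p w m \<kappa> x' y \<le>
      (\<Prod>s\<in>{m<..m+\<kappa>}. \<rho> * lo s) * trans_weight p (\<lambda>_ _. 1) m \<kappa> x' y"
    using lo(1) \<open>1 \<le> \<rho>\<close> by (intro trans_weight_le w hi) (auto simp: less_imp_le)
  also have "\<dots> \<le> (\<Prod>s\<in>{m<..m+\<kappa>}. \<rho> * lo s) * 1"
    using lo(1) \<open>1 \<le> \<rho>\<close> by (intro mult_left_mono unweighted_le_1 prod_nonneg) (auto simp: less_imp_le)
  also have "\<dots> = \<rho> ^ \<kappa> * (\<Prod>s\<in>{m<..m+\<kappa>}. lo s)"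
    by (simp add: prod.distrib)
  finally have "\<delta> / \<rho> ^ \<kappa> * trans_weight p w m \<kappa> x' y \<le>
      \<delta> / \<rho> ^ \<kappa> * (\<rho> ^ \<kappa> * (\<Prod>s\<in>{m<..m+\<kappa>}. lo s))"
    using delta_pos \<open>1 \<le> \<rho>\<close> by (intro mult_left_mono) auto
  also have "\<dots> = (\<Prod>s\<in>{m<..m+\<kappa>}. lo s) * \<delta>" using \<open>1 \<le> \<rho>\<close> by simp
  also have "\<dots> \<le> (\<Prod>s\<in>{m<..m+\<kappa>}. lo s) * trans_weight p (\<lambda>_ _. 1) m \<kappa> x y"
    using lo(1) by (intro mult_left_mono mixing prod_nonneg) (auto simp: less_imp_le)
  also have "\<dots> \<le> trans_weight p w m \<kappa> x y"
    by (rule trans_weight_ge[of w, OF w]) (use lo in \<open>auto simp: less_imp_le\<close>)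
  finally show ?thesis .
qed

end

section \<open>Contraction of oscillations by backward kernels\<close>

text \<open>
The common part \<open>\<alpha> * \<mu>\<close> of the two probability vectors cancels in the difference, and the rest of each
vector has mass \<open>1 - \<alpha>\<close>.
\<close>

lemma doeblin_contraction:
  fixes f k k' \<mu> :: "'h::finite \<Rightarrow> real"
  assumes "(\<Sum>x\<in>UNIV. k x) = 1" "(\<Sum>x\<in>UNIV. k' x) = 1" "(\<Sum>x\<in>UNIV. \<mu> x) = 1"
    and "\<And>x. \<alpha> * \<mu> x \<le> k x" "\<And>x. \<alpha> * \<mu> x \<le> k' x"
    and "\<And>x x'. \<bar>f x - f x'\<bar> \<le> d"
  shows "\<bar>(\<Sum>x\<in>UNIV. f x * k x) - (\<Sum>x\<in>UNIV. f x * k' x)\<bar> \<le> (1 - \<alpha>) * d"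
proof -
  define lo hi where "lo = Min (range f)" and "hi = Max (range f)"
  have f: "lo \<le> f x" "f x \<le> hi" for x by (auto simp: lo_def hi_def)
  have "lo \<in> range f" "hi \<in> range f" unfolding lo_def hi_def by (auto intro!: Min_in Max_in)
  then have d: "hi - lo \<le> d" using assms(6) by (metis abs_le_D1 imageE)
  have *: "lo * (1 - \<alpha>) \<le> (\<Sum>x\<in>UNIV. f x * k x) - \<alpha> * (\<Sum>x\<in>UNIV. f x * \<mu> x)
      \<and> (\<Sum>x\<in>UNIV. f x * k x) - \<alpha> * (\<Sum>x\<in>UNIV. f x * \<mu> x) \<le> hi * (1 - \<alpha>)"
    if "(\<Sum>x\<in>UNIV. k x) = 1" "\<And>x. \<alpha> * \<mu> x \<le> k x" for k
  proof -
    have e: "(\<Sum>x\<in>UNIV. f x * k x) - \<alpha> * (\<Sum>x\<in>UNIV. f x * \<mu> x) = (\<Sum>x\<in>UNIV. f x * (k x - \<alpha> * \<mu> x))"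
      by (simp add: sum_distrib_left sum_subtractf algebra_simps)
    have s: "(\<Sum>x\<in>UNIV. c * (k x - \<alpha> * \<mu> x)) = c * (1 - \<alpha>)" for c
      using that(1) assms(3) by (simp add: sum_distrib_left[symmetric] sum_subtractf)
    have "(\<Sum>x\<in>UNIV. lo * (k x - \<alpha> * \<mu> x)) \<le> (\<Sum>x\<in>UNIV. f x * (k x - \<alpha> * \<mu> x))"
      "(\<Sum>x\<in>UNIV. f x * (k x - \<alpha> * \<mu> x)) \<le> (\<Sum>x\<in>UNIV. hi * (k x - \<alpha> * \<mu> x))"
      using that f by (auto intro!: sum_mono mult_right_mono)
    then show ?thesis unfolding e s by auto
  qed
  have "(\<Sum>x\<in>UNIV. \<alpha> * \<mu> x) \<le> (\<Sum>x\<in>UNIV. k x)" by (intro sum_mono assms)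
  then have "\<alpha> \<le> 1" using assms by (simp add: sum_distrib_left[symmetric])
  then have "(1 - \<alpha>) * (hi - lo) \<le> (1 - \<alpha>) * d" using d by (intro mult_left_mono) auto
  then show ?thesis using *[of k] *[of k'] assms by (auto simp: algebra_simps abs_le_iff)
qed

context mixing_chain
begin

text \<open>
The conditional probability that the weighted path from \<open>\<iota>\<close> is in \<open>x\<close> at time \<open>m\<close>, given that it is in
\<open>y\<close> at time \<open>m + k\<close>. It is a probability vector in its first state argument.
\<close>

definition backward_kernel :: "(nat \<Rightarrow> 'h \<Rightarrow> real) \<Rightarrow> 'h \<Rightarrow> nat \<Rightarrow> nat \<Rightarrow> 'h \<Rightarrow> 'h \<Rightarrow> real" where
  "backward_kernel w \<iota> m k x y =
     trans_weight p w 0 m \<iota> x * trans_weight p w m k x y / trans_weight p w 0 (m + k) \<iota> y"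

lemma backward_kernel_nonneg:
  assumes "\<And>s b. 0 < w s b"
  shows "0 \<le> backward_kernel w \<iota> m k x y"
  unfolding backward_kernel_def using assms
  by (intro divide_nonneg_nonneg mult_nonneg_nonneg trans_weight_nonneg) auto

lemma backward_kernel_sum:
  assumes "\<And>s b. 0 < w s b" "\<kappa> \<le> m + k"
  shows "(\<Sum>x\<in>UNIV. backward_kernel w \<iota> m k x y) = 1"
  using trans_weight_pos[of w "m + k" 0 \<iota> y, OF assms] trans_weight_add[of p w 0 m k \<iota> y]
  by (simp add: backward_kernel_def sum_divide_distrib[symmetric])

lemma backward_kernel_add:
  assumes "\<And>s b. 0 < w s b" "\<kappa> \<le> m"
  shows "backward_kernel w \<iota> m (k + l) x y =
    (\<Sum>v\<in>UNIV. backward_kernel w \<iota> m k x v * backward_kernel w \<iota> (m + k) l v y)"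
proof -
  have [simp]: "trans_weight p w 0 (m + k) \<iota> v \<noteq> 0" for v
    using trans_weight_pos[of w "m + k" 0 \<iota> v, OF assms(1)] assms(2) by simp
  show ?thesis
    unfolding backward_kernel_def trans_weight_add[of p w m k l x y]
    by (simp add: sum_distrib_left sum_divide_distrib add.assoc mult_ac)
qed

text \<open>
Over a good block the weight of reaching \<open>y\<close> depends on the state \<open>x\<close> in which the block starts only up to
a bounded factor, and so conditioning on \<open>y\<close> changes the law of \<open>x\<close> only by such a factor. The minorizing vector is that law
without the conditioning, and therefore the same for all \<open>y\<close>.
\<close>

lemma backward_kernel_minorization:
  assumes w: "\<And>s b. 0 < w s b" and "1 \<le> \<rho>" "\<kappa> \<le> m"
    and good: "\<And>s b b'. s \<in> {m<..m+\<kappa>} \<Longrightarrow> w s b \<le> \<rho> * w s b'"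
  shows "\<delta> / \<rho> ^ \<kappa> * (trans_weight p w 0 m \<iota> x / (\<Sum>x\<in>UNIV. trans_weight p w 0 m \<iota> x))
    \<le> backward_kernel w \<iota> m \<kappa> x y"
proof -
  define V where "V x = trans_weight p w 0 m \<iota> x" for x
  define T where "T x = trans_weight p w m \<kappa> x y" for x
  define \<alpha> where "\<alpha> = \<delta> / \<rho> ^ \<kappa>"
  have V: "0 < V x" for x unfolding V_def using assms by (intro trans_weight_pos) auto
  have sV: "0 < sum V UNIV" using V by (intro sum_pos) auto
  have T: "\<alpha> * T x' \<le> T x" for x x'
    unfolding T_def \<alpha>_def using trans_weight_minorization[of w, OF w assms(2) good] by auto
  have W: "trans_weight p w 0 (m + \<kappa>) \<iota> y = (\<Sum>x\<in>UNIV. V x * T x)"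
    by (simp add: trans_weight_add V_def T_def)
  have W0: "0 < (\<Sum>x\<in>UNIV. V x * T x)" unfolding W[symmetric]
    by (rule trans_weight_pos[OF w]) simp
  have "\<alpha> * (\<Sum>x\<in>UNIV. V x * T x) = (\<Sum>x'\<in>UNIV. V x' * (\<alpha> * T x'))"
    by (simp add: sum_distrib_left mult_ac)
  also have "\<dots> \<le> (\<Sum>x'\<in>UNIV. V x' * T x)"
    using V T by (intro sum_mono mult_left_mono) (auto simp: less_imp_le)
  finally have "\<alpha> * (\<Sum>x\<in>UNIV. V x * T x) \<le> T x * sum V UNIV"
    by (simp add: sum_distrib_left mult_ac)
  then have "V x * (\<alpha> * (\<Sum>x\<in>UNIV. V x * T x)) \<le> V x * (T x * sum V UNIV)"
    using V by (simp add: less_imp_le)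
  then have "\<alpha> * (V x / sum V UNIV) \<le> V x * T x / (\<Sum>x\<in>UNIV. V x * T x)"
    using sV W0 by (simp add: pos_le_divide_eq pos_divide_le_eq mult_ac)
  then show ?thesis unfolding backward_kernel_def W by (simp add: V_def T_def \<alpha>_def)
qed

text \<open>
\<open>j\<close> blocks are followed by \<open>l\<close> further steps, which do not increase the oscillation. A block that is not
known to be good is covered by \<open>c i = 1\<close>.
\<close>

lemma backward_kernel_contraction:
  assumes w: "\<And>s b. 0 < w s b" and "1 \<le> \<rho>" "\<kappa> \<le> m"
    and c: "\<And>i. i < j \<Longrightarrow> c i = 1 \<or> c i = 1 - \<delta> / \<rho> ^ \<kappa> \<and>
      (\<forall>s\<in>{m + i*\<kappa><..m + i*\<kappa>+\<kappa>}. \<forall>b b'. w s b \<le> \<rho> * w s b')"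
    and f: "\<And>x x'. \<bar>f x - f x'\<bar> \<le> d"
  shows "\<bar>(\<Sum>x\<in>UNIV. f x * backward_kernel w \<iota> m (j * \<kappa> + l) x y) -
    (\<Sum>x\<in>UNIV. f x * backward_kernel w \<iota> m (j * \<kappa> + l) x y')\<bar> \<le> (\<Prod>i<j. c i) * d"
proof -
  define F where "F n y = (\<Sum>x\<in>UNIV. f x * backward_kernel w \<iota> m n x y)" for n y
  have F_add: "F (n + n') y = (\<Sum>v\<in>UNIV. F n v * backward_kernel w \<iota> (m + n) n' v y)" for n n' y
  proof -
    have "F (n + n') y = (\<Sum>x\<in>UNIV. \<Sum>v\<in>UNIV. f x *
       (backward_kernel w \<iota> m n x v * backward_kernel w \<iota> (m + n) n' v y))"
      unfolding F_def by (subst backward_kernel_add[OF w assms(3)]) (simp add: sum_distrib_left)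
    also have "\<dots> = (\<Sum>v\<in>UNIV. \<Sum>x\<in>UNIV. f x *
       (backward_kernel w \<iota> m n x v * backward_kernel w \<iota> (m + n) n' v y))"
      by (rule sum.swap)
    also have "\<dots> = (\<Sum>v\<in>UNIV. F n v * backward_kernel w \<iota> (m + n) n' v y)"
      unfolding F_def by (simp add: sum_distrib_right mult.assoc)
    finally show ?thesis .
  qed
  have avg: "\<bar>F (n + n') y - F (n + n') y'\<bar> \<le> D" if "\<And>x x'. \<bar>F n x - F n x'\<bar> \<le> D" for n n' D y y'
  proof -
    have "\<bar>F (n + n') y - F (n + n') y'\<bar> \<le> (1 - 0) * D"
      unfolding F_add
      by (rule doeblin_contraction[where \<mu> = "\<lambda>x. 1 / CARD('h)"])
         (use that assms(3) in \<open>auto intro!: backward_kernel_sum backward_kernel_nonneg w\<close>)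
    then show ?thesis by simp
  qed
  have F0: "F 0 = f"
  proof
    fix y
    have nz: "trans_weight p w 0 m \<iota> y \<noteq> 0"
      using trans_weight_pos[of w m 0 \<iota> y, OF w assms(3)] by simp
    have "F 0 y = (\<Sum>x\<in>{y}. f x * backward_kernel w \<iota> m 0 x y)"
      unfolding F_def by (rule sum.mono_neutral_right) (auto simp: backward_kernel_def)
    then show "F 0 y = f y" using nz by (simp add: backward_kernel_def)
  qed
  have main: "\<bar>F (j * \<kappa>) y - F (j * \<kappa>) y'\<bar> \<le> (\<Prod>i<j. c i) * d" for y y'
    using c
  proof (induction j arbitrary: y y')
    case 0
    then show ?case using f F0 by simp
  next
    case (Suc j)
    have IH: "\<bar>F (j * \<kappa>) x - F (j * \<kappa>) x'\<bar> \<le> (\<Prod>i<j. c i) * d" for x x'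
      using Suc by auto
    have e: "Suc j * \<kappa> = j * \<kappa> + \<kappa>" by simp
    consider "c j = 1" | "c j = 1 - \<delta> / \<rho> ^ \<kappa>"
        "\<And>s b b'. s\<in>{m + j*\<kappa><..m + j*\<kappa>+\<kappa>} \<Longrightarrow> w s b \<le> \<rho> * w s b'"
      using Suc.prems[of j] by blast
    then show ?case
    proof cases
      case 1
      show ?thesis unfolding e using avg[of "j * \<kappa>", OF IH] by (simp add: 1)
    next
      case 2
      have pos: "0 < (\<Sum>x\<in>UNIV. trans_weight p w 0 (m + j * \<kappa>) \<iota> x)"
        by (rule trans_weight_sum_pos[OF w])
      then have one: "(\<Sum>v\<in>UNIV. trans_weight p w 0 (m + j * \<kappa>) \<iota> v /
          (\<Sum>x\<in>UNIV. trans_weight p w 0 (m + j * \<kappa>) \<iota> x)) = 1"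
        by (simp add: sum_divide_distrib[symmetric])
      have min: "\<delta> / \<rho> ^ \<kappa> * (trans_weight p w 0 (m + j * \<kappa>) \<iota> v /
          (\<Sum>x\<in>UNIV. trans_weight p w 0 (m + j * \<kappa>) \<iota> x)) \<le> backward_kernel w \<iota> (m + j * \<kappa>) \<kappa> v y" for v y
        by (rule backward_kernel_minorization[OF w assms(2) _ 2(2)]) (use assms(3) in auto)
      have "\<bar>F (j * \<kappa> + \<kappa>) y - F (j * \<kappa> + \<kappa>) y'\<bar> \<le> (1 - \<delta> / \<rho> ^ \<kappa>) * ((\<Prod>i<j. c i) * d)"
        unfolding F_add
        by (rule doeblin_contraction[OF _ _ one min min IH])
           (use assms(3) in \<open>auto intro!: backward_kernel_sum w\<close>)
      then show ?thesis unfolding e by (simp add: 2(1) mult_ac)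
    qed
  qed
  show ?thesis using avg[of "j * \<kappa>" _ l, OF main] unfolding F_def .
qed

end

section \<open>Subexponential sequences and decay rates\<close>

text \<open>
Growth of smaller order than every geometric sequence. Such factors cost nothing but a slightly larger
rate, see \<open>subexponential_absorb\<close>.
\<close>

definition subexponential :: "(nat \<Rightarrow> real) \<Rightarrow> bool" where
  "subexponential f \<longleftrightarrow> (\<forall>\<beta>>1. \<exists>C. \<forall>n. \<bar>f n\<bar> \<le> C * \<beta> ^ n)"

lemma subexponential_const: "subexponential (\<lambda>n. c)"
  unfolding subexponential_def
proof (intro allI impI exI)
  fix \<beta> :: real and n assume "1 < \<beta>"
  then show "\<bar>c\<bar> \<le> \<bar>c\<bar> * \<beta> ^ n" using mult_left_mono[of 1 "\<beta> ^ n" "\<bar>c\<bar>"] by simp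
qed

lemma subexponential_add:
  assumes "subexponential f" "subexponential g"
  shows "subexponential (\<lambda>n. f n + g n)"
  unfolding subexponential_def
proof (intro allI impI)
  fix \<beta> :: real assume "1 < \<beta>"
  then obtain C D where "\<And>n. \<bar>f n\<bar> \<le> C * \<beta> ^ n" "\<And>n. \<bar>g n\<bar> \<le> D * \<beta> ^ n"
    using assms unfolding subexponential_def by meson
  then have "\<bar>f n + g n\<bar> \<le> (C + D) * \<beta> ^ n" for n
    unfolding distrib_right by (intro order_trans[OF abs_triangle_ineq add_mono])
  then show "\<exists>C. \<forall>n. \<bar>f n + g n\<bar> \<le> C * \<beta> ^ n" by blast
qed

lemma subexponential_mult:
  assumes "subexponential f" "subexponential g"
  shows "subexponential (\<lambda>n. f n * g n)"
  unfolding subexponential_def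
proof (intro allI impI)
  fix \<beta> :: real assume \<beta>: "1 < \<beta>"
  then have "1 < sqrt \<beta>" by simp
  then obtain C D where CD: "\<And>n. \<bar>f n\<bar> \<le> C * sqrt \<beta> ^ n" "\<And>n. \<bar>g n\<bar> \<le> D * sqrt \<beta> ^ n"
    using assms unfolding subexponential_def by meson
  have "\<bar>f n * g n\<bar> \<le> (C * D) * \<beta> ^ n" for n
  proof -
    have "\<bar>f n * g n\<bar> \<le> (C * sqrt \<beta> ^ n) * (D * sqrt \<beta> ^ n)"
      unfolding abs_mult by (intro mult_mono CD order_trans[OF abs_ge_zero CD(1)] abs_ge_zero)
    also have "\<dots> = (C * D) * (sqrt \<beta> * sqrt \<beta>) ^ n"
      by (simp only: power_mult_distrib mult_ac)
    also have "sqrt \<beta> * sqrt \<beta> = \<beta>" using \<beta> by (simp add: real_sqrt_mult_self)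
    finally show ?thesis .
  qed
  then show "\<exists>C. \<forall>n. \<bar>f n * g n\<bar> \<le> C * \<beta> ^ n" by blast
qed

lemma subexponential_power: "subexponential f \<Longrightarrow> subexponential (\<lambda>n. f n ^ k)"
  by (induction k) (auto intro: subexponential_const subexponential_mult)

lemma subexponential_Suc:
  assumes "subexponential f"
  shows "subexponential (\<lambda>n. f (Suc n))"
  unfolding subexponential_def
proof (intro allI impI)
  fix \<beta> :: real assume "1 < \<beta>"
  then obtain C where "\<And>n. \<bar>f n\<bar> \<le> C * \<beta> ^ n"
    using assms unfolding subexponential_def by meson
  then have "\<bar>f (Suc n)\<bar> \<le> (C * \<beta>) * \<beta> ^ n" for n
    unfolding mult.assoc power_Suc[symmetric] by blast
  then show "\<exists>C. \<forall>n. \<bar>f (Suc n)\<bar> \<le> C * \<beta> ^ n" by blast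
qed

lemma subexponential_absorb:
  assumes "subexponential f" "0 < y" "y < 1"
  shows "\<exists>C. \<forall>n. \<bar>f n\<bar> * y ^ (2 * n) \<le> C * y ^ n"
proof -
  have "1 < 1 / y" using assms by simp
  then obtain C where C: "\<And>n. \<bar>f n\<bar> \<le> C * (1 / y) ^ n"
    using assms unfolding subexponential_def by meson
  have "\<bar>f n\<bar> * y ^ (2 * n) \<le> C * y ^ n" for n
  proof -
    have "\<bar>f n\<bar> * y ^ (2 * n) \<le> (C * (1 / y) ^ n) * y ^ (2 * n)"
      using assms by (intro mult_right_mono C) auto
    also have "\<dots> = C * y ^ n"
      using assms by (simp add: power_divide mult_2 power_add)
    finally show ?thesis .
  qed
  then show ?thesis by blast
qed

text \<open>
Rates of decay for successive orders of differentiation. An induction step loses a power \<open>2 * \<kappa>\<close>, because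
\<open>n\<close> steps contain two runs of \<open>n div (2 * \<kappa>)\<close> blocks and only the second one contracts, and a further
square to absorb subexponential factors. Hence the exponent \<open>1 / (4 * \<kappa>)\<close>.
\<close>

primrec decay_rate :: "nat \<Rightarrow> real \<Rightarrow> nat \<Rightarrow> real" where
  "decay_rate \<kappa> t 0 = t"
| "decay_rate \<kappa> t (Suc j) = decay_rate \<kappa> t j powr (1 / real (4 * \<kappa>))"

lemma decay_rate_bounds:
  assumes "0 < t" "t < 1" "1 \<le> \<kappa>"
  shows "0 < decay_rate \<kappa> t j" "decay_rate \<kappa> t j < 1" "t \<le> decay_rate \<kappa> t j"
proof -
  have "0 < decay_rate \<kappa> t j \<and> decay_rate \<kappa> t j < 1 \<and> t \<le> decay_rate \<kappa> t j"
  proof (induction j)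
    case (Suc j)
    have "decay_rate \<kappa> t j powr 1 \<le> decay_rate \<kappa> t j powr (1 / real (4 * \<kappa>))"
      using Suc assms by (intro powr_mono') auto
    moreover have "decay_rate \<kappa> t j powr (1 / real (4 * \<kappa>)) < 1"
      using powr_less_mono2[of "1 / real (4 * \<kappa>)" "decay_rate \<kappa> t j" 1] Suc assms by auto
    ultimately show ?case using Suc by auto
  qed (use assms in auto)
  then show "0 < decay_rate \<kappa> t j" "decay_rate \<kappa> t j < 1" "t \<le> decay_rate \<kappa> t j" by auto
qed

lemma decay_rate_Suc_power:
  assumes "0 < t" "t < 1" "1 \<le> \<kappa>"
  shows "decay_rate \<kappa> t (Suc j) ^ (4 * \<kappa>) = decay_rate \<kappa> t j"
proof -
  note b = decay_rate_bounds[OF assms]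
  have "decay_rate \<kappa> t (Suc j) ^ (4 * \<kappa>) = decay_rate \<kappa> t (Suc j) powr real (4 * \<kappa>)"
    by (rule powr_realpow[OF b(1), symmetric])
  also have "\<dots> = decay_rate \<kappa> t j powr 1"
    using assms by (simp add: powr_powr)
  finally show ?thesis using b(1)[of j] by simp
qed

lemma decay_rate_div_power:
  assumes "0 < t" "t < 1" "1 \<le> \<kappa>"
  shows "decay_rate \<kappa> t j ^ (n div (2 * \<kappa>)) \<le>
    (1 / decay_rate \<kappa> t j) * decay_rate \<kappa> t (Suc j) ^ (2 * n)"
proof -
  note b = decay_rate_bounds[OF assms]
  define x y where "x = decay_rate \<kappa> t j" and "y = decay_rate \<kappa> t (Suc j)"
  have xy: "x = y ^ (4 * \<kappa>)" using decay_rate_Suc_power[OF assms, of j] by (simp add: x_def y_def)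
  have pos: "0 < x" "0 < y" "y < 1" using b[of j] b[of "Suc j"] by (auto simp: x_def y_def)
  have "n < 2 * \<kappa> * (n div (2 * \<kappa>)) + 2 * \<kappa>"
    using dividend_less_div_times[of "2 * \<kappa>" n] assms(3) by (simp add: mult.commute add.commute)
  then have "2 * n \<le> 4 * \<kappa> * (n div (2 * \<kappa>)) + 4 * \<kappa>" by linarith
  then have "y ^ (4 * \<kappa> * (n div (2 * \<kappa>)) + 4 * \<kappa>) \<le> y ^ (2 * n)"
    using pos by (intro power_decreasing) auto
  then have "x ^ (n div (2 * \<kappa>)) * x \<le> y ^ (2 * n)"
    by (simp add: xy power_mult power_add)
  then have "x ^ (n div (2 * \<kappa>)) \<le> y ^ (2 * n) / x" using pos by (simp add: pos_le_divide_eq)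
  then show ?thesis by (simp add: x_def y_def)
qed

section \<open>Exponential forgetting of all derivatives\<close>

text \<open>
The situation for one realization and one direction of time: \<open>G s b\<close> is the likelihood of state \<open>b\<close> at
time \<open>s\<close> as a function of the parameter, \<open>U\<close> is a ball of parameters, and \<open>c i\<close> is the contraction factor
of the block of times from \<open>i * \<kappa> + 1\<close> to \<open>i * \<kappa> + \<kappa>\<close>. Everything that holds only almost surely is an
assumption here.
\<close>

locale dominated_chain = mixing_chain p \<kappa> \<delta>
  for p :: "nat \<Rightarrow> 'h::finite \<Rightarrow> 'h \<Rightarrow> real" and \<kappa> :: nat and \<delta> :: real +
  fixes G :: "nat \<Rightarrow> 'h \<Rightarrow> real ^ 'p::finite \<Rightarrow> real" and \<iota> :: 'h and U :: "(real ^ 'p) set"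
    and L :: "'p list" and M :: "nat \<Rightarrow> real" and t \<rho> :: real and c :: "nat \<Rightarrow> real"
  assumes G_pos: "\<And>s b \<epsilon>. 0 < G s b \<epsilon>"
    and G_cont: "\<And>s b. continuous_on U (G s b)"
    and U_compact: "compact U"
    and M_nonneg: "\<And>s. 0 \<le> M s"
    and G_dominated: "\<And>s b. 1 \<le> s \<Longrightarrow> dominated U L (M s) (G s b) (G s b)"
    and M_subexp: "subexponential (\<lambda>n. \<Sum>s\<in>{0<..n}. M s)"
    and t_bounds: "0 < t" "t < 1"
    and rho_ge_1: "1 \<le> \<rho>"
    and c_cases: "\<And>i. c i = 1 \<or> c i = 1 - \<delta> / \<rho> ^ \<kappa> \<and>
      (\<forall>s\<in>{i*\<kappa><..i*\<kappa>+\<kappa>}. \<forall>\<epsilon>\<in>U. \<forall>b b'. G s b \<epsilon> \<le> \<rho> * G s b' \<epsilon>)"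
    and c_contraction: "\<forall>\<^sub>F J in sequentially. (\<Prod>i\<in>{J..<2*J}. c i) \<le> t ^ J"
begin

abbreviation W :: "nat \<Rightarrow> nat \<Rightarrow> 'h \<Rightarrow> 'h \<Rightarrow> real ^ 'p \<Rightarrow> real" where
  "W m k x y \<epsilon> \<equiv> trans_weight p (\<lambda>s b. G s b \<epsilon>) m k x y"

abbreviation K :: "nat \<Rightarrow> nat \<Rightarrow> 'h \<Rightarrow> 'h \<Rightarrow> real ^ 'p \<Rightarrow> real" where
  "K m k x y \<epsilon> \<equiv> backward_kernel (\<lambda>s b. G s b \<epsilon>) \<iota> m k x y"

definition start_ratio :: "nat \<Rightarrow> 'h \<Rightarrow> 'h \<Rightarrow> real ^ 'p \<Rightarrow> real" where
  "start_ratio n a y \<epsilon> = W 0 n a y \<epsilon> / W 0 n \<iota> y \<epsilon>"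

definition total_bound :: "nat \<Rightarrow> real" where "total_bound n = (\<Sum>s\<in>{0<..n}. M s)"

text \<open>
A domination constant valid for the start ratios and the backward kernels up to time \<open>n\<close> alike.
\<close>

definition growth :: "nat \<Rightarrow> real" where "growth n = (1 + 3 ^ length L) * total_bound n"

lemma total_bound_add: "total_bound m + (\<Sum>s\<in>{m<..m+k}. M s) = total_bound (m + k)"
proof -
  have "{0<..m+k} = {0<..m} \<union> {m<..m+k}" by auto
  then show ?thesis unfolding total_bound_def by (simp add: sum.union_disjoint)
qed

lemma total_bound_nonneg: "0 \<le> total_bound n" unfolding total_bound_def by (intro sum_nonneg M_nonneg)

lemma total_bound_mono: "m \<le> n \<Longrightarrow> total_bound m \<le> total_bound n"
  unfolding total_bound_def by (intro sum_mono2) (auto simp: M_nonneg)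

lemma growth_nonneg: "0 \<le> growth n"
  unfolding growth_def using total_bound_nonneg by (intro mult_nonneg_nonneg) auto

lemma growth_mono: "m \<le> n \<Longrightarrow> growth m \<le> growth n"
  unfolding growth_def by (intro mult_left_mono total_bound_mono) auto

lemma growth_subexp: "subexponential (\<lambda>n. (1 + growth n) ^ k)"
proof -
  have "subexponential growth"
    unfolding growth_def[abs_def] total_bound_def by (rule subexponential_mult[OF subexponential_const M_subexp])
  then show ?thesis
    by (rule subexponential_power[OF subexponential_add[OF subexponential_const]])
qed

lemma W_nonneg: "0 \<le> W m k x y \<epsilon>"
  by (rule trans_weight_nonneg) (rule G_pos)

lemma W_pos: "\<kappa> \<le> k \<Longrightarrow> 0 < W m k x y \<epsilon>"
  by (rule trans_weight_pos) (rule G_pos)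

lemma W_sum_pos: "0 < (\<Sum>y\<in>UNIV. W m k x y \<epsilon>)"
  by (rule trans_weight_sum_pos) (rule G_pos)

lemma W_continuous: "continuous_on U (W m k x y)"
proof (induction k arbitrary: y)
  case (Suc k)
  show ?case unfolding trans_weight.simps
    by (intro continuous_on_mult continuous_on_sum continuous_on_const G_cont Suc.IH)
qed (simp add: continuous_on_const)

lemma W_dominated: "dominated U L (\<Sum>s\<in>{m<..m+k}. M s) (W m k x y) (W m k x y)"
proof (induction k arbitrary: y)
  case 0
  show ?case using dominated_const[of 0 "of_bool (x = y)" U L] by simp
next
  case (Suc k)
  have "dominated U L (\<Sum>s\<in>{m<..m+k}. M s)
      (\<lambda>\<epsilon>. \<Sum>v\<in>UNIV. \<bar>p (m + k) v y\<bar> * W m k x v \<epsilon>) (\<lambda>\<epsilon>. \<Sum>v\<in>UNIV. p (m + k) v y * W m k x v \<epsilon>)"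
    by (intro dominated_sum dominated_cmult Suc.IH) auto
  then have 1: "dominated U L (\<Sum>s\<in>{m<..m+k}. M s)
      (\<lambda>\<epsilon>. \<Sum>v\<in>UNIV. p (m + k) v y * W m k x v \<epsilon>) (\<lambda>\<epsilon>. \<Sum>v\<in>UNIV. p (m + k) v y * W m k x v \<epsilon>)"
    using p_nonneg by simp
  have "dominated U L ((\<Sum>s\<in>{m<..m+k}. M s) + M (m + k + 1))
     (\<lambda>\<epsilon>. (\<Sum>v\<in>UNIV. p (m + k) v y * W m k x v \<epsilon>) * G (m + k + 1) y \<epsilon>)
     (\<lambda>\<epsilon>. (\<Sum>v\<in>UNIV. p (m + k) v y * W m k x v \<epsilon>) * G (m + k + 1) y \<epsilon>)"
    by (intro dominated_mult 1 G_dominated)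
       (auto intro!: sum_nonneg mult_nonneg_nonneg M_nonneg W_nonneg p_nonneg simp: G_pos less_imp_le)
  moreover have "{m<..m + Suc k} = insert (m + k + 1) {m<..m+k}" by auto
  ultimately show ?case by (simp add: add.commute)
qed

lemma W_dominated_total: "dominated U L (total_bound k) (W 0 k x y) (W 0 k x y)"
  using W_dominated[of 0 k] by (simp add: total_bound_def)

lemma start_ratio_dominated:
  assumes "\<kappa> \<le> n"
  shows "dominated U L (growth n) (start_ratio n a y) (start_ratio n a y)"
proof -
  have "dominated U L (total_bound n + 3 ^ length L * total_bound n)
     (\<lambda>\<epsilon>. W 0 n a y \<epsilon> / W 0 n \<iota> y \<epsilon>) (\<lambda>\<epsilon>. W 0 n a y \<epsilon> / W 0 n \<iota> y \<epsilon>)"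
    by (intro dominated_divide W_dominated_total) (use assms in \<open>auto intro: total_bound_nonneg W_pos W_nonneg\<close>)
  then show ?thesis
    unfolding start_ratio_def[abs_def] growth_def by (simp add: distrib_right)
qed

lemma K_dominated:
  assumes "\<kappa> \<le> m + k"
  shows "dominated U L (growth (m + k)) (K m k x y) (K m k x y)"
proof -
  have "dominated U L (total_bound m + (\<Sum>s\<in>{m<..m+k}. M s) + 3 ^ length L * total_bound (m + k))
     (\<lambda>\<epsilon>. W 0 m \<iota> x \<epsilon> * W m k x y \<epsilon> / W 0 (m + k) \<iota> y \<epsilon>)
     (\<lambda>\<epsilon>. W 0 m \<iota> x \<epsilon> * W m k x y \<epsilon> / W 0 (m + k) \<iota> y \<epsilon>)"
    by (intro dominated_divide dominated_mult W_dominated_total W_dominated)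
       (use assms in \<open>auto intro!: total_bound_nonneg W_pos W_nonneg sum_nonneg M_nonneg add_nonneg_nonneg mult_nonneg_nonneg\<close>)
  then show ?thesis
    unfolding backward_kernel_def growth_def total_bound_add by (simp add: distrib_right)
qed

lemma K_nonneg: "0 \<le> K m k x y \<epsilon>"
  by (rule backward_kernel_nonneg) (rule G_pos)

lemma K_sum: "\<kappa> \<le> m + k \<Longrightarrow> (\<Sum>x\<in>UNIV. K m k x y \<epsilon>) = 1"
  by (rule backward_kernel_sum) (rule G_pos)

lemma start_ratio_mult:
  assumes "\<kappa> \<le> n"
  shows "start_ratio n a x \<epsilon> * W 0 n \<iota> x \<epsilon> = W 0 n a x \<epsilon>"
  using W_pos[OF assms, of \<epsilon> 0 \<iota> x] by (simp add: start_ratio_def)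

lemma start_ratio_add:
  assumes "\<kappa> \<le> m"
  shows "start_ratio (m + k) a y \<epsilon> = (\<Sum>x\<in>UNIV. start_ratio m a x \<epsilon> * K m k x y \<epsilon>)"
  unfolding start_ratio_def[of "m + k"] trans_weight_add[of p _ 0 m k a y] backward_kernel_def
  by (simp only: times_divide_eq_right mult.assoc[symmetric] start_ratio_mult[OF assms] sum_divide_distrib add_0)

lemma start_ratio_nonneg: "0 \<le> start_ratio n a y \<epsilon>"
  unfolding start_ratio_def by (intro divide_nonneg_nonneg W_nonneg)

text \<open>
From time \<open>\<kappa>\<close> on the ratios are averages of the ratios at time \<open>\<kappa>\<close>, which are continuous on the compact
set \<open>U\<close>.
\<close>

lemma start_ratio_bounded: "\<exists>B\<ge>0. \<forall>n\<ge>\<kappa>. \<forall>a y. \<forall>\<epsilon>\<in>U. start_ratio n a y \<epsilon> \<le> B"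
proof -
  have "continuous_on U (start_ratio \<kappa> a y)" for a y
  proof -
    have "W 0 \<kappa> \<iota> y \<epsilon> \<noteq> 0" for \<epsilon> using W_pos[of \<kappa> \<epsilon> 0 \<iota> y] by simp
    then show ?thesis unfolding start_ratio_def[abs_def] by (intro continuous_on_divide W_continuous) auto
  qed
  then have "bounded (start_ratio \<kappa> a y ` U)" for a y
    using U_compact compact_continuous_image compact_imp_bounded by blast
  then have "\<exists>b. \<forall>\<epsilon>\<in>U. \<bar>start_ratio \<kappa> a y \<epsilon>\<bar> \<le> b" for a y
    by (auto simp: bounded_iff)
  then obtain b where b: "\<And>a y \<epsilon>. \<epsilon> \<in> U \<Longrightarrow> \<bar>start_ratio \<kappa> a y \<epsilon>\<bar> \<le> b a y" by metis
  define B where "B = Max (insert 0 (range (\<lambda>(a, y). b a y)))"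
  have bB: "b a y \<le> B" for a y unfolding B_def by (intro Max_ge) auto
  have B0: "0 \<le> B" unfolding B_def by (intro Max_ge) auto
  have "start_ratio n a y \<epsilon> \<le> B" if n: "n \<ge> \<kappa>" and e: "\<epsilon> \<in> U" for n a y \<epsilon>
  proof -
    obtain k where k: "n = \<kappa> + k" using n le_Suc_ex by blast
    have "start_ratio n a y \<epsilon> = (\<Sum>x\<in>UNIV. start_ratio \<kappa> a x \<epsilon> * K \<kappa> k x y \<epsilon>)"
      unfolding k by (rule start_ratio_add) simp
    also have "\<dots> \<le> (\<Sum>x\<in>UNIV. B * K \<kappa> k x y \<epsilon>)"
      using b[OF e] bB by (intro sum_mono mult_right_mono K_nonneg) (meson abs_le_D1 order_trans)
    also have "\<dots> = B" using K_sum[of \<kappa> k \<epsilon> y] by (simp add: sum_distrib_left[symmetric])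
    finally show ?thesis .
  qed
  then show ?thesis using B0 by blast
qed

text \<open>
One step of the induction on the order. At time \<open>J * \<kappa>\<close> the derivatives of lower order have oscillation at
most \<open>E\<close>; the \<open>J\<close> blocks that follow contract the derivative of full order, for which only the crude bound
by domination is used.
\<close>

lemma oscillation_step:
  assumes n: "n = J * \<kappa> + (J * \<kappa> + l)" and J: "1 \<le> J" and B: "subseq B L" and e: "\<epsilon> \<in> U"
    and low: "\<And>B' a x x' \<epsilon>. subseq B' L \<Longrightarrow> length B' < length B \<Longrightarrow> \<epsilon> \<in> U \<Longrightarrow>
      \<bar>iter_partial B' (start_ratio (J * \<kappa>) a x) \<epsilon> - iter_partial B' (start_ratio (J * \<kappa>) a x') \<epsilon>\<bar> \<le> E"
    and E: "0 \<le> E"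
    and Rb: "\<And>n a y \<epsilon>. \<kappa> \<le> n \<Longrightarrow> \<epsilon> \<in> U \<Longrightarrow> start_ratio n a y \<epsilon> \<le> Rb"
  shows "\<bar>iter_partial B (start_ratio n a y) \<epsilon> - iter_partial B (start_ratio n a y') \<epsilon>\<bar> \<le>
     (\<Prod>i\<in>{J..<2*J}. c i) * (2 * (growth n ^ length B * Rb)) + E * 2 * (1 + growth n) ^ length B"
proof -
  define m k where "m = J * \<kappa>" and "k = J * \<kappa> + l"
  have nmk: "n = m + k" using n by (simp add: m_def k_def)
  have km: "\<kappa> \<le> m" using J by (simp add: m_def)
  then have kn: "\<kappa> \<le> n" by (simp add: nmk)
  define D where "D x \<epsilon> = start_ratio m a x \<epsilon> - start_ratio m a \<iota> \<epsilon>" for x \<epsilon>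
  define Q where "Q x \<epsilon> = K m k x y \<epsilon> - K m k x y' \<epsilon>" for x \<epsilon>
  have R_dom: "dominated U B (growth n) (start_ratio n a y) (start_ratio n a y)" if "\<kappa> \<le> n" for n y
    using dominated_subseq[OF start_ratio_dominated[OF that] B] .
  have Q_dom: "dominated U B (growth n) (\<lambda>\<epsilon>. K m k x y \<epsilon> + K m k x y' \<epsilon>) (Q x)" for x
    unfolding Q_def[abs_def] using km nmk
    by (intro dominated_diff dominated_subseq[OF _ B]) (auto intro!: K_dominated)
  have D_low: "low_order_bound U B E (D x)" for x
    unfolding low_order_bound_def
  proof (intro allI impI conjI ballI)
    fix B' assume B': "subseq B' B"
    have ex: "iter_partial_exists B' (start_ratio m a x)" for x
      using dominated_subseq[OF R_dom[OF km] B'] dominatedD(1) by blast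
    show "iter_partial_exists B' (D x)"
      unfolding D_def[abs_def] by (intro iter_partial_diff ex)
    fix \<epsilon> assume "length B' < length B" "\<epsilon> \<in> U"
    then show "\<bar>iter_partial B' (D x) \<epsilon>\<bar> \<le> E"
      unfolding D_def[abs_def] iter_partial_diff(2)[OF ex ex]
      using subseq_order.order_trans[OF B' B] by (intro low[folded m_def]) auto
  qed
  \<comment> \<open>As the columns of the kernel have equal sums, \<open>start_ratio m a\<close> may be centred at an arbitrary
    state; \<open>\<iota>\<close> is as good as any.\<close>
  have eq: "start_ratio n a y \<epsilon> - start_ratio n a y' \<epsilon> = (\<Sum>x\<in>UNIV. D x \<epsilon> * Q x \<epsilon>)" for \<epsilon>
  proof -
    have "(\<Sum>x\<in>UNIV. Q x \<epsilon>) = 0"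
      using K_sum[of m k] km by (simp add: Q_def sum_subtractf)
    then have "(\<Sum>x\<in>UNIV. start_ratio m a \<iota> \<epsilon> * Q x \<epsilon>) = 0"
      by (simp add: sum_distrib_left[symmetric])
    moreover have "start_ratio n a y \<epsilon> - start_ratio n a y' \<epsilon> = (\<Sum>x\<in>UNIV. start_ratio m a x \<epsilon> * Q x \<epsilon>)"
      unfolding nmk start_ratio_add[OF km] by (simp add: Q_def right_diff_distrib sum_subtractf)
    ultimately show ?thesis by (simp add: D_def left_diff_distrib sum_subtractf)
  qed
  have exR: "iter_partial_exists B (start_ratio n a y)" if "\<kappa> \<le> n" for n y
    using R_dom[OF that] dominatedD(1) by blast
  have exD: "iter_partial_exists B (D x)" for x
    unfolding D_def[abs_def] by (intro iter_partial_diff exR km)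
  \<comment> \<open>On the empty set domination is mere existence of the derivatives.\<close>
  have "dominated {} B (1 + growth n) (\<lambda>\<epsilon>. 1 * 1) (\<lambda>\<epsilon>. D x \<epsilon> * Q x \<epsilon>)" for x
    by (rule dominated_mult)
       (use D_low[of x] Q_dom[of x] growth_nonneg in \<open>auto simp: low_order_bound_def dominated_def\<close>)
  then have exDQ: "iter_partial_exists B (\<lambda>\<epsilon>. D x \<epsilon> * Q x \<epsilon>)" for x
    using dominatedD(1) by blast
  have split: "iter_partial B (start_ratio n a y) \<epsilon> - iter_partial B (start_ratio n a y') \<epsilon> =
     (\<Sum>x\<in>UNIV. iter_partial B (\<lambda>\<epsilon>. D x \<epsilon> * Q x \<epsilon>) \<epsilon>)"
    using fun_cong[OF iter_partial_diff(2)[OF exR[OF kn, of y] exR[OF kn, of y']], of \<epsilon>]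
      fun_cong[OF iter_partial_sum(2)[of UNIV B "\<lambda>x \<epsilon>. D x \<epsilon> * Q x \<epsilon>"], of \<epsilon>] exDQ
    by (simp add: eq)
  have lower: "\<bar>(\<Sum>x\<in>UNIV. iter_partial B (\<lambda>\<epsilon>. D x \<epsilon> * Q x \<epsilon>) \<epsilon>) - (\<Sum>x\<in>UNIV. iter_partial B (D x) \<epsilon> * Q x \<epsilon>)\<bar>
      \<le> E * 2 * (1 + growth n) ^ length B"
  proof -
    have "\<bar>(\<Sum>x\<in>UNIV. iter_partial B (\<lambda>\<epsilon>. D x \<epsilon> * Q x \<epsilon>) \<epsilon>) - (\<Sum>x\<in>UNIV. iter_partial B (D x) \<epsilon> * Q x \<epsilon>)\<bar>
      \<le> (\<Sum>x\<in>UNIV. \<bar>iter_partial B (\<lambda>\<epsilon>. D x \<epsilon> * Q x \<epsilon>) \<epsilon> - iter_partial B (D x) \<epsilon> * Q x \<epsilon>\<bar>)"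
      unfolding sum_subtractf[symmetric] by (rule sum_abs)
    also have "\<dots> \<le> (\<Sum>x\<in>UNIV. E * (K m k x y \<epsilon> + K m k x y' \<epsilon>) * (1 + growth n) ^ length B)"
      by (intro sum_mono leibniz_top_order[OF D_low Q_dom growth_nonneg E _ e] add_nonneg_nonneg K_nonneg)
    also have "\<dots> = E * (\<Sum>x\<in>UNIV. K m k x y \<epsilon> + K m k x y' \<epsilon>) * (1 + growth n) ^ length B"
      by (simp add: sum_distrib_left sum_distrib_right)
    also have "(\<Sum>x\<in>UNIV. K m k x y \<epsilon> + K m k x y' \<epsilon>) = 2"
      using km by (simp add: sum.distrib K_sum)
    finally show ?thesis .
  qed
  have top: "\<bar>\<Sum>x\<in>UNIV. iter_partial B (D x) \<epsilon> * Q x \<epsilon>\<bar> \<le>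
      (\<Prod>i\<in>{J..<2*J}. c i) * (2 * (growth n ^ length B * Rb))"
  proof -
    have fD: "iter_partial B (D x) \<epsilon> = iter_partial B (start_ratio m a x) \<epsilon> - iter_partial B (start_ratio m a \<iota>) \<epsilon>" for x
      unfolding D_def[abs_def] using fun_cong[OF iter_partial_diff(2)[OF exR[OF km, of x] exR[OF km, of \<iota>]]] .
    have Rbound: "\<bar>iter_partial B (start_ratio m a x) \<epsilon>\<bar> \<le> growth n ^ length B * Rb" for x
    proof -
      have "\<bar>iter_partial B (start_ratio m a x) \<epsilon>\<bar> \<le> growth m ^ length B * start_ratio m a x \<epsilon>"
        by (rule dominatedD(2)[OF R_dom[OF km] e])
      also have "\<dots> \<le> growth n ^ length B * Rb"
        using nmk by (intro mult_mono power_mono growth_mono growth_nonneg Rb e km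
            zero_le_power start_ratio_nonneg) auto
      finally show ?thesis .
    qed
    have osc: "\<bar>iter_partial B (D x) \<epsilon> - iter_partial B (D x') \<epsilon>\<bar> \<le> 2 * (growth n ^ length B * Rb)" for x x'
      using Rbound[of x] Rbound[of x'] unfolding fD by linarith
    have "\<bar>(\<Sum>x\<in>UNIV. iter_partial B (D x) \<epsilon> * K m (J * \<kappa> + l) x y \<epsilon>) -
        (\<Sum>x\<in>UNIV. iter_partial B (D x) \<epsilon> * K m (J * \<kappa> + l) x y' \<epsilon>)\<bar>
       \<le> (\<Prod>i<J. c (J + i)) * (2 * (growth n ^ length B * Rb))"
    proof (rule backward_kernel_contraction[OF G_pos rho_ge_1 km _ osc])
      fix i
      show "c (J + i) = 1 \<or> c (J + i) = 1 - \<delta> / \<rho> ^ \<kappa> \<and>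
        (\<forall>s\<in>{m + i * \<kappa><..m + i * \<kappa> + \<kappa>}. \<forall>b b'. G s b \<epsilon> \<le> \<rho> * G s b' \<epsilon>)"
        using c_cases[of "J + i"] e by (auto simp: m_def algebra_simps)
    qed
    moreover have "(\<Prod>i<J. c (J + i)) = (\<Prod>i\<in>{J..<2*J}. c i)"
      by (rule prod.reindex_bij_witness[of _ "\<lambda>i. i - J" "\<lambda>i. J + i"]) auto
    ultimately show ?thesis
      unfolding Q_def by (simp add: k_def right_diff_distrib sum_subtractf)
  qed
  show ?thesis using split lower top by linarith
qed

text \<open>
Induction on the order. The crude bound is subexponential and gains the factor \<open>t ^ J\<close>; the terms of lower
order are subexponential multiples of the oscillation at time \<open>J * \<kappa>\<close>. Both are at most a subexponential
multiple of \<open>decay_rate \<kappa> t j ^ J\<close>, with \<open>J = n div (2 * \<kappa>)\<close>.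
\<close>

lemma start_ratio_oscillation:
  "\<exists>C. \<forall>\<^sub>F n in sequentially. \<forall>B a y y'. \<forall>\<epsilon>\<in>U. subseq B L \<and> length B < j \<longrightarrow>
     \<bar>iter_partial B (start_ratio n a y) \<epsilon> - iter_partial B (start_ratio n a y') \<epsilon>\<bar>
       \<le> C * decay_rate \<kappa> t j ^ n"
proof (induction j)
  case 0
  show ?case by simp
next
  case (Suc j)
  define x y where "x = decay_rate \<kappa> t j" and "y = decay_rate \<kappa> t (Suc j)"
  note rb = decay_rate_bounds[OF t_bounds kappa_pos]
  have x: "0 < x" "x < 1" "t \<le> x" and y: "0 < y" "y < 1"
    using rb by (auto simp: x_def y_def simp del: decay_rate.simps)
  obtain C0 N0 where C0: "\<And>n B a z z' \<epsilon>. N0 \<le> n \<Longrightarrow> \<epsilon> \<in> U \<Longrightarrow> subseq B L \<Longrightarrow> length B < j \<Longrightarrow>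
     \<bar>iter_partial B (start_ratio n a z) \<epsilon> - iter_partial B (start_ratio n a z') \<epsilon>\<bar> \<le> C0 * x ^ n"
    using Suc.IH unfolding eventually_sequentially x_def by blast
  obtain N1 where N1: "\<And>J. N1 \<le> J \<Longrightarrow> (\<Prod>i\<in>{J..<2*J}. c i) \<le> t ^ J"
    using c_contraction unfolding eventually_sequentially by blast
  obtain Rb where Rb: "0 \<le> Rb" "\<And>n a y \<epsilon>. \<kappa> \<le> n \<Longrightarrow> \<epsilon> \<in> U \<Longrightarrow> start_ratio n a y \<epsilon> \<le> Rb"
    using start_ratio_bounded by blast
  obtain C1 where C1: "\<And>n. \<bar>(1 + growth n) ^ length L\<bar> * y ^ (2 * n) \<le> C1 * y ^ n"
    using subexponential_absorb[OF growth_subexp y, of "length L"] by blast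
  define A where "A = 2 * Rb + 2 * \<bar>C0\<bar>"
  have A: "0 \<le> A" using Rb by (auto simp: A_def)
  have "\<bar>iter_partial B (start_ratio n a z) \<epsilon> - iter_partial B (start_ratio n a z') \<epsilon>\<bar> \<le> (A / x * C1) * y ^ n"
    if n: "2 * \<kappa> * (N0 + N1 + 1) \<le> n" and e: "\<epsilon> \<in> U" and B: "subseq B L" "length B < Suc j"
    for n B a z z' \<epsilon>
  proof -
    \<comment> \<open>The first \<open>J\<close> blocks make the lower orders small, the next \<open>J\<close> blocks contract the top order.\<close>
    define J where "J = n div (2 * \<kappa>)"
    have J: "N0 + N1 + 1 \<le> J"
      using div_le_mono[OF n, of "2 * \<kappa>"] kappa_pos by (simp add: J_def)
    have JJ: "J \<le> J * \<kappa>" using kappa_pos by simp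
    then have N0J: "N0 \<le> J * \<kappa>" using J by linarith
    have nJ: "n = J * \<kappa> + (J * \<kappa> + n mod (2 * \<kappa>))"
      using div_mult_mod_eq[of n "2 * \<kappa>"] by (simp add: J_def algebra_simps)
    have "\<bar>iter_partial B (start_ratio n a z) \<epsilon> - iter_partial B (start_ratio n a z') \<epsilon>\<bar> \<le>
       (\<Prod>i\<in>{J..<2*J}. c i) * (2 * (growth n ^ length B * Rb)) + \<bar>C0\<bar> * x ^ J * 2 * (1 + growth n) ^ length B"
    proof (rule oscillation_step[OF nJ _ B(1) e _ _ Rb(2)])
      fix B' a z z' \<epsilon> assume *: "subseq B' L" "length B' < length B" "\<epsilon> \<in> U"
      have "\<bar>iter_partial B' (start_ratio (J * \<kappa>) a z) \<epsilon> - iter_partial B' (start_ratio (J * \<kappa>) a z') \<epsilon>\<bar>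
         \<le> C0 * x ^ (J * \<kappa>)"
        by (rule C0[OF N0J]) (use * B in auto)
      also have "\<dots> \<le> \<bar>C0\<bar> * x ^ J"
        using x JJ by (intro mult_mono power_decreasing) auto
      finally show "\<bar>iter_partial B' (start_ratio (J * \<kappa>) a z) \<epsilon> -
          iter_partial B' (start_ratio (J * \<kappa>) a z') \<epsilon>\<bar> \<le> \<bar>C0\<bar> * x ^ J" .
    qed (use J x in auto)
    also have "\<dots> \<le> x ^ J * (2 * ((1 + growth n) ^ length L * Rb)) + \<bar>C0\<bar> * x ^ J * 2 * (1 + growth n) ^ length L"
    proof -
      have lenB: "length B \<le> length L" using B(1) not_subseq_length not_le by blast
      have 1: "(1 + growth n) ^ length B \<le> (1 + growth n) ^ length L"
        using growth_nonneg[of n] lenB by (intro power_increasing) auto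
      have 2: "growth n ^ length B \<le> (1 + growth n) ^ length L"
        using growth_nonneg[of n] by (intro order_trans[OF power_mono 1]) auto
      have "(\<Prod>i\<in>{J..<2*J}. c i) \<le> t ^ J" by (rule N1) (use J in simp)
      also have "\<dots> \<le> x ^ J" using x t_bounds by (intro power_mono) auto
      finally show ?thesis
        using 1 2 x Rb(1) growth_nonneg[of n]
        by (intro add_mono mult_mono mult_left_mono mult_nonneg_nonneg) auto
    qed
    also have "\<dots> = A * (1 + growth n) ^ length L * x ^ J"
      by (simp add: A_def algebra_simps)
    also have "\<dots> \<le> A * (1 + growth n) ^ length L * ((1 / x) * y ^ (2 * n))"
      using A growth_nonneg[of n] decay_rate_div_power[OF t_bounds kappa_pos, of j n]
      unfolding J_def x_def y_def by (intro mult_left_mono mult_nonneg_nonneg) auto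
    also have "\<dots> = A / x * (\<bar>(1 + growth n) ^ length L\<bar> * y ^ (2 * n))"
      using growth_nonneg[of n] by simp
    also have "\<dots> \<le> A / x * (C1 * y ^ n)" using A x by (intro mult_left_mono C1) auto
    finally show ?thesis by simp
  qed
  then show ?case unfolding eventually_sequentially y_def by blast
qed

definition start_quotient :: "nat \<Rightarrow> 'h \<Rightarrow> real ^ 'p \<Rightarrow> real" where
  "start_quotient n a \<epsilon> = (\<Sum>y\<in>UNIV. W 0 n a y \<epsilon>) / (\<Sum>y\<in>UNIV. W 0 n \<iota> y \<epsilon>)"

lemma sum_W_dominated:
  "dominated U L (total_bound n) (\<lambda>\<epsilon>. \<Sum>y\<in>UNIV. W 0 n a y \<epsilon>) (\<lambda>\<epsilon>. \<Sum>y\<in>UNIV. W 0 n a y \<epsilon>)"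
  by (intro dominated_sum W_dominated_total) auto

lemma start_quotient_exists: "iter_partial_exists L (start_quotient n a)"
proof -
  have "dominated U L (total_bound n + 3 ^ length L * total_bound n) (start_quotient n a) (start_quotient n a)"
    unfolding start_quotient_def[abs_def]
    by (intro dominated_divide sum_W_dominated total_bound_nonneg W_sum_pos sum_nonneg W_nonneg)
  then show ?thesis using dominatedD(1) by blast
qed

text \<open>
Consecutive quotients average the same function \<open>start_ratio n a\<close> with respect to two probability vectors.
The difference of the two vectors has mass zero, also after differentiation, so only the oscillations of
the derivatives of \<open>start_ratio n a\<close> enter.
\<close>

lemma start_quotient_increment:
  "\<exists>C. \<forall>\<^sub>F n in sequentially. \<forall>a. \<forall>\<epsilon>\<in>U.
     \<bar>iter_partial L (start_quotient (Suc n) a) \<epsilon> - iter_partial L (start_quotient n a) \<epsilon>\<bar>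
       \<le> C * decay_rate \<kappa> t (length L + 2) ^ n"
proof -
  define x y where "x = decay_rate \<kappa> t (length L + 1)" and "y = decay_rate \<kappa> t (length L + 2)"
  note rb = decay_rate_bounds[OF t_bounds kappa_pos]
  have x: "0 < x" "x < 1" and y: "0 < y" "y < 1"
    using rb unfolding x_def y_def by blast+
  obtain C0 N0 where C0: "\<And>n B a z z' \<epsilon>. N0 \<le> n \<Longrightarrow> \<epsilon> \<in> U \<Longrightarrow> subseq B L \<Longrightarrow> length B < length L + 1 \<Longrightarrow>
     \<bar>iter_partial B (start_ratio n a z) \<epsilon> - iter_partial B (start_ratio n a z') \<epsilon>\<bar> \<le> C0 * x ^ n"
    using start_ratio_oscillation[of "length L + 1"] unfolding eventually_sequentially x_def by blast
  obtain C1 where C1: "\<And>n. \<bar>(1 + growth (Suc n)) ^ length L\<bar> * y ^ (2 * n) \<le> C1 * y ^ n"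
    using subexponential_absorb[OF subexponential_Suc[OF growth_subexp] y, of "length L"] by blast
  have "\<bar>iter_partial L (start_quotient (Suc n) a) \<epsilon> - iter_partial L (start_quotient n a) \<epsilon>\<bar>
       \<le> (2 * \<bar>C0\<bar> * C1) * y ^ n"
    if n: "N0 + \<kappa> \<le> n" and e: "\<epsilon> \<in> U" for n a \<epsilon>
  proof -
    have kn: "\<kappa> \<le> n" using n by simp
    define E where "E = \<bar>C0\<bar> * x ^ n"
    have E: "0 \<le> E" using x by (simp add: E_def)
    define D where "D z \<epsilon> = start_ratio n a z \<epsilon> - start_ratio n a \<iota> \<epsilon>" for z \<epsilon>
    \<comment> \<open>\<open>k0\<close> and \<open>k1\<close> are the laws at time \<open>n\<close> of the weighted paths from \<open>\<iota>\<close> of length \<open>n\<close> and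
      \<open>n + 1\<close>.\<close>
    define k0 where "k0 z \<epsilon> = W 0 n \<iota> z \<epsilon> / (\<Sum>y\<in>UNIV. W 0 n \<iota> y \<epsilon>)" for z \<epsilon>
    define k1 where "k1 z \<epsilon> = W 0 n \<iota> z \<epsilon> * (\<Sum>y\<in>UNIV. W n 1 z y \<epsilon>) / (\<Sum>y\<in>UNIV. W 0 (n + 1) \<iota> y \<epsilon>)" for z \<epsilon>
    have W1: "(\<Sum>y\<in>UNIV. W 0 (n + 1) a y \<epsilon>) = (\<Sum>z\<in>UNIV. W 0 n a z \<epsilon> * (\<Sum>y\<in>UNIV. W n 1 z y \<epsilon>))" for a \<epsilon>
      unfolding trans_weight_add[of p _ 0 n 1] sum_distrib_left
      by (subst sum.swap) simp
    have nz: "(\<Sum>y\<in>UNIV. W 0 n \<iota> y \<epsilon>) \<noteq> 0" "(\<Sum>y\<in>UNIV. W 0 (n + 1) \<iota> y \<epsilon>) \<noteq> 0" for n \<epsilon>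
      using W_sum_pos[of \<epsilon> 0 n \<iota>] W_sum_pos[of \<epsilon> 0 "n + 1" \<iota>] by (auto simp del: trans_weight.simps)
    have s0: "(\<Sum>z\<in>UNIV. k0 z \<epsilon>) = 1" and s1: "(\<Sum>z\<in>UNIV. k1 z \<epsilon>) = 1" for \<epsilon>
      unfolding k0_def k1_def sum_divide_distrib[symmetric] W1[symmetric] using nz by auto
    have pos: "0 \<le> k0 z \<epsilon>" "0 \<le> k1 z \<epsilon>" for z \<epsilon>
      unfolding k0_def k1_def by (intro divide_nonneg_nonneg mult_nonneg_nonneg sum_nonneg W_nonneg)+
    have q0: "start_quotient n a \<epsilon> = (\<Sum>z\<in>UNIV. start_ratio n a z \<epsilon> * k0 z \<epsilon>)" for \<epsilon>
      unfolding start_quotient_def k0_def by (simp add: start_ratio_mult[OF kn] sum_divide_distrib)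
    have q1: "start_quotient (n + 1) a \<epsilon> = (\<Sum>z\<in>UNIV. start_ratio n a z \<epsilon> * k1 z \<epsilon>)" for \<epsilon>
    proof -
      have "start_ratio n a z \<epsilon> * k1 z \<epsilon> = W 0 n a z \<epsilon> * (\<Sum>y\<in>UNIV. W n 1 z y \<epsilon>) / (\<Sum>y\<in>UNIV. W 0 (n + 1) \<iota> y \<epsilon>)" for z
        unfolding k1_def
        by (simp only: times_divide_eq_right mult.assoc[symmetric] start_ratio_mult[OF kn])
      then show ?thesis unfolding start_quotient_def W1[of _ a] sum_divide_distrib by simp
    qed
    have diff: "start_quotient (n + 1) a \<epsilon> - start_quotient n a \<epsilon> = (\<Sum>z\<in>UNIV. D z \<epsilon> * (k1 z \<epsilon> - k0 z \<epsilon>))" for \<epsilon>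
    proof -
      have "(\<Sum>z\<in>UNIV. start_ratio n a \<iota> \<epsilon> * (k1 z \<epsilon> - k0 z \<epsilon>)) = 0"
        by (simp add: sum_distrib_left[symmetric] sum_subtractf s0 s1)
      then show ?thesis unfolding q0 q1 D_def
        by (simp add: left_diff_distrib right_diff_distrib sum_subtractf)
    qed
    have d0: "dominated U L (growth (n + 1)) (k0 z) (k0 z)" for z
    proof -
      have 1: "dominated U L (total_bound n + 3 ^ length L * total_bound n) (k0 z) (k0 z)"
        unfolding k0_def[abs_def]
        by (intro dominated_divide sum_W_dominated W_dominated_total total_bound_nonneg W_sum_pos W_nonneg)
      show ?thesis
        by (rule dominated_mono[OF 1])
           (use total_bound_mono[of n "n + 1"] total_bound_nonneg[of n] pos in
             \<open>auto simp: growth_def distrib_right intro!: add_mono mult_left_mono\<close>)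
    qed
    have d1: "dominated U L (growth (n + 1)) (k1 z) (k1 z)" for z
    proof -
      have "dominated U L (total_bound n + (\<Sum>s\<in>{n<..n+1}. M s) + 3 ^ length L * total_bound (n + 1)) (k1 z) (k1 z)"
        unfolding k1_def[abs_def]
        by (intro dominated_divide dominated_mult sum_W_dominated W_dominated_total dominated_sum W_dominated
            total_bound_nonneg W_sum_pos W_nonneg sum_nonneg M_nonneg add_nonneg_nonneg mult_nonneg_nonneg) auto
      then show ?thesis unfolding total_bound_add by (simp add: growth_def distrib_right)
    qed
    have dD: "dominated U L 1 (\<lambda>\<epsilon>. E) (D z)" for z
      unfolding dominated_def
    proof (intro allI impI conjI ballI)
      fix B assume B: "subseq B L"
      have lenB: "length B \<le> length L" using B not_subseq_length not_le by blast
      have ex: "iter_partial_exists B (start_ratio n a z)" for z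
        using dominated_subseq[OF start_ratio_dominated[OF kn] B] dominatedD(1) by blast
      show "iter_partial_exists B (D z)"
        unfolding D_def[abs_def] by (intro iter_partial_diff ex)
      fix \<epsilon> assume "\<epsilon> \<in> U"
      then have "\<bar>iter_partial B (D z) \<epsilon>\<bar> \<le> C0 * x ^ n"
        unfolding D_def[abs_def] iter_partial_diff(2)[OF ex ex]
        using B n lenB by (intro C0) auto
      also have "\<dots> \<le> E" unfolding E_def using x by (intro mult_right_mono) auto
      finally show "\<bar>iter_partial B (D z) \<epsilon>\<bar> \<le> 1 ^ length B * E" by simp
    qed
    have "dominated U L (1 + growth (n + 1)) (\<lambda>\<epsilon>. \<Sum>z\<in>UNIV. E * (k1 z \<epsilon> + k0 z \<epsilon>))
        (\<lambda>\<epsilon>. \<Sum>z\<in>UNIV. D z \<epsilon> * (k1 z \<epsilon> - k0 z \<epsilon>))"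
      by (intro dominated_sum dominated_mult dD dominated_diff d0 d1 growth_nonneg add_nonneg_nonneg pos E) auto
    from dominatedD(2)[OF this e]
    have "\<bar>iter_partial L (\<lambda>\<epsilon>. start_quotient (n + 1) a \<epsilon> - start_quotient n a \<epsilon>) \<epsilon>\<bar> \<le>
        (1 + growth (n + 1)) ^ length L * (2 * E)"
      unfolding diff by (simp add: sum_distrib_left[symmetric] sum.distrib s0 s1)
    then have "\<bar>iter_partial L (start_quotient (Suc n) a) \<epsilon> - iter_partial L (start_quotient n a) \<epsilon>\<bar> \<le>
        (1 + growth (Suc n)) ^ length L * (2 * E)"
      using iter_partial_diff(2)[OF start_quotient_exists start_quotient_exists, of "n + 1" a n a] by simp
    also have "\<dots> = 2 * \<bar>C0\<bar> * (\<bar>(1 + growth (Suc n)) ^ length L\<bar> * x ^ n)"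
      using growth_nonneg[of "Suc n"] by (simp add: E_def)
    also have "\<dots> \<le> 2 * \<bar>C0\<bar> * (\<bar>(1 + growth (Suc n)) ^ length L\<bar> * y ^ (2 * n))"
    proof -
      have "x = y ^ (4 * \<kappa>)"
        using decay_rate_Suc_power[OF t_bounds kappa_pos, of "length L + 1"] by (simp add: x_def y_def)
      then have "x ^ n = y ^ (4 * \<kappa> * n)" by (simp add: power_mult)
      also have "\<dots> \<le> y ^ (2 * n)" using y kappa_pos by (intro power_decreasing) auto
      finally show ?thesis by (intro mult_left_mono) auto
    qed
    also have "\<dots> \<le> 2 * \<bar>C0\<bar> * (C1 * y ^ n)" by (intro mult_left_mono C1) auto
    finally show ?thesis by simp
  qed
  then show ?thesis unfolding eventually_sequentially y_def by blast
qed

end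

section \<open>Path expectations of a Markov chain\<close>

lemma path_event_sets:
  assumes "\<And>i. X i \<in> measurable M (count_space UNIV)" "finite I"
  shows "{v\<in>space M. \<forall>i\<in>I. X i v = u i} \<in> sets M"
proof (rule sets.sets_Collect_finite_All[OF _ assms(2)])
  fix i
  have "X i -` {u i} \<inter> space M \<in> sets M" by (rule measurable_sets[OF assms(1)]) simp
  also have "X i -` {u i} \<inter> space M = {v\<in>space M. X i v = u i}" by auto
  finally show "{v\<in>space M. X i v = u i} \<in> sets M" .
qed

context prob_space
begin

text \<open>
A function of the path up to time \<open>m + k\<close> takes finitely many values; summing over the paths reduces the claim
to the Markov property of path probabilities.
\<close>

lemma markov_path_step:
  fixes X :: "nat \<Rightarrow> 'a \<Rightarrow> 'h::finite" and F :: "(nat \<Rightarrow> 'h) \<Rightarrow> real" and m k :: nat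
  assumes [measurable]: "\<And>i. X i \<in> measurable M (count_space UNIV)"
    and markov: "\<And>m k u. prob {v\<in>space M. \<forall>i\<in>{m..Suc (m + k)}. X i v = u i} =
       p (m + k) (u (m + k)) (u (Suc (m + k))) * prob {v\<in>space M. \<forall>i\<in>{m..m + k}. X i v = u i}"
  defines "R \<equiv> \<lambda>v. restrict (\<lambda>i. X i v) {m..m+k}"
  shows "integrable M (\<lambda>v. F (R v) * of_bool (X (m + k) v = x) * of_bool (X (Suc (m + k)) v = y))"
    "(\<integral>v. F (R v) * of_bool (X (m + k) v = x) * of_bool (X (Suc (m + k)) v = y) \<partial>M) =
       p (m + k) x y * (\<integral>v. F (R v) * of_bool (X (m + k) v = x) \<partial>M)"
proof -
  define PE where "PE = PiE {m..m+k} (\<lambda>_. UNIV :: 'h set)"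
  have fin: "finite PE" unfolding PE_def by (intro finite_PiE) auto
  define A where "A u = {v\<in>space M. \<forall>i\<in>{m..m + k}. X i v = u i}" for u
  define B where "B u = {v\<in>space M. \<forall>i\<in>{m..Suc (m + k)}. X i v = (u(Suc (m + k) := y)) i}" for u
  have [measurable]: "A u \<in> sets M" "B u \<in> sets M" for u
    unfolding A_def B_def by (rule path_event_sets[OF assms(1)], simp)+
  have only: "(\<Sum>u\<in>PE. f u * indicator (A u) v) = f (R v)"
    if "v \<in> space M" for f :: "(nat \<Rightarrow> 'h) \<Rightarrow> real" and v
  proof -
    have in_PE: "R v \<in> PE" by (auto simp: R_def PE_def)
    have uniq: "u = R v" if "u \<in> PE" "v \<in> A u" for u
      using that by (intro PiE_ext[of u "{m..m+k}" _ "R v"]) (auto simp: PE_def A_def R_def)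
    have in_A: "v \<in> A (R v)" using that by (auto simp: A_def R_def)
    have "(\<Sum>u\<in>PE. f u * indicator (A u) v) = (\<Sum>u\<in>{R v}. f u * indicator (A u) v)"
    proof (rule sum.mono_neutral_right[OF fin], use in_PE in simp, rule ballI)
      fix u assume "u \<in> PE - {R v}"
      then have "v \<notin> A u" using uniq by blast
      then show "f u * indicator (A u) v = 0" by simp
    qed
    then show ?thesis using in_A by simp
  qed
  have RX: "R v (m + k) = X (m + k) v" for v by (simp add: R_def)
  have e1: "F (R v) * of_bool (X (m + k) v = x) = (\<Sum>u\<in>PE. (F u * of_bool (u (m + k) = x)) * indicator (A u) v)"
    if "v \<in> space M" for v
    using only[OF that, of "\<lambda>u. F u * of_bool (u (m + k) = x)"] by (simp add: RX)
  have AB: "indicator (A u) v * of_bool (X (Suc (m + k)) v = y) = (indicator (B u) v :: real)" for u v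
    by (auto simp: A_def B_def split: split_indicator)
  have e2: "F (R v) * of_bool (X (m + k) v = x) * of_bool (X (Suc (m + k)) v = y) =
      (\<Sum>u\<in>PE. (F u * of_bool (u (m + k) = x)) * indicator (B u) v)"
    if "v \<in> space M" for v
    by (simp only: e1[OF that] sum_distrib_right mult.assoc AB)
  have i1: "(\<integral>v. F (R v) * of_bool (X (m + k) v = x) \<partial>M) = (\<Sum>u\<in>PE. (F u * of_bool (u (m + k) = x)) * prob (A u))"
  proof -
    have "(\<integral>v. F (R v) * of_bool (X (m + k) v = x) \<partial>M) =
      (\<integral>v. (\<Sum>u\<in>PE. (F u * of_bool (u (m + k) = x)) * indicator (A u) v) \<partial>M)"
      by (intro Bochner_Integration.integral_cong e1) auto
    also have "\<dots> = (\<Sum>u\<in>PE. \<integral>v. (F u * of_bool (u (m + k) = x)) * indicator (A u) v \<partial>M)"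
      by (intro Bochner_Integration.integral_sum integrable_mult_right) (auto simp: emeasure_eq_measure)
    finally show ?thesis by simp
  qed
  have i2: "(\<integral>v. F (R v) * of_bool (X (m + k) v = x) * of_bool (X (Suc (m + k)) v = y) \<partial>M) =
     (\<Sum>u\<in>PE. (F u * of_bool (u (m + k) = x)) * prob (B u))"
  proof -
    have "(\<integral>v. F (R v) * of_bool (X (m + k) v = x) * of_bool (X (Suc (m + k)) v = y) \<partial>M) =
      (\<integral>v. (\<Sum>u\<in>PE. (F u * of_bool (u (m + k) = x)) * indicator (B u) v) \<partial>M)"
      by (intro Bochner_Integration.integral_cong e2) auto
    also have "\<dots> = (\<Sum>u\<in>PE. \<integral>v. (F u * of_bool (u (m + k) = x)) * indicator (B u) v \<partial>M)"
      by (intro Bochner_Integration.integral_sum integrable_mult_right) (auto simp: emeasure_eq_measure)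
    finally show ?thesis by simp
  qed
  have "prob (B u) = p (m + k) (u (m + k)) y * prob (A u)" for u
  proof -
    have "{v\<in>space M. \<forall>i\<in>{m..m + k}. X i v = (u(Suc (m + k) := y)) i} = A u"
      by (auto simp: A_def)
    then show ?thesis using markov[of m k "u(Suc (m + k) := y)"] by (simp add: B_def)
  qed
  then have "(\<Sum>u\<in>PE. (F u * of_bool (u (m + k) = x)) * prob (B u)) =
     p (m + k) x y * (\<Sum>u\<in>PE. (F u * of_bool (u (m + k) = x)) * prob (A u))"
    unfolding sum_distrib_left by (intro sum.cong) auto
  then show "(\<integral>v. F (R v) * of_bool (X (m + k) v = x) * of_bool (X (Suc (m + k)) v = y) \<partial>M) =
       p (m + k) x y * (\<integral>v. F (R v) * of_bool (X (m + k) v = x) \<partial>M)"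
    unfolding i1 i2 .
  have "integrable M (\<lambda>v. \<Sum>u\<in>PE. (F u * of_bool (u (m + k) = x)) * indicator (B u) v)"
    by (intro Bochner_Integration.integrable_sum integrable_mult_right) (auto simp: emeasure_eq_measure)
  then show "integrable M (\<lambda>v. F (R v) * of_bool (X (m + k) v = x) * of_bool (X (Suc (m + k)) v = y))"
    by (subst Bochner_Integration.integrable_cong[OF refl e2]) auto
qed

text \<open>
The weights multiply along the path, so conditioning on the last but one state reproduces the recursion that
defines \<open>trans_weight\<close>.
\<close>

lemma markov_path_expectation:
  fixes X :: "nat \<Rightarrow> 'a \<Rightarrow> 'h::finite" and w :: "nat \<Rightarrow> 'h \<Rightarrow> real"
  assumes [measurable]: "\<And>i. X i \<in> measurable M (count_space UNIV)"
    and markov: "\<And>m k u. prob {v\<in>space M. \<forall>i\<in>{m..Suc (m + k)}. X i v = u i} =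
       p (m + k) (u (m + k)) (u (Suc (m + k))) * prob {v\<in>space M. \<forall>i\<in>{m..m + k}. X i v = u i}"
  shows "(\<integral>v. (\<Prod>s\<in>{m<..m+k}. w s (X s v)) * of_bool (X m v = x) * of_bool (X (m + k) v = y) \<partial>M) =
     prob {v\<in>space M. X m v = x} * trans_weight p w m k x y"
proof (induction k arbitrary: y)
  case 0
  have "(\<integral>v. of_bool (X m v = x) * of_bool (X m v = y) \<partial>M) =
      (\<integral>v. (of_bool (x = y) :: real) * indicator {v\<in>space M. X m v = x} v \<partial>M)"
    by (intro Bochner_Integration.integral_cong) (auto split: split_indicator)
  then show ?case by simp
next
  case (Suc k)
  define F where "F u = (\<Prod>s\<in>{m<..m+k}. w s (u s)) * of_bool (u m = x)" for u
  define R where "R v = restrict (\<lambda>i. X i v) {m..m+k}" for v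
  note step = markov_path_step[where X = X and p = p and m = m and k = k and F = F, OF assms, folded R_def]
  have FR: "F (R v) = (\<Prod>s\<in>{m<..m+k}. w s (X s v)) * of_bool (X m v = x)" for v
    unfolding F_def R_def by (auto intro!: prod.cong)
  have ins: "{m<..m + Suc k} = insert (Suc (m + k)) {m<..m+k}" by auto
  have one: "(\<Sum>z\<in>UNIV. of_bool (X (m + k) v = z)) = (1 :: real)" for v
  proof -
    have "(\<Sum>z\<in>UNIV. of_bool (X (m + k) v = z)) = (\<Sum>z\<in>{X (m + k) v}. of_bool (X (m + k) v = z) :: real)"
      by (rule sum.mono_neutral_right) auto
    then show ?thesis by simp
  qed
  have "(\<Prod>s\<in>{m<..m+Suc k}. w s (X s v)) * of_bool (X m v = x) * of_bool (X (m + Suc k) v = y) =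
     (\<Sum>z\<in>UNIV. F (R v) * of_bool (X (m + k) v = z) * of_bool (X (Suc (m + k)) v = y)) * w (Suc (m + k)) y" for v
  proof -
    have "(\<Sum>z\<in>UNIV. F (R v) * of_bool (X (m + k) v = z) * of_bool (X (Suc (m + k)) v = y)) =
       F (R v) * of_bool (X (Suc (m + k)) v = y) * (\<Sum>z\<in>UNIV. of_bool (X (m + k) v = z))"
      by (simp only: sum_distrib_left mult_ac)
    then show ?thesis unfolding one ins FR by (simp add: mult_ac)
  qed
  then have "(\<integral>v. (\<Prod>s\<in>{m<..m+Suc k}. w s (X s v)) * of_bool (X m v = x) * of_bool (X (m + Suc k) v = y) \<partial>M) =
     (\<integral>v. (\<Sum>z\<in>UNIV. F (R v) * of_bool (X (m + k) v = z) * of_bool (X (Suc (m + k)) v = y)) * w (Suc (m + k)) y \<partial>M)"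
    by simp
  also have "\<dots> = (\<Sum>z\<in>UNIV. \<integral>v. F (R v) * of_bool (X (m + k) v = z) * of_bool (X (Suc (m + k)) v = y) \<partial>M) * w (Suc (m + k)) y"
    using step(1) by (subst integral_mult_left_zero, subst Bochner_Integration.integral_sum) auto
  also have "\<dots> = (\<Sum>z\<in>UNIV. p (m + k) z y * (\<integral>v. F (R v) * of_bool (X (m + k) v = z) \<partial>M)) * w (Suc (m + k)) y"
    by (simp only: step(2))
  also have "\<dots> = (\<Sum>z\<in>UNIV. p (m + k) z y * (prob {v\<in>space M. X m v = x} * trans_weight p w m k x z)) * w (Suc (m + k)) y"
    unfolding FR Suc.IH ..
  also have "\<dots> = prob {v\<in>space M. X m v = x} * trans_weight p w m (Suc k) x y"
    by (simp add: sum_distrib_left mult_ac)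
  finally show ?case .
qed

lemma markov_cond_expect:
  fixes X :: "nat \<Rightarrow> 'a \<Rightarrow> 'h::finite" and w :: "nat \<Rightarrow> 'h \<Rightarrow> real"
  assumes [measurable]: "\<And>i. X i \<in> measurable M (count_space UNIV)"
    and markov: "\<And>m k u. prob {v\<in>space M. \<forall>i\<in>{m..Suc (m + k)}. X i v = u i} =
       p (m + k) (u (m + k)) (u (Suc (m + k))) * prob {v\<in>space M. \<forall>i\<in>{m..m + k}. X i v = u i}"
    and pos: "prob {v\<in>space M. X 0 v = a} > 0"
  shows "cond_expect M (\<lambda>v. \<Prod>s=1..n. w s (X s v)) (\<lambda>v. X 0 v = a) = (\<Sum>y\<in>UNIV. trans_weight p w 0 n a y)"
proof -
  let ?f = "\<lambda>y v. (\<Prod>s\<in>{0<..0+n}. w s (X s v)) * of_bool (X 0 v = a) * of_bool (X (0 + n) v = y)"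
  have Rm: "(\<lambda>v. \<Prod>s\<in>{0<..0+n}. w s (X s v)) \<in> borel_measurable M" by measurable
  obtain C where C: "\<And>s b. s \<in> {0<..n} \<Longrightarrow> \<bar>w s b\<bar> \<le> C" 
  proof
    show "s \<in> {0<..n} \<Longrightarrow> \<bar>w s b\<bar> \<le> Max ((\<lambda>(s, b). \<bar>w s b\<bar>) ` ({0<..n} \<times> UNIV))" for s b
      by (intro Max_ge) auto
  qed
  have int: "integrable M (?f y)" for y
  proof (rule integrable_const_bound[where B = "\<bar>C\<bar> ^ n"])
    show "AE v in M. norm (?f y v) \<le> \<bar>C\<bar> ^ n"
    proof (rule AE_I2)
      fix v
      have "(\<Prod>s\<in>{0<..n}. \<bar>w s (X s v)\<bar>) \<le> (\<Prod>s\<in>{0<..n}. \<bar>C\<bar>)"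
        by (intro prod_mono conjI abs_ge_zero order_trans[OF C abs_ge_self])
      then show "norm (?f y v) \<le> \<bar>C\<bar> ^ n" by (auto simp: abs_prod)
    qed
  qed measurable
  have one: "(\<Sum>z\<in>UNIV. of_bool (X n v = z)) = (1 :: real)" for v
  proof -
    have "(\<Sum>z\<in>UNIV. of_bool (X n v = z)) = (\<Sum>z\<in>{X n v}. of_bool (X n v = z) :: real)"
      by (rule sum.mono_neutral_right) auto
    then show ?thesis by simp
  qed
  have i: "{1..n} = {0<..n}" by auto
  have "(\<integral>v. (\<Prod>s=1..n. w s (X s v)) * indicator {v\<in>space M. X 0 v = a} v \<partial>M) = (\<integral>v. (\<Sum>y\<in>UNIV. ?f y v) \<partial>M)"
  proof (intro Bochner_Integration.integral_cong refl)
    fix v assume "v \<in> space M"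
    then show "(\<Prod>s=1..n. w s (X s v)) * indicator {v\<in>space M. X 0 v = a} v = (\<Sum>y\<in>UNIV. ?f y v)"
      unfolding sum_distrib_left[symmetric] i using one by (auto split: split_indicator)
  qed
  also have "\<dots> = (\<Sum>y\<in>UNIV. \<integral>v. ?f y v \<partial>M)" by (rule Bochner_Integration.integral_sum) (rule int)
  also have "\<dots> = prob {v\<in>space M. X 0 v = a} * (\<Sum>y\<in>UNIV. trans_weight p w 0 n a y)"
    by (simp only: markov_path_expectation[of X p, OF assms(1,2)] sum_distrib_left)
  finally show ?thesis using pos by (simp add: cond_expect_def)
qed

end

section \<open>Mixing Markov chains on the integers, run in either direction\<close>

locale mixing_markov = prob_space P for P :: "'w measure" +
  fixes \<eta> :: "int \<Rightarrow> 'w \<Rightarrow> 'h::finite" and \<kappa> :: nat and \<delta> :: real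
  assumes markov: "markov_chain P \<eta>"
    and kappa: "1 \<le> \<kappa>" and delta: "0 < \<delta>"
    and mixing: "\<And>a b s t. int \<kappa> \<le> \<bar>s - t\<bar> \<Longrightarrow> \<delta> \<le> \<P>(\<omega> in P. \<eta> t \<omega> = b \<bar> \<eta> s \<omega> = a)"
begin

lemma measurable_eta[measurable]: "\<eta> t \<in> measurable P (count_space UNIV)"
  using markov by (auto simp: markov_chain_def)

text \<open>
A conditional probability given a null event is zero by convention, which the mixing bound excludes.
\<close>

lemma marginal_pos: "0 < prob {\<omega>\<in>space P. \<eta> t \<omega> = a}"
proof (rule ccontr)
  assume "\<not> ?thesis"
  then have "prob {\<omega>\<in>space P. \<eta> t \<omega> = a} = 0" by (simp add: not_less measure_le_0_iff)
  then show False using mixing[of t "t + int \<kappa>" a a] delta by (simp add: cond_prob_def)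
qed

lemma cond_prob_mult_marginal:
  "\<P>(\<omega> in P. \<eta> t \<omega> = b \<bar> \<eta> s \<omega> = a) * prob {\<omega>\<in>space P. \<eta> s \<omega> = a} = prob {\<omega>\<in>space P. \<eta> t \<omega> = b \<and> \<eta> s \<omega> = a}"
  using marginal_pos[of s a] by (simp add: cond_prob_def)

lemma forward_step:
  assumes "s \<le> t"
  shows "prob {\<omega>\<in>space P. \<forall>i\<in>{s..t + 1}. \<eta> i \<omega> = x i} =
     \<P>(\<omega> in P. \<eta> (t + 1) \<omega> = x (t + 1) \<bar> \<eta> t \<omega> = x t) * prob {\<omega>\<in>space P. \<forall>i\<in>{s..t}. \<eta> i \<omega> = x i}"
proof -
  have i: "{s..t + 1} = insert (t + 1) {s..t}" using assms by auto
  have e: "{\<omega>\<in>space P. \<forall>i\<in>{s..t + 1}. \<eta> i \<omega> = x i} =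
     {\<omega>\<in>space P. \<eta> (t + 1) \<omega> = x (t + 1) \<and> (\<forall>i\<in>{s..t}. \<eta> i \<omega> = x i)}" unfolding i by auto
  show ?thesis
  proof (cases "prob {\<omega>\<in>space P. \<forall>i\<in>{s..t}. \<eta> i \<omega> = x i} > 0")
    case True
    then have "\<P>(\<omega> in P. \<eta> (t + 1) \<omega> = x (t + 1) \<bar> \<forall>i\<in>{s..t}. \<eta> i \<omega> = x i) =
        \<P>(\<omega> in P. \<eta> (t + 1) \<omega> = x (t + 1) \<bar> \<eta> t \<omega> = x t)"
      using markov assms unfolding markov_chain_def by blast
    then show ?thesis using True unfolding e by (simp add: cond_prob_def[of P _ "\<lambda>\<omega>. \<forall>i\<in>{s..t}. \<eta> i \<omega> = x i"] field_simps)
  next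
    case False
    then have z: "prob {\<omega>\<in>space P. \<forall>i\<in>{s..t}. \<eta> i \<omega> = x i} = 0" by (simp add: not_less measure_le_0_iff)
    have "prob {\<omega>\<in>space P. \<forall>i\<in>{s..t + 1}. \<eta> i \<omega> = x i} \<le> prob {\<omega>\<in>space P. \<forall>i\<in>{s..t}. \<eta> i \<omega> = x i}"
      by (rule finite_measure_mono) (auto simp: i)
    then show ?thesis using z measure_nonneg[of P "{\<omega>\<in>space P. \<forall>i\<in>{s..t + 1}. \<eta> i \<omega> = x i}"] by simp
  qed
qed

text \<open>
The Markov property is symmetric in time. Growing the interval at its upper end multiplies both sides by
the same forward transition probability, so only an interval consisting of \<open>s\<close> has to be checked.
\<close>

lemma backward_step:
  assumes "s \<le> t"
  shows "prob {\<omega>\<in>space P. \<forall>i\<in>{s - 1..t}. \<eta> i \<omega> = x i} =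
     \<P>(\<omega> in P. \<eta> (s - 1) \<omega> = x (s - 1) \<bar> \<eta> s \<omega> = x s) * prob {\<omega>\<in>space P. \<forall>i\<in>{s..t}. \<eta> i \<omega> = x i}"
  using assms
proof (induction t rule: int_ge_induct)
  case base
  have "{s - 1..s} = {s - 1, s}" by auto
  then show ?case using cond_prob_mult_marginal[of "s - 1" "x (s - 1)" s "x s"] by simp
next
  case (step t)
  show ?case using forward_step[of "s - 1" t x] forward_step[of s t x] step by simp
qed

lemma directed_markov:
  assumes d: "d \<in> {1, - 1 :: int}"
  shows "prob {v\<in>space P. \<forall>i\<in>{m..Suc (m + k)}. \<eta> (d * int i) v = u i} =
    \<P>(\<omega> in P. \<eta> (d * int (Suc (m + k))) \<omega> = u (Suc (m + k)) \<bar> \<eta> (d * int (m + k)) \<omega> = u (m + k)) *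
       prob {v\<in>space P. \<forall>i\<in>{m..m + k}. \<eta> (d * int i) v = u i}"
proof -
  \<comment> \<open>The path \<open>u\<close> transported to the integer times \<open>d * i\<close>.\<close>
  define x where "x j = u (nat (d * j))" for j :: int
  have dd: "d * (d * j) = j" for j using d by auto
  consider "d = 1" | "d = - 1" using d by auto
  then show ?thesis
  proof cases
    case 1
    have *: "(\<forall>i\<in>{m..n}. \<eta> (d * int i) v = u i) \<longleftrightarrow> (\<forall>j\<in>{int m..int n}. \<eta> j v = x j)" for n v
    proof safe
      fix j assume "\<forall>i\<in>{m..n}. \<eta> (d * int i) v = u i" "j \<in> {int m..int n}"
      then show "\<eta> j v = x j" by (auto simp: 1 x_def dest!: bspec[of _ _ "nat j"])
    next
      fix i assume "\<forall>j\<in>{int m..int n}. \<eta> j v = x j" "i \<in> {m..n}"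
      then show "\<eta> (d * int i) v = u i" by (auto simp: 1 x_def dest!: bspec[of _ _ "int i"])
    qed
    have a: "int (Suc (m + k)) = int (m + k) + 1" by simp
    have "x (int (m + k)) = u (m + k)" "x (int (m + k) + 1) = u (Suc (m + k))"
      by (auto simp: x_def 1 nat_add_distrib)
    then show ?thesis
      using forward_step[of "int m" "int (m + k)" x] unfolding * by (simp only: a 1 mult_1)
  next
    case 2
    have *: "(\<forall>i\<in>{m..n}. \<eta> (d * int i) v = u i) \<longleftrightarrow> (\<forall>j\<in>{- int n..- int m}. \<eta> j v = x j)" for n v
    proof safe
      fix j assume "\<forall>i\<in>{m..n}. \<eta> (d * int i) v = u i" "j \<in> {- int n..- int m}"
      then show "\<eta> j v = x j" by (auto simp: 2 x_def dest!: bspec[of _ _ "nat (- j)"])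
    next
      fix i assume "\<forall>j\<in>{- int n..- int m}. \<eta> j v = x j" "i \<in> {m..n}"
      then show "\<eta> (d * int i) v = u i" by (auto simp: 2 x_def dest!: bspec[of _ _ "- int i"])
    qed
    have a: "d * int (Suc (m + k)) = - int (m + k) - 1" "d * int (m + k) = - int (m + k)"
      "- int (Suc (m + k)) = - int (m + k) - 1" by (simp_all add: 2)
    have b: "x (- int (m + k)) = u (m + k)" unfolding x_def 2 mult_minus1 minus_minus nat_int ..
    have "nat (- (- int (m + k) - 1)) = Suc (m + k)" by simp
    then have c: "x (- int (m + k) - 1) = u (Suc (m + k))" unfolding x_def 2 mult_minus1 by (simp only:)
    have "- int (m + k) \<le> - int m" by simp
    from backward_step[OF this, of x]
    show ?thesis unfolding * a b c .
  qed
qed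

definition step_prob :: "int \<Rightarrow> nat \<Rightarrow> 'h \<Rightarrow> 'h \<Rightarrow> real" where
  "step_prob d n x y = \<P>(\<omega> in P. \<eta> (d * int (Suc n)) \<omega> = y \<bar> \<eta> (d * int n) \<omega> = x)"

lemma mixing_chain_step_prob:
  assumes d: "d \<in> {1, - 1 :: int}"
  shows "mixing_chain (step_prob d) \<kappa> \<delta>"
proof
  fix n x y
  show "0 \<le> step_prob d n x y" by (simp add: step_prob_def cond_prob_def)
  have "(\<Sum>y\<in>UNIV. prob {\<omega>\<in>space P. \<eta> (d * int (Suc n)) \<omega> = y \<and> \<eta> (d * int n) \<omega> = x}) =
     prob (\<Union>y\<in>UNIV. {\<omega>\<in>space P. \<eta> (d * int (Suc n)) \<omega> = y \<and> \<eta> (d * int n) \<omega> = x})"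
    by (rule finite_measure_finite_Union[symmetric]) (auto simp: disjoint_family_on_def)
  also have "(\<Union>y\<in>UNIV. {\<omega>\<in>space P. \<eta> (d * int (Suc n)) \<omega> = y \<and> \<eta> (d * int n) \<omega> = x}) = {\<omega>\<in>space P. \<eta> (d * int n) \<omega> = x}"
    by auto
  finally show "(\<Sum>y\<in>UNIV. step_prob d n x y) = 1"
    using marginal_pos[of "d * int n" x] by (simp add: step_prob_def cond_prob_def sum_divide_distrib[symmetric])
next
  fix m x y
  have "prob {v\<in>space P. \<eta> (d * int m) v = x} * trans_weight (step_prob d) (\<lambda>_ _. 1) m \<kappa> x y =
     (\<integral>v. (\<Prod>s\<in>{m<..m+\<kappa>}. 1) * of_bool (\<eta> (d * int m) v = x) * of_bool (\<eta> (d * int (m + \<kappa>)) v = y) \<partial>P)"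
    by (rule markov_path_expectation[symmetric]) (use directed_markov[OF d] in \<open>auto simp: step_prob_def\<close>)
  also have "\<dots> = (\<integral>v. indicator {\<omega>\<in>space P. \<eta> (d * int (m + \<kappa>)) \<omega> = y \<and> \<eta> (d * int m) \<omega> = x} v \<partial>P)"
    by (intro Bochner_Integration.integral_cong) (auto split: split_indicator)
  also have "\<dots> = prob {\<omega>\<in>space P. \<eta> (d * int (m + \<kappa>)) \<omega> = y \<and> \<eta> (d * int m) \<omega> = x}"
    by simp
  also have "\<dots> = prob {v\<in>space P. \<eta> (d * int m) v = x} * \<P>(\<omega> in P. \<eta> (d * int (m + \<kappa>)) \<omega> = y \<bar> \<eta> (d * int m) \<omega> = x)"
    by (simp only: cond_prob_mult_marginal[symmetric] mult.commute)
  finally have "trans_weight (step_prob d) (\<lambda>_ _. 1) m \<kappa> x y = \<P>(\<omega> in P. \<eta> (d * int (m + \<kappa>)) \<omega> = y \<bar> \<eta> (d * int m) \<omega> = x)"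
    using marginal_pos[of "d * int m" x] by simp
  also have "\<dots> \<ge> \<delta>" using d by (intro mixing) auto
  finally show "\<delta> \<le> trans_weight (step_prob d) (\<lambda>_ _. 1) m \<kappa> x y" .
qed (use kappa delta in auto)

text \<open>
Only the joint laws of finitely many coordinates of \<open>\<sigma>\<close> enter, and these are the laws of \<open>\<eta>\<close>.
\<close>

lemma copy_cond_expect:
  fixes Q :: "'v measure" and \<sigma> :: "int \<Rightarrow> 'v \<Rightarrow> 'h"
  assumes Q: "prob_space Q" and [measurable]: "\<And>t. \<sigma> t \<in> measurable Q (count_space UNIV)"
    and copy: "distr Q (Pi\<^sub>M UNIV (\<lambda>_. count_space UNIV)) (\<lambda>v t. \<sigma> t v) =
         distr P (Pi\<^sub>M UNIV (\<lambda>_. count_space UNIV)) (\<lambda>\<omega> t. \<eta> t \<omega>)"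
    and d: "d \<in> {1, - 1 :: int}"
  shows "cond_expect Q (\<lambda>v. \<Prod>s=1..n. w s (\<sigma> (d * int s) v)) (\<lambda>v. \<sigma> 0 v = a) =
    (\<Sum>y\<in>UNIV. trans_weight (step_prob d) w 0 n a y)"
proof -
  interpret Q: prob_space Q by (rule Q)
  have eq: "Q.prob {v\<in>space Q. \<forall>i\<in>I. \<sigma> (j i) v = u i} = prob {v\<in>space P. \<forall>i\<in>I. \<eta> (j i) v = u i}"
    if "finite I" for I :: "nat set" and j u
  proof -
    let ?A = "{f \<in> space (Pi\<^sub>M UNIV (\<lambda>_::int. count_space (UNIV :: 'h set))). \<forall>i\<in>I. f (j i) = u i}"
    have A: "?A \<in> sets (Pi\<^sub>M UNIV (\<lambda>_. count_space UNIV))" using that by measurable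
    have mQ: "(\<lambda>v t. \<sigma> t v) \<in> measurable Q (Pi\<^sub>M UNIV (\<lambda>_. count_space UNIV))"
      by (rule measurable_PiM_single') auto
    have mP: "(\<lambda>v t. \<eta> t v) \<in> measurable P (Pi\<^sub>M UNIV (\<lambda>_. count_space UNIV))"
      by (rule measurable_PiM_single') auto
    have "Q.prob ((\<lambda>v t. \<sigma> t v) -` ?A \<inter> space Q) = prob ((\<lambda>v t. \<eta> t v) -` ?A \<inter> space P)"
      using arg_cong[OF copy, of "\<lambda>D. measure D ?A"] by (simp only: measure_distr[OF mQ A] measure_distr[OF mP A])
    moreover have "(\<lambda>v t. \<sigma> t v) -` ?A \<inter> space Q = {v\<in>space Q. \<forall>i\<in>I. \<sigma> (j i) v = u i}"
      by (auto simp: space_PiM)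
    moreover have "(\<lambda>v t. \<eta> t v) -` ?A \<inter> space P = {v\<in>space P. \<forall>i\<in>I. \<eta> (j i) v = u i}"
      by (auto simp: space_PiM)
    ultimately show ?thesis by simp
  qed
  have "cond_expect Q (\<lambda>v. \<Prod>s=1..n. w s (\<sigma> (d * int s) v)) (\<lambda>v. \<sigma> (d * int 0) v = a) =
    (\<Sum>y\<in>UNIV. trans_weight (step_prob d) w 0 n a y)"
  proof (rule Q.markov_cond_expect)
    show "Q.prob {v\<in>space Q. \<forall>i\<in>{m..Suc (m + k)}. \<sigma> (d * int i) v = u i} =
       step_prob d (m + k) (u (m + k)) (u (Suc (m + k))) *
       Q.prob {v\<in>space Q. \<forall>i\<in>{m..m + k}. \<sigma> (d * int i) v = u i}" for m k u
      by (simp only: eq finite_atLeastAtMost directed_markov[OF d] step_prob_def)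
    show "0 < Q.prob {v\<in>space Q. \<sigma> (d * int 0) v = a}"
      using eq[of "{0}" "\<lambda>_. 0" "\<lambda>_. a"] marginal_pos[of 0 a] by simp
  qed measurable
  then show ?thesis by simp
qed

end

section \<open>Multi-indices and sorted lists\<close>

lemma sorted_concat_replicate:
  "sorted xs \<Longrightarrow> sorted (concat (map (\<lambda>i. replicate (f i) i) xs))"
  by (induction xs) (auto simp: sorted_append sorted_replicate)

lemma sorted_mi_list: "sorted (mi_list \<nu>)"
  unfolding mi_list_def by (rule sorted_concat_replicate) simp

lemma count_list_concat_replicate:
  "distinct xs \<Longrightarrow> count_list (concat (map (\<lambda>i. replicate (f i) i) xs)) j = (if j \<in> set xs then f j else 0)"
proof (induction xs)
  case (Cons x xs)
  have "count_list (replicate n y) j = (if j = y then n else 0)" for n y by (induction n) auto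
  then show ?case using Cons by (auto simp: count_list_append)
qed auto

lemma count_list_mi_list: "count_list (mi_list \<nu>) i = \<nu> i"
  unfolding mi_list_def by (subst count_list_concat_replicate) auto

lemma length_mi_list: "length (mi_list \<nu>) = mi_size \<nu>"
  unfolding mi_list_def mi_size_def
  by (simp add: length_concat comp_def sum_list_distinct_conv_sum_set)

text \<open>
Multi-indices and sorted lists of directions are the same thing.
\<close>

lemma mi_list_count_list:
  assumes "sorted B"
  shows "mi_list (count_list B) = B"
proof -
  have "mset (mi_list (count_list B)) = mset B"
    by (rule multiset_eqI) (simp add: count_mset count_list_mi_list)
  then have "sort B = mi_list (count_list B)"
    by (intro properties_for_sort sorted_mi_list)
  then show ?thesis using assms by (simp add: sorted_sort_id)
qed

lemma mi_size_count_list: "sorted B \<Longrightarrow> mi_size (count_list B) = length B"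
  using length_mi_list[of "count_list B"] mi_list_count_list[of B] by simp

lemma sorted_subseq: "subseq B A \<Longrightarrow> sorted A \<Longrightarrow> sorted B"
  by (auto simp: subseq_conv_nths sorted_nths)

lemma finite_mi: "finite {\<nu> :: 'p::finite \<Rightarrow> nat. mi_size \<nu> \<le> q}"
proof (rule finite_subset)
  show "{\<nu> :: 'p \<Rightarrow> nat. mi_size \<nu> \<le> q} \<subseteq> PiE UNIV (\<lambda>_. {..q})"
  proof clarify
    fix \<nu> :: "'p \<Rightarrow> nat" assume q: "mi_size \<nu> \<le> q"
    have "\<nu> i \<le> q" for i
      using member_le_sum[of i UNIV \<nu>] q by (simp add: mi_size_def)
    then show "\<nu> \<in> PiE UNIV (\<lambda>_. {..q})" by auto
  qed
qed (auto intro: finite_PiE)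

section \<open>Joint smoothness of parametrized functions\<close>

text \<open>
Differentiability is in the second argument, continuity of the derivatives is in both. Continuity in the
second argument makes suprema over balls finite, continuity in the first makes them measurable.
\<close>

definition jointly_smooth :: "'p::finite list \<Rightarrow> ('z::topological_space \<Rightarrow> real ^ 'p \<Rightarrow> real) \<Rightarrow> bool" where
  "jointly_smooth A F \<longleftrightarrow> (\<forall>B. subseq B A \<longrightarrow>
     (\<forall>z. iter_partial_exists B (F z)) \<and> continuous_on UNIV (\<lambda>(z, \<epsilon>). iter_partial B (F z) \<epsilon>))"

lemma jointly_smooth_Nil: "jointly_smooth [] F \<longleftrightarrow> continuous_on UNIV (\<lambda>(z, \<epsilon>). F z \<epsilon>)"
  unfolding jointly_smooth_def by (auto dest: subseq_order.antisym)

lemma jointly_smooth_snoc: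
  "jointly_smooth (A @ [i]) F \<longleftrightarrow>
     jointly_smooth A F \<and> (\<forall>z. has_partial i (F z)) \<and> jointly_smooth A (\<lambda>z. partial_deriv i (F z))"
  unfolding jointly_smooth_def all_subseq_snoc
  by (auto simp: iter_partial_exists_snoc)

lemma jointly_smooth_add:
  assumes "jointly_smooth A F" "jointly_smooth A G"
  shows "jointly_smooth A (\<lambda>z \<epsilon>. F z \<epsilon> + G z \<epsilon>)"
  using assms
proof (induction A arbitrary: F G rule: rev_induct)
  case Nil
  then show ?case unfolding jointly_smooth_Nil by (auto simp: case_prod_unfold intro: continuous_intros)
next
  case (snoc i A)
  then show ?case by (auto simp: jointly_smooth_snoc partial_add)
qed

lemma jointly_smooth_cmult:
  assumes "jointly_smooth A F"
  shows "jointly_smooth A (\<lambda>z \<epsilon>. c * F z \<epsilon>)"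
  using assms
proof (induction A arbitrary: F rule: rev_induct)
  case Nil
  then show ?case unfolding jointly_smooth_Nil by (auto simp: case_prod_unfold intro: continuous_intros)
next
  case (snoc i A)
  then show ?case by (auto simp: jointly_smooth_snoc partial_cmult)
qed

lemma jointly_smooth_mult:
  assumes "jointly_smooth A F" "jointly_smooth A G"
  shows "jointly_smooth A (\<lambda>z \<epsilon>. F z \<epsilon> * G z \<epsilon>)"
  using assms
proof (induction A arbitrary: F G rule: rev_induct)
  case Nil
  then show ?case unfolding jointly_smooth_Nil by (auto simp: case_prod_unfold intro: continuous_intros)
next
  case (snoc i A)
  then show ?case by (auto simp: jointly_smooth_snoc partial_mult intro: jointly_smooth_add)
qed

lemma jointly_smooth_inverse:
  assumes "jointly_smooth A F" "\<And>z \<epsilon>. F z \<epsilon> > 0"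
  shows "jointly_smooth A (\<lambda>z \<epsilon>. inverse (F z \<epsilon>))"
  using assms(1)
proof (induction A rule: rev_induct)
  case Nil
  have "F z \<epsilon> \<noteq> 0" for z \<epsilon> using assms(2)[of z \<epsilon>] by simp
  then show ?case using Nil unfolding jointly_smooth_Nil
    by (auto simp: case_prod_unfold intro!: continuous_on_inverse)
next
  case (snoc i A)
  have "jointly_smooth A (\<lambda>z \<epsilon>. - 1 * (partial_deriv i (F z) \<epsilon> * (inverse (F z \<epsilon>) * inverse (F z \<epsilon>))))"
    using snoc by (intro jointly_smooth_cmult jointly_smooth_mult) (auto simp: jointly_smooth_snoc)
  moreover have p: "has_partial i (F z)" for z using snoc.prems by (simp add: jointly_smooth_snoc)
  ultimately show ?case
    using snoc partial_inverse[OF p assms(2)] by (simp add: jointly_smooth_snoc)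
qed

lemma jointly_smooth_ln:
  assumes "jointly_smooth A F" "\<And>z \<epsilon>. F z \<epsilon> > 0"
  shows "jointly_smooth A (\<lambda>z \<epsilon>. ln (F z \<epsilon>))"
  using assms(1)
proof (induction A rule: rev_induct)
  case Nil
  have "F z \<epsilon> \<noteq> 0" for z \<epsilon> using assms(2)[of z \<epsilon>] by simp
  then show ?case using Nil unfolding jointly_smooth_Nil
    by (auto simp: case_prod_unfold intro!: continuous_on_ln)
next
  case (snoc i A)
  have "jointly_smooth A (\<lambda>z \<epsilon>. partial_deriv i (F z) \<epsilon> * inverse (F z \<epsilon>))"
    using snoc assms(2) by (intro jointly_smooth_mult jointly_smooth_inverse) (auto simp: jointly_smooth_snoc)
  moreover have p: "has_partial i (F z)" for z using snoc.prems by (simp add: jointly_smooth_snoc)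
  ultimately show ?case
    using snoc partial_ln[OF p assms(2)] by (simp add: jointly_smooth_snoc)
qed

lemma continuous_fix_left:
  assumes "continuous_on UNIV (\<lambda>(z, \<epsilon>). F z \<epsilon>)"
  shows "continuous_on S (F z)"
proof -
  have "continuous_on S (\<lambda>\<epsilon>. (z, \<epsilon>))"
    by (intro continuous_on_Pair continuous_on_const continuous_on_id)
  from continuous_on_compose2[OF assms this] show ?thesis by simp
qed

lemma continuous_fix_right:
  assumes "continuous_on UNIV (\<lambda>(z, \<epsilon>). F z \<epsilon>)"
  shows "continuous_on S (\<lambda>z. F z \<epsilon>)"
proof -
  have "continuous_on S (\<lambda>z. (z, \<epsilon>))"
    by (intro continuous_on_Pair continuous_on_const continuous_on_id)
  from continuous_on_compose2[OF assms this] show ?thesis by simp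
qed

section \<open>Likelihoods with jointly continuous derivatives\<close>

locale smooth_likelihood =
  fixes g :: "'z::euclidean_space \<Rightarrow> 'h::finite \<Rightarrow> 'h \<Rightarrow> real ^ 'p::{finite,linorder} \<Rightarrow> real" and q :: nat
  assumes g_pos: "\<And>z a b \<epsilon>. 0 < g z a b \<epsilon>"
    and g_C: "\<And>z a b. C_class q (g z a b)"
    and g_joint: "\<And>a b \<nu>. mi_size \<nu> \<le> q \<Longrightarrow> continuous_on UNIV (\<lambda>(z, \<epsilon>). mderiv \<nu> (g z a b) \<epsilon>)"
    and q_pos: "1 \<le> q"
begin

lemma g_jointly_smooth:
  assumes "sorted L" "length L \<le> q"
  shows "jointly_smooth L (\<lambda>z. g z a b)"
  unfolding jointly_smooth_def
proof (intro allI impI conjI)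
  fix B z assume B: "subseq B L"
  have s: "sorted B" and l: "length B \<le> q"
    using sorted_subseq[OF B assms(1)] B assms(2) not_subseq_length[of L B] not_le by force+
  have size: "mi_size (count_list B) \<le> q" using l mi_size_count_list[OF s] by simp
  show "iter_partial_exists B (g z a b)"
    using g_C[of z a b] size mi_list_count_list[OF s] unfolding C_class_def mderiv_exists_def by metis
  show "continuous_on UNIV (\<lambda>(z, \<epsilon>). iter_partial B (g z a b) \<epsilon>)"
    using g_joint[OF size] by (simp add: mderiv_def mi_list_count_list[OF s])
qed

lemma g_continuous: "continuous_on UNIV (\<lambda>(z, \<epsilon>). g z a b \<epsilon>)"
  using g_jointly_smooth[of "[]"] by (simp add: jointly_smooth_Nil)

lemma ln_g_jointly_smooth:
  assumes "mi_size \<nu> \<le> q"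
  shows "continuous_on UNIV (\<lambda>(z, \<epsilon>). mderiv \<nu> (\<lambda>\<epsilon>. ln (g z a b \<epsilon>)) \<epsilon>)"
    "mderiv_exists \<nu> (\<lambda>\<epsilon>. ln (g z a b \<epsilon>))"
  using jointly_smooth_ln[OF g_jointly_smooth[of "mi_list \<nu>" a b]] assms g_pos
  unfolding jointly_smooth_def mderiv_def mderiv_exists_def by (auto simp: sorted_mi_list length_mi_list)

abbreviation "M \<equiv> log_deriv_bound g q"

text \<open>
The set whose supremum is \<open>M\<close>. It has to be bounded and nonempty for the supremum to mean anything.
\<close>

definition log_derivs :: "'z \<Rightarrow> real \<Rightarrow> real set" where
  "log_derivs z r = {\<bar>mderiv \<nu> (\<lambda>\<epsilon>. ln (g z a b \<epsilon>)) \<epsilon>\<bar> | \<nu> \<epsilon> a b.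
                  1 \<le> mi_size \<nu> \<and> mi_size \<nu> \<le> q \<and> norm \<epsilon> \<le> r}"

lemma M_eq: "M z r = Sup (log_derivs z r)"
  using q_pos by (simp add: log_deriv_bound_def log_derivs_def)

lemma log_derivs_bdd: "bdd_above (log_derivs z r)"
proof -
  define S where "S = {\<nu> :: 'p \<Rightarrow> nat. mi_size \<nu> \<le> q}"
  have "bdd_above ((\<lambda>\<epsilon>. \<bar>mderiv \<nu> (\<lambda>\<epsilon>. ln (g z a b \<epsilon>)) \<epsilon>\<bar>) ` cball 0 r)" if "\<nu> \<in> S" for \<nu> a b
  proof -
    have "continuous_on (cball 0 r) (\<lambda>\<epsilon>. \<bar>mderiv \<nu> (\<lambda>\<epsilon>. ln (g z a b \<epsilon>)) \<epsilon>\<bar>)"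
      using continuous_fix_left[OF ln_g_jointly_smooth(1)[of \<nu> a b]] that
      by (intro continuous_on_rabs) (simp add: S_def)
    then show ?thesis
      by (intro bounded_imp_bdd_above compact_imp_bounded compact_continuous_image) auto
  qed
  then have "bdd_above (\<Union>\<nu>\<in>S. \<Union>a\<in>UNIV. \<Union>b\<in>UNIV. (\<lambda>\<epsilon>. \<bar>mderiv \<nu> (\<lambda>\<epsilon>. ln (g z a b \<epsilon>)) \<epsilon>\<bar>) ` cball 0 r)"
    by (simp add: S_def finite_mi)
  then show ?thesis
    by (rule bdd_above_mono) (fastforce simp: log_derivs_def S_def)
qed

lemma exists_mi_size_1: "\<exists>\<nu> :: 'p \<Rightarrow> nat. mi_size \<nu> = 1"
  using mi_size_count_list[of "[undefined :: 'p]"] by (intro exI[of _ "count_list [undefined :: 'p]"]) auto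

lemma log_derivs_nonempty: "0 \<le> r \<Longrightarrow> log_derivs z r \<noteq> {}"
proof -
  assume r: "0 \<le> r"
  obtain \<nu> :: "'p \<Rightarrow> nat" where "mi_size \<nu> = 1" using exists_mi_size_1 by blast
  then have "\<bar>mderiv \<nu> (\<lambda>\<epsilon>. ln (g z undefined undefined \<epsilon>)) 0\<bar> \<in> log_derivs z r"
    unfolding log_derivs_def using r q_pos by (intro CollectI exI[of _ \<nu>] exI[of _ 0] exI) auto
  then show ?thesis by blast
qed

lemma M_upper:
  assumes "1 \<le> mi_size \<nu>" "mi_size \<nu> \<le> q" "norm \<epsilon> \<le> r"
  shows "\<bar>mderiv \<nu> (\<lambda>\<epsilon>. ln (g z a b \<epsilon>)) \<epsilon>\<bar> \<le> M z r"
  unfolding M_eq using assms by (intro cSup_upper log_derivs_bdd) (auto simp: log_derivs_def)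

text \<open>
A supremum of functions that are continuous in \<open>z\<close> has closed sublevel sets.
\<close>

lemma M_measurable:
  assumes "0 \<le> r"
  shows "(\<lambda>z. M z r) \<in> borel_measurable borel"
proof (rule borel_measurableI_le)
  fix u
  have "{z. M z r \<le> u} = (\<Inter>\<nu>\<in>{\<nu>. 1 \<le> mi_size \<nu> \<and> mi_size \<nu> \<le> q}. \<Inter>\<epsilon>\<in>{\<epsilon>. norm \<epsilon> \<le> r}. \<Inter>a. \<Inter>b.
      {z. \<bar>mderiv \<nu> (\<lambda>\<epsilon>. ln (g z a b \<epsilon>)) \<epsilon>\<bar> \<le> u})"
    unfolding M_eq cSup_le_iff[OF log_derivs_nonempty[OF assms] log_derivs_bdd]
    unfolding log_derivs_def by blast
  moreover have "closed {z. \<bar>mderiv \<nu> (\<lambda>\<epsilon>. ln (g z a b \<epsilon>)) \<epsilon>\<bar> \<le> u}" if "mi_size \<nu> \<le> q" for \<nu> \<epsilon> a b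
    by (intro closed_Collect_le continuous_on_rabs continuous_on_const
        continuous_fix_right[OF ln_g_jointly_smooth(1)[OF that]])
  ultimately have "closed {z. M z r \<le> u}" by (auto intro!: closed_INT)
  then show "{x \<in> space borel. M x r \<le> u} \<in> sets borel" by simp
qed

lemma g_dominated:
  assumes "sorted L" "length L \<le> q"
  shows "dominated (cball 0 r) L ((real (length L) + 1) * max 1 (M z r)) (g z a b) (g z a b)"
proof (rule dominated_of_log_derivs[OF _ _ g_pos])
  fix B i assume B: "subseq (B @ [i]) L"
  have s: "sorted (B @ [i])" and l: "length (B @ [i]) \<le> q"
    using sorted_subseq[OF B assms(1)] B assms(2) not_subseq_length[of L "B @ [i]"] not_le by force+
  define \<nu> where "\<nu> = count_list (B @ [i])"
  have \<nu>: "mi_list \<nu> = B @ [i]" "mi_size \<nu> = length B + 1"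
    using mi_list_count_list[OF s] mi_size_count_list[OF s] by (auto simp: \<nu>_def)
  have "jointly_smooth (B @ [i]) (\<lambda>z. g z a b)" by (rule g_jointly_smooth[OF s l])
  then have p: "has_partial i (g z a b)" by (simp add: jointly_smooth_snoc)
  have ln: "partial_deriv i (\<lambda>\<epsilon>. ln (g z a b \<epsilon>)) = (\<lambda>\<epsilon>. partial_deriv i (g z a b) \<epsilon> / g z a b \<epsilon>)"
    using partial_ln(2)[OF p g_pos] by (simp add: divide_inverse)
  have "mderiv_exists \<nu> (\<lambda>\<epsilon>. ln (g z a b \<epsilon>))" using \<nu> l by (intro ln_g_jointly_smooth) simp
  then have ex: "iter_partial_exists B (\<lambda>\<epsilon>. partial_deriv i (g z a b) \<epsilon> / g z a b \<epsilon>)"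
    unfolding mderiv_exists_def \<nu> iter_partial_exists_snoc ln by simp
  have "\<bar>iter_partial B (\<lambda>\<epsilon>. partial_deriv i (g z a b) \<epsilon> / g z a b \<epsilon>) \<epsilon>\<bar> \<le> max 1 (M z r)"
    if "\<epsilon> \<in> cball 0 r" for \<epsilon>
  proof -
    have "\<bar>mderiv \<nu> (\<lambda>\<epsilon>. ln (g z a b \<epsilon>)) \<epsilon>\<bar> \<le> M z r" using \<nu> l that by (intro M_upper) auto
    then show ?thesis by (simp add: mderiv_def \<nu> ln)
  qed
  then show "has_partial i (g z a b) \<and>
      (iter_partial_exists B (\<lambda>\<epsilon>. partial_deriv i (g z a b) \<epsilon> / g z a b \<epsilon>)) \<and>
      (\<forall>\<epsilon>\<in>cball 0 r. \<bar>iter_partial B (\<lambda>\<epsilon>. partial_deriv i (g z a b) \<epsilon> / g z a b \<epsilon>) \<epsilon>\<bar> \<le> max 1 (M z r))"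
    using p ex by blast
qed auto

lemma g_ratio_bounded:
  "\<exists>\<rho>\<ge>1. \<forall>z a b b'. \<forall>\<epsilon>\<in>cball 0 r. norm z \<le> R \<longrightarrow> g z a b \<epsilon> \<le> \<rho> * g z a b' \<epsilon>"
proof -
  have "\<exists>u. \<forall>z \<epsilon>. norm z \<le> R \<longrightarrow> \<epsilon> \<in> cball 0 r \<longrightarrow> g z a b \<epsilon> / g z a b' \<epsilon> \<le> u" for a b b'
  proof -
    have "g z a b' \<epsilon> \<noteq> 0" for z \<epsilon> using g_pos[of z a b' \<epsilon>] by simp
    then have "continuous_on (cball 0 R \<times> cball 0 r) (\<lambda>(z, \<epsilon>). g z a b \<epsilon> / g z a b' \<epsilon>)"
      using continuous_on_subset[OF g_continuous[of a b]] continuous_on_subset[OF g_continuous[of a b']]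
      by (auto simp: case_prod_unfold intro!: continuous_on_divide)
    then have "bounded ((\<lambda>(z, \<epsilon>). g z a b \<epsilon> / g z a b' \<epsilon>) ` (cball 0 R \<times> cball 0 r))"
      by (intro compact_imp_bounded compact_continuous_image compact_Times compact_cball)
    then obtain u where "\<forall>x\<in>cball 0 R \<times> cball 0 r. \<bar>(\<lambda>(z, \<epsilon>). g z a b \<epsilon> / g z a b' \<epsilon>) x\<bar> \<le> u"
      by (auto simp: bounded_iff)
    then show ?thesis by (intro exI[of _ u]) (auto simp: abs_of_pos[OF g_pos] dest!: bspec)
  qed
  then obtain u where u: "\<And>a b b' z \<epsilon>. norm z \<le> R \<Longrightarrow> \<epsilon> \<in> cball 0 r \<Longrightarrow> g z a b \<epsilon> / g z a b' \<epsilon> \<le> u a b b'"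
    by metis
  define \<rho> where "\<rho> = Max (insert 1 (range (\<lambda>(a, b, b'). u a b b')))"
  have "u a b b' \<le> \<rho>" for a b b'
    unfolding \<rho>_def by (intro Max_ge) (auto intro!: rev_image_eqI[of "(a, b, b')"])
  then have ratio: "g z a b \<epsilon> / g z a b' \<epsilon> \<le> \<rho>" if "norm z \<le> R" "\<epsilon> \<in> cball 0 r" for z a b b' \<epsilon>
    using u[OF that] order_trans by blast
  have "g z a b \<epsilon> \<le> \<rho> * g z a b' \<epsilon>" if "norm z \<le> R" "\<epsilon> \<in> cball 0 r" for z a b b' \<epsilon>
    using ratio[OF that, of a b b'] g_pos[of z a b' \<epsilon>] by (simp add: pos_divide_le_eq)
  moreover have "1 \<le> \<rho>" unfolding \<rho>_def by (intro Max_ge) auto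
  ultimately show ?thesis by blast
qed

end

section \<open>Subexponential growth and Cauchy criteria\<close>

text \<open>
Finitely many exceptional values are absorbed in the constant.
\<close>

lemma subexponentialI_eventually:
  assumes "\<And>\<beta>. 1 < \<beta> \<Longrightarrow> \<forall>\<^sub>F n in sequentially. \<bar>f n\<bar> \<le> \<beta> ^ n"
  shows "subexponential f"
  unfolding subexponential_def
proof (intro allI impI)
  fix \<beta> :: real assume \<beta>: "1 < \<beta>"
  then obtain N where N: "\<And>n. N \<le> n \<Longrightarrow> \<bar>f n\<bar> \<le> \<beta> ^ n"
    using assms unfolding eventually_sequentially by blast
  define C where "C = 1 + (\<Sum>n<N. \<bar>f n\<bar>)"
  have C: "1 \<le> C" unfolding C_def by (simp add: sum_nonneg)
  have "\<bar>f n\<bar> \<le> C * \<beta> ^ n" for n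
  proof (cases "N \<le> n")
    case True
    have "\<beta> ^ n \<le> C * \<beta> ^ n" using C \<beta> by simp
    then show ?thesis using N[OF True] by simp
  next
    case False
    then have "\<bar>f n\<bar> \<le> (\<Sum>n<N. \<bar>f n\<bar>)" by (intro member_le_sum) auto
    also have "\<dots> \<le> C * 1" by (simp add: C_def)
    also have "\<dots> \<le> C * \<beta> ^ n" using C \<beta> by (intro mult_left_mono) auto
    finally show ?thesis .
  qed
  then show "\<exists>C. \<forall>n. \<bar>f n\<bar> \<le> C * \<beta> ^ n" by blast
qed

lemma subexponential_sum:
  assumes "subexponential f"
  shows "subexponential (\<lambda>n. \<Sum>s\<in>{0<..n}. f s)"
  unfolding subexponential_def
proof (intro allI impI)
  fix \<beta> :: real assume \<beta>: "1 < \<beta>"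
  then obtain C where C: "\<And>n. \<bar>f n\<bar> \<le> C * \<beta> ^ n"
    using assms unfolding subexponential_def by meson
  have C0: "0 \<le> C" using C[of 0] by simp
  have "\<bar>\<Sum>s\<in>{0<..n}. f s\<bar> \<le> (C * (\<beta> / (\<beta> - 1))) * \<beta> ^ n" for n
  proof (induction n)
    case 0
    then show ?case using \<beta> C0 by simp
  next
    case (Suc n)
    have "{0<..Suc n} = insert (Suc n) {0<..n}" by auto
    then have "\<bar>\<Sum>s\<in>{0<..Suc n}. f s\<bar> \<le> \<bar>f (Suc n)\<bar> + \<bar>\<Sum>s\<in>{0<..n}. f s\<bar>" by simp
    also have "\<dots> \<le> C * \<beta> ^ Suc n + (C * (\<beta> / (\<beta> - 1))) * \<beta> ^ n"
      by (intro add_mono C Suc)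
    also have "\<dots> = (C * (\<beta> / (\<beta> - 1))) * \<beta> ^ Suc n"
      using \<beta> by (simp add: field_simps)
    finally show ?case .
  qed
  then show "\<exists>C. \<forall>n. \<bar>\<Sum>s\<in>{0<..n}. f s\<bar> \<le> C * \<beta> ^ n" by blast
qed

lemma geometric_increments_lim:
  fixes X :: "nat \<Rightarrow> real"
  assumes "\<And>n. N \<le> n \<Longrightarrow> \<bar>X (Suc n) - X n\<bar> \<le> C * y ^ n" "0 < y" "y < 1" "N \<le> n"
  shows "\<bar>X n - lim X\<bar> \<le> C / (1 - y) * y ^ n"
proof -
  have "0 < y ^ N" using assms(2) by simp
  then have C: "0 \<le> C" using order_trans[OF abs_ge_zero assms(1)[of N]] by (simp add: zero_le_mult_iff)
  have bound: "\<bar>X (n + k) - X n\<bar> \<le> C / (1 - y) * y ^ n" if "N \<le> n" for n k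
  proof -
    have "\<bar>X (n + k) - X n\<bar> \<le> C / (1 - y) * (y ^ n - y ^ (n + k))"
    proof (induction k)
      case (Suc k)
      have "\<bar>X (n + Suc k) - X n\<bar> \<le> \<bar>X (Suc (n + k)) - X (n + k)\<bar> + \<bar>X (n + k) - X n\<bar>" by simp
      also have "\<dots> \<le> C * y ^ (n + k) + C / (1 - y) * (y ^ n - y ^ (n + k))"
        using that by (intro add_mono assms(1) Suc) auto
      also have "\<dots> = C / (1 - y) * (y ^ n - y ^ (n + Suc k))"
        using assms(3) by (simp add: field_simps)
      finally show ?case .
    qed auto
    also have "\<dots> \<le> C / (1 - y) * y ^ n" using C assms by (intro mult_left_mono) auto
    finally show ?thesis .
  qed
  have conv: "convergent X"
  proof (rule Cauchy_convergent, rule metric_CauchyI)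
    fix e :: real assume e: "0 < e"
    have "(\<lambda>n. C / (1 - y) * y ^ n) \<longlonglongrightarrow> C / (1 - y) * 0"
      using assms by (intro tendsto_mult tendsto_const LIMSEQ_power_zero) auto
    then have "\<forall>\<^sub>F n in sequentially. C / (1 - y) * y ^ n < e / 2"
      using e by (intro order_tendstoD(2)) auto
    then obtain n0 where n0: "N \<le> n0" "C / (1 - y) * y ^ n0 < e / 2"
      unfolding eventually_sequentially by (metis nle_le)
    have "dist (X m) (X n) < e" if "n0 \<le> m" "n0 \<le> n" for m n
    proof -
      have "\<bar>X k - X n0\<bar> < e / 2" if "n0 \<le> k" for k
        using le_less_trans[OF bound[OF n0(1), of "k - n0"] n0(2)] that by simp
      from this[OF that(1)] this[OF that(2)] show ?thesis unfolding dist_real_def by linarith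
    qed
    then show "\<exists>M. \<forall>m\<ge>M. \<forall>n\<ge>M. dist (X m) (X n) < e" by blast
  qed
  have "(\<lambda>k. \<bar>X (n + k) - X n\<bar>) \<longlonglongrightarrow> \<bar>lim X - X n\<bar>"
    using LIMSEQ_ignore_initial_segment[OF convergent_LIMSEQ_iff[THEN iffD1, OF conv], of n]
    by (intro tendsto_intros) (simp add: add.commute)
  then have "\<bar>lim X - X n\<bar> \<le> C / (1 - y) * y ^ n"
    by (rule LIMSEQ_le_const2) (use bound[OF assms(4)] in auto)
  then show ?thesis by (simp add: abs_minus_commute)
qed

section \<open>Almost sure behaviour of an i.i.d. sequence\<close>

lemma subexponential_max_1:
  assumes "\<And>\<beta>. 1 < \<beta> \<Longrightarrow> \<forall>\<^sub>F s in sequentially. m s < \<beta> ^ s"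
  shows "subexponential (\<lambda>s. max 1 (m s))"
proof (rule subexponentialI_eventually)
  fix \<beta> :: real assume \<beta>: "1 < \<beta>"
  show "\<forall>\<^sub>F n in sequentially. \<bar>max 1 (m n)\<bar> \<le> \<beta> ^ n"
    using assms[OF \<beta>] by eventually_elim (use \<beta> in \<open>auto simp: max_def\<close>)
qed

locale iid_sequence = prob_space P for P :: "'w measure" +
  fixes Z :: "int \<Rightarrow> 'w \<Rightarrow> 'z::euclidean_space"
  assumes Z_indep: "indep_vars (\<lambda>_. borel) Z UNIV"
    and Z_ident: "\<And>t. distr P borel (Z t) = distr P borel (Z 0)"
begin

lemma Z_measurable[measurable]: "Z t \<in> borel_measurable P"
  using Z_indep by (auto simp: indep_vars_def)

lemma prob_Z:
  assumes A: "A \<in> sets borel"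
  shows "prob {\<omega>\<in>space P. Z t \<omega> \<in> A} = prob {\<omega>\<in>space P. Z 0 \<omega> \<in> A}"
proof -
  have "prob {\<omega>\<in>space P. Z t \<omega> \<in> A} = measure (distr P borel (Z t)) A" for t
    using A by (subst measure_distr) (auto intro!: arg_cong[where f = "measure P"])
  then show ?thesis using Z_ident by metis
qed

text \<open>
For each \<open>\<beta> > 1\<close> the probability that \<open>m\<close> exceeds \<open>\<beta> ^ s\<close> at time \<open>s\<close> is of order \<open>s powr (- c)\<close>, which is
summable. Borel-Cantelli is applied to a sequence of values of \<open>\<beta>\<close> tending to \<open>1\<close>.
\<close>

lemma AE_subexponential:
  fixes m :: "'z \<Rightarrow> real" and j :: "nat \<Rightarrow> int"
  assumes [measurable]: "m \<in> borel_measurable borel" and c: "1 < c"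
    and tail: "(\<lambda>u. prob {\<omega>\<in>space P. m (Z 0 \<omega>) \<ge> u}) \<in> O[at_top](\<lambda>u. ln u powr (- c))"
  shows "AE \<omega> in P. subexponential (\<lambda>s. max 1 (m (Z (j s) \<omega>)))"
proof -
  obtain C where C: "\<forall>\<^sub>F u in at_top. norm (prob {\<omega>\<in>space P. m (Z 0 \<omega>) \<ge> u}) \<le> C * norm (ln u powr (- c))"
    using tail by (rule landau_o.bigE)
  then obtain u0 where u0: "\<And>u. u0 \<le> u \<Longrightarrow> prob {\<omega>\<in>space P. m (Z 0 \<omega>) \<ge> u} \<le> C * ln u powr (- c)"
    unfolding eventually_at_top_linorder by auto
  have one: "AE \<omega> in P. \<forall>\<^sub>F s in sequentially. m (Z (j s) \<omega>) < \<beta> ^ s" if \<beta>: "1 < \<beta>" for \<beta> :: real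
  proof -
    define A where "A s = {\<omega>\<in>space P. m (Z (j s) \<omega>) \<ge> \<beta> ^ s}" for s
    have A[measurable]: "A s \<in> sets P" for s unfolding A_def by measurable
    obtain s0 where s0: "u0 < \<beta> ^ s0" using real_arch_pow[OF \<beta>] by blast
    have "prob (A s) \<le> C * ln \<beta> powr (- c) * real s powr (- c)" if s: "max 1 s0 \<le> s" for s
    proof -
      have "{z. \<beta> ^ s \<le> m z} \<in> sets borel" by measurable
      from prob_Z[OF this, of "j s"]
      have "prob (A s) = prob {\<omega>\<in>space P. m (Z 0 \<omega>) \<ge> \<beta> ^ s}" by (simp add: A_def)
      also have "\<beta> ^ s0 \<le> \<beta> ^ s" using s \<beta> by (intro power_increasing) auto
      then have "prob {\<omega>\<in>space P. m (Z 0 \<omega>) \<ge> \<beta> ^ s} \<le> C * ln (\<beta> ^ s) powr (- c)"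
        using s0 by (intro u0) simp
      also have "\<dots> = C * ln \<beta> powr (- c) * real s powr (- c)"
        using \<beta> s by (simp add: ln_realpow powr_mult)
      finally show ?thesis .
    qed
    then have "\<forall>\<^sub>F s in sequentially. norm (prob (A s)) \<le> C * ln \<beta> powr (- c) * real s powr (- c)"
      unfolding eventually_sequentially by (auto intro!: exI[of _ "max 1 s0"])
    moreover have "summable (\<lambda>s. C * ln \<beta> powr (- c) * real s powr (- c))"
      using c by (intro summable_mult) (simp add: summable_real_powr_iff)
    ultimately have "summable (\<lambda>s. prob (A s))" by (rule summable_comparison_test_ev)
    then have "AE \<omega> in P. \<forall>\<^sub>F s in sequentially. \<omega> \<in> space P - A s"
      by (intro borel_cantelli_AE1 A) (auto simp: emeasure_eq_measure)
    then show ?thesis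
      by eventually_elim (auto elim!: eventually_mono simp: A_def not_le)
  qed
  have "AE \<omega> in P. \<forall>k::nat. \<forall>\<^sub>F s in sequentially. m (Z (j s) \<omega>) < (1 + 1 / real (Suc k)) ^ s"
    unfolding AE_all_countable by (intro allI one) simp
  then show ?thesis
  proof eventually_elim
    case (elim \<omega>)
    show ?case
    proof (rule subexponential_max_1)
      fix \<beta> :: real assume "1 < \<beta>"
      then obtain k where k: "inverse (real (Suc k)) < \<beta> - 1"
        using reals_Archimedean[of "\<beta> - 1"] by auto
      have "\<forall>\<^sub>F s in sequentially. m (Z (j s) \<omega>) < (1 + 1 / real (Suc k)) ^ s" using elim by blast
      then show "\<forall>\<^sub>F s in sequentially. m (Z (j s) \<omega>) < \<beta> ^ s"
      proof eventually_elim
        case (elim s)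
        have "(1 + 1 / real (Suc k)) ^ s \<le> \<beta> ^ s"
          using k by (intro power_mono) (auto simp: inverse_eq_divide)
        then show ?case using elim by linarith
      qed
    qed
  qed
qed

lemma exists_likely_ball:
  assumes "0 < e"
  shows "\<exists>R. prob {\<omega>\<in>space P. R < norm (Z 0 \<omega>)} \<le> e"
proof -
  define A where "A n = {\<omega>\<in>space P. real n < norm (Z 0 \<omega>)}" for n
  have "(\<lambda>n. prob (A n)) \<longlonglongrightarrow> prob (\<Inter>n. A n)"
    by (rule finite_Lim_measure_decseq) (auto simp: A_def decseq_def)
  moreover have "(\<Inter>n. A n) = {}"
  proof -
    have "\<omega> \<notin> (\<Inter>n. A n)" for \<omega>
      using reals_Archimedean2[of "norm (Z 0 \<omega>)"] by (auto simp: A_def not_less intro: less_imp_le)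
    then show ?thesis by blast
  qed
  ultimately have "(\<lambda>n. prob (A n)) \<longlonglongrightarrow> 0" by simp
  then have "\<forall>\<^sub>F n in sequentially. prob (A n) < e" using assms by (intro order_tendstoD(2))
  then obtain n where "prob (A n) < e" by (auto simp: eventually_sequentially)
  then show ?thesis by (intro exI[of _ "real n"]) (simp add: A_def)
qed

text \<open>
The guaranteed contraction of block number \<open>i\<close> in direction \<open>d\<close>: it is \<open>1 - \<alpha>\<close> if all observations of the
block lie in the ball of radius \<open>R\<close>, and no contraction is claimed otherwise.
\<close>

definition block_factor :: "real \<Rightarrow> real \<Rightarrow> nat \<Rightarrow> int \<Rightarrow> nat \<Rightarrow> 'w \<Rightarrow> real" where
  "block_factor \<alpha> R \<kappa> d i \<omega> =
     (if \<forall>s\<in>{i*\<kappa><..i*\<kappa>+\<kappa>}. norm (Z (d * int s) \<omega>) \<le> R then 1 - \<alpha> else 1)"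

lemma block_factor_measurable[measurable]: "block_factor \<alpha> R \<kappa> d i \<in> borel_measurable P"
proof -
  have "{\<omega>\<in>space P. \<forall>s\<in>{i*\<kappa><..i*\<kappa>+\<kappa>}. norm (Z (d * int s) \<omega>) \<le> R} \<in> sets P"
    by (rule sets.sets_Collect_finite_All) auto
  then show ?thesis unfolding block_factor_def[abs_def] by (intro measurable_If) auto
qed

text \<open>
The union bound over the \<open>\<kappa>\<close> times of a block shows that a block is good with probability at least one half.
\<close>

lemma expectation_block_factor:
  assumes "0 < \<alpha>" "1 \<le> \<kappa>" and R: "prob {\<omega>\<in>space P. R < norm (Z 0 \<omega>)} \<le> 1 / (2 * real \<kappa>)"
  shows "expectation (block_factor \<alpha> R \<kappa> d i) \<le> 1 - \<alpha> / 2"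
proof -
  define B where "B = (\<Union>s\<in>{i*\<kappa><..i*\<kappa>+\<kappa>}. {\<omega>\<in>space P. R < norm (Z (d * int s) \<omega>)})"
  have [measurable]: "B \<in> sets P" unfolding B_def by (intro sets.finite_UN) auto
  have "prob {\<omega>\<in>space P. R < norm (Z t \<omega>)} \<le> 1 / (2 * real \<kappa>)" for t
    using prob_Z[of "{z. R < norm z}" t] R by simp
  then have "prob B \<le> (\<Sum>s\<in>{i*\<kappa><..i*\<kappa>+\<kappa>}. 1 / (2 * real \<kappa>))"
    unfolding B_def by (intro order_trans[OF finite_measure_subadditive_finite] sum_mono) auto
  then have B: "prob B \<le> 1 / 2" using assms(2) by simp
  have "expectation (block_factor \<alpha> R \<kappa> d i) = expectation (\<lambda>\<omega>. (1 - \<alpha>) + \<alpha> * indicator B \<omega>)"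
    by (intro Bochner_Integration.integral_cong refl)
       (auto simp: block_factor_def B_def not_less split: split_indicator)
  also have "\<dots> = (1 - \<alpha>) + \<alpha> * prob B"
    by (subst Bochner_Integration.integral_add) (auto simp: prob_space emeasure_eq_measure)
  also have "\<dots> \<le> 1 - \<alpha> / 2" using mult_left_mono[OF B, of \<alpha>] assms(1) by linarith
  finally show ?thesis .
qed

lemma indep_block_factor:
  assumes d: "d \<in> {1, - 1 :: int}"
  shows "indep_vars (\<lambda>_. borel) (block_factor \<alpha> R \<kappa> d) UNIV"
proof -
  define K where "K i = (\<lambda>s. d * int s) ` {i*\<kappa><..i*\<kappa>+\<kappa>}" for i
  have inj: "d * int s = d * int s' \<longleftrightarrow> s = s'" for s s' using d by auto
  have disj: "disjoint_family_on K UNIV"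
  proof -
    have lt: "K i \<inter> K i' = {}" if ii: "i < i'" for i i'
    proof (rule equals0I)
      fix j assume "j \<in> K i \<inter> K i'"
      then obtain s s' where s: "s \<le> i*\<kappa>+\<kappa>" "i'*\<kappa> < s'" and j: "d * int s = d * int s'"
        unfolding K_def by auto
      have "Suc i * \<kappa> \<le> i' * \<kappa>" using ii by (intro mult_le_mono1) simp
      moreover have "s = s'" using j inj by simp
      ultimately show False using s by simp
    qed
    have "K i \<inter> K i' = {}" if "i \<noteq> i'" for i i'
      using lt[of i i'] lt[of i' i] that by (cases "i < i'") auto
    then show ?thesis unfolding disjoint_family_on_def by blast
  qed
  define Y where "Y i x = (if \<forall>t\<in>K i. norm (x t :: 'z) \<le> R then 1 - \<alpha> else 1)" for i x
  have Y: "Y i \<in> borel_measurable (Pi\<^sub>M (K i) (\<lambda>_. borel))" for i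
  proof -
    have "{x\<in>space (Pi\<^sub>M (K i) (\<lambda>_. borel)). \<forall>t\<in>K i. norm (x t :: 'z) \<le> R} \<in> sets (Pi\<^sub>M (K i) (\<lambda>_. borel))"
    proof (rule sets.sets_Collect_finite_All)
      fix t assume [measurable]: "t \<in> K i"
      show "{x\<in>space (Pi\<^sub>M (K i) (\<lambda>_. borel)). norm (x t :: 'z) \<le> R} \<in> sets (Pi\<^sub>M (K i) (\<lambda>_. borel))"
        by measurable
    qed (simp add: K_def)
    then show ?thesis unfolding Y_def[abs_def] by (intro measurable_If) auto
  qed
  have "indep_vars (\<lambda>_. borel) (\<lambda>i \<omega>. Y i (restrict (\<lambda>t. Z t \<omega>) (K i))) UNIV"
    by (rule indep_vars_compose2[OF indep_vars_restrict[OF Z_indep _ disj] Y]) auto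
  also have "(\<lambda>i \<omega>. Y i (restrict (\<lambda>t. Z t \<omega>) (K i))) = block_factor \<alpha> R \<kappa> d"
    by (auto simp: fun_eq_iff Y_def block_factor_def K_def)
  finally show ?thesis .
qed

text \<open>
By independence the product has expectation at most \<open>(1 - \<alpha> / 2) ^ J\<close>. Markov's inequality compares this with
\<open>(1 - \<alpha> / 4) ^ J\<close>, and the quotient of the two is summable.
\<close>

lemma AE_block_contraction:
  assumes \<alpha>: "0 < \<alpha>" "\<alpha> \<le> 1" and \<kappa>: "1 \<le> \<kappa>" and d: "d \<in> {1, - 1 :: int}"
    and R: "prob {\<omega>\<in>space P. R < norm (Z 0 \<omega>)} \<le> 1 / (2 * real \<kappa>)"
  shows "AE \<omega> in P. \<forall>\<^sub>F J in sequentially. (\<Prod>i\<in>{J..<2*J}. block_factor \<alpha> R \<kappa> d i \<omega>) \<le> (1 - \<alpha> / 4) ^ J"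
proof -
  define t where "t = 1 - \<alpha> / 4"
  have t: "0 < t" "1 - \<alpha> / 2 < t" using \<alpha> by (auto simp: t_def)
  define U where "U J \<omega> = (\<Prod>i\<in>{J..<2*J}. block_factor \<alpha> R \<kappa> d i \<omega>)" for J \<omega>
  define A where "A J = {\<omega>\<in>space P. t ^ J \<le> U J \<omega>}" for J
  have U_meas[measurable]: "U J \<in> borel_measurable P" for J unfolding U_def[abs_def] by measurable
  have A: "A J \<in> sets P" for J unfolding A_def by measurable
  have bf: "0 \<le> block_factor \<alpha> R \<kappa> d i \<omega>" "block_factor \<alpha> R \<kappa> d i \<omega> \<le> 1" for i \<omega>
    using \<alpha> by (auto simp: block_factor_def)
  have int: "integrable P (block_factor \<alpha> R \<kappa> d i)" for i
    by (rule integrable_const_bound[where B = 1]) (use bf in auto)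
  have indep: "indep_vars (\<lambda>_. borel) (block_factor \<alpha> R \<kappa> d) {J..<2*J}" for J
    by (rule indep_vars_subset[OF indep_block_factor[OF d]]) simp
  have "prob (A J) \<le> ((1 - \<alpha> / 2) / t) ^ J" for J
  proof -
    have "prob (A J) \<le> expectation (U J) / t ^ J"
      unfolding A_def
    proof (rule integral_Markov_inequality_measure[where A = "{}"])
      show "integrable P (U J)" unfolding U_def by (rule indep_vars_integrable[OF _ indep int]) simp
    qed (use t bf in \<open>auto simp: U_def intro!: prod_nonneg\<close>)
    also have "expectation (U J) = (\<Prod>i\<in>{J..<2*J}. expectation (block_factor \<alpha> R \<kappa> d i))"
      unfolding U_def by (rule indep_vars_lebesgue_integral[OF _ indep int]) simp
    also have "\<dots> \<le> (\<Prod>i\<in>{J..<2*J}. 1 - \<alpha> / 2)"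
      using bf by (intro prod_mono conjI expectation_block_factor \<alpha> \<kappa> R Bochner_Integration.integral_nonneg) auto
    also have "\<dots> = (1 - \<alpha> / 2) ^ J" by simp
    finally show ?thesis using t by (simp add: power_divide divide_right_mono)
  qed
  then have "summable (\<lambda>J. prob (A J))"
    using \<alpha> t by (intro summable_comparison_test'[OF summable_geometric[of "(1 - \<alpha> / 2) / t"]]) auto
  then have "AE \<omega> in P. \<forall>\<^sub>F J in sequentially. \<omega> \<in> space P - A J"
    by (intro borel_cantelli_AE1 A) (auto simp: emeasure_eq_measure)
  then show ?thesis
    by eventually_elim (auto elim!: eventually_mono simp: A_def U_def t_def not_le intro: less_imp_le)
qed

end

section \<open>Geometric convergence of the derivatives\<close>

locale hidden_markov_model =
  mixing_markov P \<eta> \<kappa> \<delta> + iid_sequence P Z + smooth_likelihood g q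
  for P :: "'w measure" and \<eta> :: "int \<Rightarrow> 'w \<Rightarrow> 'h::finite" and \<kappa> :: nat and \<delta> :: real
    and Z :: "int \<Rightarrow> 'w \<Rightarrow> 'z::euclidean_space"
    and g :: "'z \<Rightarrow> 'h \<Rightarrow> 'h \<Rightarrow> real ^ 'p::{finite,linorder} \<Rightarrow> real" and q :: nat +
  fixes Q :: "'v measure" and \<sigma> :: "int \<Rightarrow> 'v \<Rightarrow> 'h" and \<iota> :: 'h
  assumes tail: "\<And>r. 0 < r \<Longrightarrow> \<exists>c>1.
      (\<lambda>u. prob {\<omega>\<in>space P. M (Z 0 \<omega>) r \<ge> u}) \<in> O[at_top](\<lambda>u. ln u powr (- c))"
    and Q_prob: "prob_space Q" and sigma_measurable: "\<And>t. \<sigma> t \<in> measurable Q (count_space UNIV)"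
    and copy: "distr Q (Pi\<^sub>M UNIV (\<lambda>_. count_space UNIV)) (\<lambda>v t. \<sigma> t v) =
         distr P (Pi\<^sub>M UNIV (\<lambda>_. count_space UNIV)) (\<lambda>\<omega> t. \<eta> t \<omega>)"
begin

abbreviation "\<Lambda> \<omega> d n a \<equiv> Lambda Q \<sigma> g \<iota> (\<lambda>t. \<eta> t \<omega>) (\<lambda>t. Z t \<omega>) d n a"

text \<open>
Both directions of time at once, on the ball of radius \<open>r\<close>.
\<close>

definition converges_at_rate :: "real \<Rightarrow> real \<Rightarrow> ('p \<Rightarrow> nat) \<Rightarrow> 'w \<Rightarrow> bool" where
  "converges_at_rate y r \<nu> \<omega> \<longleftrightarrow> (\<forall>d\<in>{1, - 1}.
     (\<forall>n a. mderiv_exists \<nu> (\<Lambda> \<omega> d n a)) \<and>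
     (\<exists>C N. \<forall>n\<ge>N. \<forall>a. \<forall>\<epsilon>\<in>cball 0 r.
        \<bar>mderiv \<nu> (\<Lambda> \<omega> d n a) \<epsilon> - lim (\<lambda>n. mderiv \<nu> (\<Lambda> \<omega> d n a) \<epsilon>)\<bar> \<le> C * y ^ n))"

text \<open>
The radius \<open>R\<close>, the ratio bound \<open>\<rho>\<close> and hence \<open>t\<close> depend only on \<open>r\<close> and the law of the model, so the rate
is chosen before the realization. Off a null set every realization gives rise to a \<open>dominated_chain\<close> in each
direction.
\<close>

lemma geometric_convergence_on_ball:
  assumes r: "0 < r"
  shows "\<exists>t. 0 < t \<and> t < 1 \<and> (AE \<omega> in P. \<forall>\<nu>. mi_size \<nu> \<le> q \<longrightarrow>
     converges_at_rate (decay_rate \<kappa> t (mi_size \<nu> + 2)) r \<nu> \<omega>)"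
proof -
  obtain R where R: "prob {\<omega>\<in>space P. R < norm (Z 0 \<omega>)} \<le> 1 / (2 * real \<kappa>)"
    using exists_likely_ball[of "1 / (2 * real \<kappa>)"] kappa by auto
  obtain \<rho> where \<rho>: "1 \<le> \<rho>" and ratio: "\<And>z a b b' \<epsilon>. \<epsilon> \<in> cball 0 r \<Longrightarrow> norm z \<le> R \<Longrightarrow> g z a b \<epsilon> \<le> \<rho> * g z a b' \<epsilon>"
    using g_ratio_bounded[of r R] by blast
  define \<alpha> where "\<alpha> = \<delta> / \<rho> ^ \<kappa>"
  interpret chain: mixing_chain "step_prob 1" \<kappa> \<delta> by (rule mixing_chain_step_prob) simp
  have \<alpha>: "0 < \<alpha>" "\<alpha> \<le> 1"
  proof -
    show "0 < \<alpha>" using \<rho> delta by (simp add: \<alpha>_def)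
    have "\<delta> \<le> \<rho> ^ \<kappa>" using chain.delta_le_1 one_le_power[OF \<rho>, of \<kappa>] by linarith
    then show "\<alpha> \<le> 1" using \<rho> by (simp add: \<alpha>_def)
  qed
  define t where "t = 1 - \<alpha> / 4"
  have t: "0 < t" "t < 1" using \<alpha> by (auto simp: t_def)
  obtain c where c: "1 < c" "(\<lambda>u. prob {\<omega>\<in>space P. M (Z 0 \<omega>) r \<ge> u}) \<in> O[at_top](\<lambda>u. ln u powr (- c))"
    using tail[OF r] by blast
  have "AE \<omega> in P. \<forall>d\<in>{1, - 1 :: int}. \<forall>\<^sub>F J in sequentially.
      (\<Prod>i\<in>{J..<2*J}. block_factor \<alpha> R \<kappa> d i \<omega>) \<le> t ^ J"
    unfolding t_def by (rule AE_finite_allI) (auto intro!: AE_block_contraction \<alpha> kappa R)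
  moreover have "AE \<omega> in P. \<forall>d\<in>{1, - 1 :: int}. subexponential (\<lambda>s. max 1 (M (Z (d * int s) \<omega>) r))"
    by (rule AE_finite_allI) (auto intro!: AE_subexponential[OF M_measurable c] simp: r less_imp_le)
  ultimately have "AE \<omega> in P. \<forall>\<nu>. mi_size \<nu> \<le> q \<longrightarrow>
     converges_at_rate (decay_rate \<kappa> t (mi_size \<nu> + 2)) r \<nu> \<omega>"
  proof eventually_elim
    case (elim \<omega>)
    show ?case
      unfolding converges_at_rate_def
    proof (intro allI impI, intro ballI)
      fix \<nu> :: "'p \<Rightarrow> nat" and d :: int assume \<nu>: "mi_size \<nu> \<le> q" and d: "d \<in> {1, - 1}"
      define L where "L = mi_list \<nu>"
      have L: "sorted L" "length L \<le> q" "length L = mi_size \<nu>"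
        using \<nu> by (auto simp: L_def sorted_mi_list length_mi_list)
      define G where "G s b \<epsilon> = g (Z (d * int s) \<omega>) (\<eta> (d * int s) \<omega>) b \<epsilon>" for s b \<epsilon>
      define B where "B s = (real (length L) + 1) * max 1 (M (Z (d * int s) \<omega>) r)" for s
      interpret mixing_chain "step_prob d" \<kappa> \<delta> by (rule mixing_chain_step_prob[OF d])
      interpret dc: dominated_chain "step_prob d" \<kappa> \<delta> G \<iota> "cball 0 r" L B t \<rho> "\<lambda>i. block_factor \<alpha> R \<kappa> d i \<omega>"
      proof
        show "0 < G s b \<epsilon>" for s b \<epsilon> by (simp add: G_def g_pos)
        show "continuous_on (cball 0 r) (G s b)" for s b
          unfolding G_def[abs_def] by (rule continuous_fix_left[OF g_continuous])
        show "0 \<le> B s" for s by (auto simp: B_def intro!: mult_nonneg_nonneg)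
        show "dominated (cball 0 r) L (B s) (G s b) (G s b)" for s b
          unfolding G_def[abs_def] B_def by (rule g_dominated[OF L(1,2)])
        show "subexponential (\<lambda>n. \<Sum>s\<in>{0<..n}. B s)"
          unfolding B_def
          by (intro subexponential_sum subexponential_mult[OF subexponential_const]) (use elim d in blast)
        show "block_factor \<alpha> R \<kappa> d i \<omega> = 1 \<or> block_factor \<alpha> R \<kappa> d i \<omega> = 1 - \<delta> / \<rho> ^ \<kappa> \<and>
           (\<forall>s\<in>{i*\<kappa><..i*\<kappa>+\<kappa>}. \<forall>\<epsilon>\<in>cball 0 r. \<forall>b b'. G s b \<epsilon> \<le> \<rho> * G s b' \<epsilon>)" for i
          unfolding block_factor_def \<alpha>_def G_def using ratio by auto
        show "\<forall>\<^sub>F J in sequentially. (\<Prod>i\<in>{J..<2*J}. block_factor \<alpha> R \<kappa> d i \<omega>) \<le> t ^ J"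
          using elim d by blast
      qed (use t \<rho> in auto)
      have \<Lambda>: "\<Lambda> \<omega> d n a = dc.start_quotient n a" for n a
        by (rule ext) (simp only: Lambda_def dc.start_quotient_def G_def
           copy_cond_expect[OF Q_prob sigma_measurable copy d,
             where w = "\<lambda>s b. g (Z (d * int s) \<omega>) (\<eta> (d * int s) \<omega>) b _"])
      have md: "mderiv \<nu> (\<Lambda> \<omega> d n a) = iter_partial L (dc.start_quotient n a)" for n a
        by (simp add: mderiv_def L_def \<Lambda>)
      define y where "y = decay_rate \<kappa> t (mi_size \<nu> + 2)"
      have y: "0 < y" "y < 1" unfolding y_def using decay_rate_bounds[OF t kappa] by blast+
      obtain C N where C: "\<And>n a \<epsilon>. N \<le> n \<Longrightarrow> \<epsilon> \<in> cball 0 r \<Longrightarrow>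
         \<bar>mderiv \<nu> (\<Lambda> \<omega> d (Suc n) a) \<epsilon> - mderiv \<nu> (\<Lambda> \<omega> d n a) \<epsilon>\<bar> \<le> C * y ^ n"
        using dc.start_quotient_increment unfolding eventually_sequentially md y_def L(3) by blast
      have "\<bar>mderiv \<nu> (\<Lambda> \<omega> d n a) \<epsilon> - lim (\<lambda>n. mderiv \<nu> (\<Lambda> \<omega> d n a) \<epsilon>)\<bar> \<le> C / (1 - y) * y ^ n"
        if "N \<le> n" "\<epsilon> \<in> cball 0 r" for n a \<epsilon>
        by (rule geometric_increments_lim[of N "\<lambda>n. mderiv \<nu> (\<Lambda> \<omega> d n a) \<epsilon>"]) (use C y that in auto)
      moreover have "mderiv_exists \<nu> (\<Lambda> \<omega> d n a)" for n a
        unfolding mderiv_exists_def \<Lambda> L_def[symmetric] by (rule dc.start_quotient_exists)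
      ultimately show "(\<forall>n a. mderiv_exists \<nu> (\<Lambda> \<omega> d n a)) \<and>
         (\<exists>C N. \<forall>n\<ge>N. \<forall>a. \<forall>\<epsilon>\<in>cball 0 r.
        \<bar>mderiv \<nu> (\<Lambda> \<omega> d n a) \<epsilon> - lim (\<lambda>n. mderiv \<nu> (\<Lambda> \<omega> d n a) \<epsilon>)\<bar>
          \<le> C * decay_rate \<kappa> t (mi_size \<nu> + 2) ^ n)"
        unfolding y_def by blast
    qed
  qed
  then show ?thesis using t by blast
qed

lemma geometric_convergence:
  "\<exists>y :: ('p \<Rightarrow> nat) \<Rightarrow> nat \<Rightarrow> real. (\<forall>\<nu> k. 0 < y \<nu> k \<and> y \<nu> k < 1) \<and>
     (AE \<omega> in P. \<forall>k \<nu>. mi_size \<nu> \<le> q \<longrightarrow> converges_at_rate (y \<nu> k) (real (Suc k)) \<nu> \<omega>)"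
proof -
  have "\<forall>k. \<exists>t. 0 < t \<and> t < 1 \<and> (AE \<omega> in P. \<forall>\<nu>. mi_size \<nu> \<le> q \<longrightarrow>
     converges_at_rate (decay_rate \<kappa> t (mi_size \<nu> + 2)) (real (Suc k)) \<nu> \<omega>)"
    by (intro allI geometric_convergence_on_ball) simp
  then obtain t where t: "\<And>k. 0 < t k" "\<And>k. t k < 1"
    and conv: "\<And>k. AE \<omega> in P. \<forall>\<nu>. mi_size \<nu> \<le> q \<longrightarrow>
      converges_at_rate (decay_rate \<kappa> (t k) (mi_size \<nu> + 2)) (real (Suc k)) \<nu> \<omega>"
    unfolding choice_iff by blast
  have "AE \<omega> in P. \<forall>k. \<forall>\<nu>. mi_size \<nu> \<le> q \<longrightarrow>
      converges_at_rate (decay_rate \<kappa> (t k) (mi_size \<nu> + 2)) (real (Suc k)) \<nu> \<omega>"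
    unfolding AE_all_countable[where ?'i = nat] using conv by blast
  then show ?thesis
    using decay_rate_bounds[OF t kappa]
    by (intro exI[of _ "\<lambda>\<nu> k. decay_rate \<kappa> (t k) (mi_size \<nu> + 2)"]) blast
qed

end

section \<open>Uniform convergence and a rate increasing with the radius\<close>

text \<open>
The supremum of a set of reals is controlled only if the set is bounded and nonempty. The geometric bound
provides this for all large \<open>n\<close>, which is all that the Landau symbol looks at.
\<close>

lemma MAX_SUP_smallo:
  fixes F :: "nat \<Rightarrow> 'h::finite \<Rightarrow> 'e \<Rightarrow> real"
  assumes bound: "\<And>n a \<epsilon>. N \<le> n \<Longrightarrow> \<epsilon> \<in> S \<Longrightarrow> \<bar>F n a \<epsilon>\<bar> \<le> C * y ^ n"
    and S: "S \<noteq> {}" and y: "0 < y" "y < r"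
  shows "(\<lambda>n. MAX a. SUP \<epsilon>\<in>S. \<bar>F n a \<epsilon>\<bar>) \<in> o(\<lambda>n. r ^ n)"
proof (rule landau_o.smallI)
  fix c :: real assume c: "0 < c"
  have "(\<lambda>n. C * (y / r) ^ n) \<longlonglongrightarrow> C * 0"
    using y by (intro tendsto_mult tendsto_const LIMSEQ_power_zero) auto
  then have "\<forall>\<^sub>F n in sequentially. C * (y / r) ^ n < c" using c by (intro order_tendstoD(2)) auto
  moreover have "\<forall>\<^sub>F n in sequentially. N \<le> n" by (rule eventually_ge_at_top)
  ultimately show "\<forall>\<^sub>F n in sequentially. norm (MAX a. SUP \<epsilon>\<in>S. \<bar>F n a \<epsilon>\<bar>) \<le> c * norm (r ^ n)"
  proof eventually_elim
    case (elim n)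
    have sup: "0 \<le> (SUP \<epsilon>\<in>S. \<bar>F n a \<epsilon>\<bar>) \<and> (SUP \<epsilon>\<in>S. \<bar>F n a \<epsilon>\<bar>) \<le> C * y ^ n" for a
    proof
      show "(SUP \<epsilon>\<in>S. \<bar>F n a \<epsilon>\<bar>) \<le> C * y ^ n" using S bound[OF elim(2)] by (intro cSUP_least) auto
      obtain \<epsilon> where "\<epsilon> \<in> S" using S by blast
      then show "0 \<le> (SUP \<epsilon>\<in>S. \<bar>F n a \<epsilon>\<bar>)"
        using bound[OF elim(2)] by (intro cSUP_upper2[where x = \<epsilon>] bdd_aboveI2) auto
    qed
    have "(MAX a. SUP \<epsilon>\<in>S. \<bar>F n a \<epsilon>\<bar>) \<in> range (\<lambda>a. SUP \<epsilon>\<in>S. \<bar>F n a \<epsilon>\<bar>)" by (rule Max_in) auto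
    then obtain a where "(MAX a. SUP \<epsilon>\<in>S. \<bar>F n a \<epsilon>\<bar>) = (SUP \<epsilon>\<in>S. \<bar>F n a \<epsilon>\<bar>)" by blast
    then have "norm (MAX a. SUP \<epsilon>\<in>S. \<bar>F n a \<epsilon>\<bar>) \<le> C * y ^ n" using sup[of a] by simp
    also have "\<dots> = C * (y / r) ^ n * r ^ n" using y by (simp add: power_divide)
    also have "\<dots> \<le> c * norm (r ^ n)" using elim(1) y by (auto intro!: mult_right_mono)
    finally show ?case .
  qed
qed

text \<open>
The running maximum of the rates \<open>y\<close>, taken at \<open>\<lceil>x\<rceil>\<close>, is increasing only in the weak sense, and it may equal
\<open>y (nat \<lceil>x\<rceil>)\<close>. Dividing its distance to \<open>1\<close> by \<open>1 + x\<close> makes monotonicity and the comparison strict.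
\<close>

lemma strictly_increasing_rate:
  fixes y :: "nat \<Rightarrow> real"
  assumes "\<And>k. 0 < y k" "\<And>k. y k < 1"
  shows "\<exists>r :: real \<Rightarrow> real. strict_mono_on {0<..} r \<and> (\<forall>x>0. 0 < r x \<and> r x < (1 :: real) \<and> y (nat \<lceil>x\<rceil>) < r x)"
proof -
  define Y where "Y k = Max (y ` {..k})" for k
  have Y: "y k \<le> Y k" "Y k < 1" for k
    using assms by (auto simp: Y_def)
  have Y_mono: "Y k \<le> Y l" if "k \<le> l" for k l
    unfolding Y_def using that by (intro Max_mono) auto
  define r where "r x = 1 - (1 - Y (nat \<lceil>x\<rceil>)) / (1 + x)" for x :: real
  have "r x < r x'" if "0 < x" "x < x'" for x x'
  proof -
    have "Y (nat \<lceil>x\<rceil>) \<le> Y (nat \<lceil>x'\<rceil>)"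
      using that by (intro Y_mono nat_mono ceiling_mono) auto
    then have "(1 - Y (nat \<lceil>x'\<rceil>)) / (1 + x') \<le> (1 - Y (nat \<lceil>x\<rceil>)) / (1 + x')"
      using that by (intro divide_right_mono) auto
    also have "\<dots> < (1 - Y (nat \<lceil>x\<rceil>)) / (1 + x)"
      using that Y(2)[of "nat \<lceil>x\<rceil>"] by (intro divide_strict_left_mono) auto
    finally show ?thesis by (simp add: r_def)
  qed
  then have "strict_mono_on {0<..} r" by (auto simp: strict_mono_on_def)
  moreover have "0 < r x \<and> r x < 1 \<and> y (nat \<lceil>x\<rceil>) < r x" if "0 < x" for x
  proof -
    have "(1 - Y (nat \<lceil>x\<rceil>)) / (1 + x) < (1 - Y (nat \<lceil>x\<rceil>)) / 1"
      using that Y(2)[of "nat \<lceil>x\<rceil>"] by (intro divide_strict_left_mono) auto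
    moreover have "0 < (1 - Y (nat \<lceil>x\<rceil>)) / (1 + x)"
      using that Y(2)[of "nat \<lceil>x\<rceil>"] by simp
    ultimately show ?thesis
      using Y(1)[of "nat \<lceil>x\<rceil>"] assms(1)[of "nat \<lceil>x\<rceil>"] by (simp add: r_def)
  qed
  ultimately show ?thesis by (intro exI[of _ r]) blast
qed

context hidden_markov_model
begin

text \<open>
Every compact set is contained in a ball of integer radius, so countably many balls are enough.
\<close>

lemma AE_uniform_convergence:
  "AE \<omega> in P. \<forall>\<nu> a. mi_size \<nu> \<le> q \<longrightarrow> (\<forall>d\<in>{1, -1}.
     (\<forall>n. mderiv_exists \<nu> (\<Lambda> \<omega> d n a)) \<and>
     (\<forall>K. compact K \<longrightarrow> uniformly_convergent_on K (\<lambda>n. mderiv \<nu> (\<Lambda> \<omega> d n a))))"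
proof -
  obtain y :: "('p \<Rightarrow> nat) \<Rightarrow> nat \<Rightarrow> real" where y: "\<And>\<nu> k. 0 < y \<nu> k \<and> y \<nu> k < 1"
    and conv: "AE \<omega> in P. \<forall>k \<nu>. mi_size \<nu> \<le> q \<longrightarrow> converges_at_rate (y \<nu> k) (real (Suc k)) \<nu> \<omega>"
    using geometric_convergence by blast
  from conv show ?thesis
  proof eventually_elim
    case (elim \<omega>)
    show ?case
    proof (intro allI impI ballI conjI)
      fix \<nu> :: "'p \<Rightarrow> nat" and a d assume \<nu>: "mi_size \<nu> \<le> q" and d: "d \<in> {1, - 1 :: int}"
      have rate: "converges_at_rate (y \<nu> k) (real (Suc k)) \<nu> \<omega>" for k using elim \<nu> by blast
      show "mderiv_exists \<nu> (\<Lambda> \<omega> d n a)" for n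
        using rate d unfolding converges_at_rate_def by blast
      fix K :: "(real ^ 'p::{finite,linorder}) set" assume "compact K"
      then have "bounded K" by (rule compact_imp_bounded)
      then obtain b where b: "\<And>\<epsilon>. \<epsilon> \<in> K \<Longrightarrow> norm \<epsilon> \<le> b"
        unfolding bounded_iff by auto
      obtain k :: nat where "b \<le> real k" using real_arch_simple by blast
      then have K: "K \<subseteq> cball 0 (real (Suc k))" using b by force
      obtain C N where C: "\<And>n \<epsilon>. N \<le> n \<Longrightarrow> \<epsilon> \<in> cball 0 (real (Suc k)) \<Longrightarrow>
         \<bar>mderiv \<nu> (\<Lambda> \<omega> d n a) \<epsilon> - lim (\<lambda>n. mderiv \<nu> (\<Lambda> \<omega> d n a) \<epsilon>)\<bar> \<le> C * y \<nu> k ^ n"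
        using rate[of k] d unfolding converges_at_rate_def by blast
      have "uniform_limit K (\<lambda>n. mderiv \<nu> (\<Lambda> \<omega> d n a)) (\<lambda>\<epsilon>. lim (\<lambda>n. mderiv \<nu> (\<Lambda> \<omega> d n a) \<epsilon>)) sequentially"
      proof (rule uniform_limitI)
        fix e :: real assume e: "0 < e"
        have "(\<lambda>n. C * y \<nu> k ^ n) \<longlonglongrightarrow> C * 0"
          using y[of \<nu> k] by (intro tendsto_mult tendsto_const LIMSEQ_power_zero) auto
        then have "\<forall>\<^sub>F n in sequentially. C * y \<nu> k ^ n < e" using e by (intro order_tendstoD(2)) auto
        moreover have "\<forall>\<^sub>F n in sequentially. N \<le> n" by (rule eventually_ge_at_top)
        ultimately show "\<forall>\<^sub>F n in sequentially. \<forall>\<epsilon>\<in>K.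
            dist (mderiv \<nu> (\<Lambda> \<omega> d n a) \<epsilon>) (lim (\<lambda>n. mderiv \<nu> (\<Lambda> \<omega> d n a) \<epsilon>)) < e"
        proof eventually_elim
          case (elim n)
          then show ?case unfolding dist_real_def using C[OF elim(2)] K by (meson le_less_trans subsetD)
        qed
      qed
      then show "uniformly_convergent_on K (\<lambda>n. mderiv \<nu> (\<Lambda> \<omega> d n a))"
        unfolding uniformly_convergent_on_def by blast
    qed
  qed
qed

lemma geometric_rate:
  assumes \<nu>: "mi_size \<nu> \<le> q"
  shows "\<exists>r :: real \<Rightarrow> real. strict_mono_on {0<..} r \<and> (\<forall>\<epsilon>\<^sub>0>0. 0 < r \<epsilon>\<^sub>0 \<and> r \<epsilon>\<^sub>0 < 1) \<and>
     (AE \<omega> in P. \<forall>\<epsilon>\<^sub>0>0. \<forall>d\<in>{1, -1}.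
       (\<lambda>n. MAX a. SUP \<epsilon>\<in>cball 0 \<epsilon>\<^sub>0.
          \<bar>mderiv \<nu> (\<Lambda> \<omega> d n a) \<epsilon> - lim (\<lambda>n. mderiv \<nu> (\<Lambda> \<omega> d n a) \<epsilon>)\<bar>)
       \<in> o[sequentially](\<lambda>n. r \<epsilon>\<^sub>0 ^ n))"
proof -
  obtain y :: "('p \<Rightarrow> nat) \<Rightarrow> nat \<Rightarrow> real" where y: "\<And>\<nu> k. 0 < y \<nu> k \<and> y \<nu> k < 1"
    and conv: "AE \<omega> in P. \<forall>k \<nu>. mi_size \<nu> \<le> q \<longrightarrow> converges_at_rate (y \<nu> k) (real (Suc k)) \<nu> \<omega>"
    using geometric_convergence by blast
  obtain r :: "real \<Rightarrow> real" where r: "strict_mono_on {0<..} r"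
     "\<And>x. 0 < x \<Longrightarrow> 0 < r x \<and> r x < 1 \<and> y \<nu> (nat \<lceil>x\<rceil>) < r x"
    using strictly_increasing_rate[of "y \<nu>"] y by metis
  from conv have "AE \<omega> in P. \<forall>\<epsilon>\<^sub>0>0. \<forall>d\<in>{1, -1}.
       (\<lambda>n. MAX a. SUP \<epsilon>\<in>cball 0 \<epsilon>\<^sub>0.
          \<bar>mderiv \<nu> (\<Lambda> \<omega> d n a) \<epsilon> - lim (\<lambda>n. mderiv \<nu> (\<Lambda> \<omega> d n a) \<epsilon>)\<bar>)
       \<in> o[sequentially](\<lambda>n. r \<epsilon>\<^sub>0 ^ n)"
  proof eventually_elim
    case (elim \<omega>)
    show ?case
    proof (intro allI impI ballI)
      fix e0 :: real and d :: int assume e0: "0 < e0" and d: "d \<in> {1, - 1}"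
      define k where "k = nat \<lceil>e0\<rceil>"
      have "e0 \<le> real (Suc k)" unfolding k_def by linarith
      then have sub: "cball 0 e0 \<subseteq> cball (0 :: real ^ 'p::{finite,linorder}) (real (Suc k))" by (auto simp: subset_iff)
      have rate: "converges_at_rate (y \<nu> k) (real (Suc k)) \<nu> \<omega>" using elim \<nu> by blast
      obtain C N where C: "\<And>n a \<epsilon>. N \<le> n \<Longrightarrow> \<epsilon> \<in> cball 0 (real (Suc k)) \<Longrightarrow>
          \<bar>mderiv \<nu> (\<Lambda> \<omega> d n a) \<epsilon> - lim (\<lambda>n. mderiv \<nu> (\<Lambda> \<omega> d n a) \<epsilon>)\<bar> \<le> C * y \<nu> k ^ n"
        using rate d unfolding converges_at_rate_def by blast
      show "(\<lambda>n. MAX a. SUP \<epsilon>\<in>cball 0 e0.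
          \<bar>mderiv \<nu> (\<Lambda> \<omega> d n a) \<epsilon> - lim (\<lambda>n. mderiv \<nu> (\<Lambda> \<omega> d n a) \<epsilon>)\<bar>)
        \<in> o[sequentially](\<lambda>n. r e0 ^ n)"
        by (rule MAX_SUP_smallo[where N = N and C = C and y = "y \<nu> k"])
           (use C sub e0 y r(2)[OF e0] in \<open>auto simp: k_def\<close>)
    qed
  qed
  then show ?thesis using r by blast
qed

end

theorem theorem2p3:
  fixes P :: "'w measure"
    and Q :: "'v measure"
    and H0 H1 :: "'h::finite set"
    and \<eta> :: "int \<Rightarrow> 'w \<Rightarrow> 'h"
    and \<sigma> :: "int \<Rightarrow> 'v \<Rightarrow> 'h"
    and Z :: "int \<Rightarrow> 'w \<Rightarrow> 'z::euclidean_space"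
    and \<Theta> :: "(real ^ 'd::finite) set"
    and \<phi> :: "'z \<Rightarrow> real ^ 'd \<Rightarrow> 'x::euclidean_space"
    and \<theta> :: "'h \<Rightarrow> real ^ 'p::{finite,linorder} \<Rightarrow> real ^ 'd"
    and f :: "'x \<Rightarrow> real ^ 'd \<Rightarrow> ennreal"
    and \<iota> :: 'h
    and \<kappa> q :: nat
    and \<phi>\<^sub>0 :: real
  assumes "prob_space P"
    and "H0 \<noteq> {}" "H1 \<noteq> {}" "H0 \<inter> H1 = {}" "H0 \<union> H1 = UNIV"
    and "open \<Theta>" "\<And>a \<epsilon>. \<theta> a \<epsilon> \<in> \<Theta>"
    \<comment> \<open>hypothesis (1)\<close>
    and "indep_rv P
           (Pi\<^sub>M UNIV (\<lambda>_. borel)) (\<lambda>\<omega> t. Z t \<omega>)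
           (Pi\<^sub>M UNIV (\<lambda>_. count_space UNIV)) (\<lambda>\<omega> t. \<eta> t \<omega>)"
    and "prob_space.indep_vars P (\<lambda>_. borel) Z UNIV"
    and "\<And>t. distr P borel (Z t) = distr P borel (Z 0)"
    and "\<And>\<tau> t. \<tau> \<in> \<Theta> \<Longrightarrow> distributed P lborel (\<lambda>\<omega>. \<phi> (Z t \<omega>) \<tau>) (\<lambda>x. f x \<tau>)"
    \<comment> \<open>hypothesis (2)\<close>
    and "markov_chain P \<eta>"
    and "\<kappa> \<ge> 1" "\<phi>\<^sub>0 > 0"
    and "\<And>a b s t. \<bar>s - t\<bar> \<ge> int \<kappa> \<Longrightarrow> \<P>(\<omega> in P. \<eta> t \<omega> = b \<bar> \<eta> s \<omega> = a) \<ge> \<phi>\<^sub>0"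
    \<comment> \<open>hypothesis (3)\<close>
    and "\<And>z a b \<epsilon>. 0 < f (\<phi> z (\<theta> a \<epsilon>)) (\<theta> b \<epsilon>)"
    and "\<And>z a b \<epsilon>. f (\<phi> z (\<theta> a \<epsilon>)) (\<theta> b \<epsilon>) < \<infinity>"
    and "\<And>z a b. continuous_on UNIV (lik f \<phi> \<theta> z a b)"
    \<comment> \<open>hypothesis (4)\<close>
    and "\<And>z a b. C_class q (lik f \<phi> \<theta> z a b)"
    and "\<And>a b \<nu>. mi_size \<nu> \<le> q \<Longrightarrow>
           continuous_on UNIV (\<lambda>(z, \<epsilon>). mderiv \<nu> (lik f \<phi> \<theta> z a b) \<epsilon>)"
    and "\<And>r. r > 0 \<Longrightarrow> \<exists>c>2.
           (\<lambda>u. \<P>(\<omega> in P. log_deriv_bound (lik f \<phi> \<theta>) q (Z 0 \<omega>) r \<ge> u))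
             \<in> O[at_top](\<lambda>u. ln u powr (- c))"
    \<comment> \<open>\<open>\<sigma>\<close> is a copy of \<open>\<eta>\<close>, on its own factor of a product space\<close>
    and "prob_space Q" "\<And>t. \<sigma> t \<in> measurable Q (count_space UNIV)"
    and "distr Q (Pi\<^sub>M UNIV (\<lambda>_. count_space UNIV)) (\<lambda>v t. \<sigma> t v) =
         distr P (Pi\<^sub>M UNIV (\<lambda>_. count_space UNIV)) (\<lambda>\<omega> t. \<eta> t \<omega>)"
  shows "(AE \<omega> in P. \<forall>\<nu> a. \<nu> \<noteq> (\<lambda>_. 0) \<and> mi_size \<nu> \<le> q \<longrightarrow> (\<forall>d\<in>{1, -1}.
            (\<forall>n. mderiv_exists \<nu>
                   (Lambda Q \<sigma> (lik f \<phi> \<theta>) \<iota> (\<lambda>t. \<eta> t \<omega>) (\<lambda>t. Z t \<omega>) d n a)) \<and>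
            (\<forall>K. compact K \<longrightarrow> uniformly_convergent_on K
              (\<lambda>n. mderiv \<nu>
                (Lambda Q \<sigma> (lik f \<phi> \<theta>) \<iota> (\<lambda>t. \<eta> t \<omega>) (\<lambda>t. Z t \<omega>) d n a)))))
       \<and> (\<forall>\<nu>. \<nu> \<noteq> (\<lambda>_. 0) \<and> mi_size \<nu> \<le> q \<longrightarrow>
            (\<exists>r :: real \<Rightarrow> real. strict_mono_on {0<..} r \<and> (\<forall>\<epsilon>\<^sub>0>0. 0 < r \<epsilon>\<^sub>0 \<and> r \<epsilon>\<^sub>0 < 1) \<and>
              (AE \<omega> in P. \<forall>\<epsilon>\<^sub>0>0. \<forall>d\<in>{1, -1}.
                (\<lambda>n. MAX a. SUP \<epsilon>\<in>cball 0 \<epsilon>\<^sub>0.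
                   \<bar>mderiv \<nu> (Lambda Q \<sigma> (lik f \<phi> \<theta>) \<iota> (\<lambda>t. \<eta> t \<omega>) (\<lambda>t. Z t \<omega>) d n a) \<epsilon>
                    - Lambda_lim Q \<sigma> (lik f \<phi> \<theta>) \<iota> (\<lambda>t. \<eta> t \<omega>) (\<lambda>t. Z t \<omega>) d \<nu> a \<epsilon>\<bar>)
                \<in> o[sequentially](\<lambda>n. r \<epsilon>\<^sub>0 ^ n))))"
proof (cases "q = 0")
  case True
  \<comment> \<open>There is no nonzero multi-index of size zero.\<close>
  have False if "\<nu> \<noteq> (\<lambda>_. 0)" "mi_size \<nu> \<le> q" for \<nu> :: "'p \<Rightarrow> nat"
    using that True by (auto simp: mi_size_def)
  then show ?thesis by (intro conjI AE_I2 allI impI) blast+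
next
  case False
  interpret prob_space P by fact
  interpret mixing_markov P \<eta> \<kappa> \<phi>\<^sub>0
    by unfold_locales (use assms(12-15) in auto)
  interpret iid_sequence P Z
    by unfold_locales (use assms(9,10) in auto)
  have pos: "0 < lik f \<phi> \<theta> z a b \<epsilon>" for z a b \<epsilon>
    using assms(16)[of z a \<epsilon> b] assms(17)[of z a \<epsilon> b]
    by (simp add: lik_def enn2real_positive_iff)
  interpret smooth_likelihood "lik f \<phi> \<theta>" q
    by unfold_locales (use pos assms(19,20) False in auto)
  interpret hidden_markov_model P \<eta> \<kappa> \<phi>\<^sub>0 Z "lik f \<phi> \<theta>" q Q \<sigma> \<iota>
  proof (intro hidden_markov_model.intro hidden_markov_model_axioms.intro)
    fix r :: real assume "0 < r"
    then obtain c where "2 < c" "(\<lambda>u. prob {\<omega>\<in>space P. log_deriv_bound (lik f \<phi> \<theta>) q (Z 0 \<omega>) r \<ge> u})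
        \<in> O[at_top](\<lambda>u. ln u powr (- c))" using assms(21) by blast
    then show "\<exists>c>1. (\<lambda>u. prob {\<omega>\<in>space P. log_deriv_bound (lik f \<phi> \<theta>) q (Z 0 \<omega>) r \<ge> u})
        \<in> O[at_top](\<lambda>u. ln u powr (- c))" by (intro exI[of _ c]) simp
  next
    show "prob_space Q" by (rule assms(22))
    show "\<sigma> t \<in> measurable Q (count_space UNIV)" for t by (rule assms(23))
    show "distr Q (Pi\<^sub>M UNIV (\<lambda>_. count_space UNIV)) (\<lambda>v t. \<sigma> t v) =
         distr P (Pi\<^sub>M UNIV (\<lambda>_. count_space UNIV)) (\<lambda>\<omega> t. \<eta> t \<omega>)" by (rule assms(24))
  qed unfold_locales
  show ?thesis
  proof (intro conjI allI impI)
    show "AE \<omega> in P. \<forall>\<nu> a. \<nu> \<noteq> (\<lambda>_. 0) \<and> mi_size \<nu> \<le> q \<longrightarrow> (\<forall>d\<in>{1, -1}.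
        (\<forall>n. mderiv_exists \<nu> (\<Lambda> \<omega> d n a)) \<and>
        (\<forall>K. compact K \<longrightarrow> uniformly_convergent_on K (\<lambda>n. mderiv \<nu> (\<Lambda> \<omega> d n a))))"
      using AE_uniform_convergence by eventually_elim blast
  qed (unfold Lambda_lim_def, rule geometric_rate, rule conjunct2)
qed

end
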